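(* Let $k\subseteq\mathbb C$ be a subfield, $p$ a prime and $n\ge1$. Any $v_n$-torsion element in an $ABP_{**}ABP$-comodule is also a $v_{n-1}$-torsion element.
   Context: Work in the motivic stable homotopy category $\mathcal{SH}(k)$. Let $MGL$ be the algebraic cobordism spectrum and $a_i\in MGL_{2i,i}$ ($i\ge1$) the images, under the canonical ring map $MU_*\to MGL_{2*,*}$, of suitable polynomial generators $a_i^{top}\in MU_{2i}$ of $MU_*$, such that the $a_i^{top}$ with $i\ne p^j-1$ generate in $(MU_* )_{(p)}$ the vanishing ideal for $p$-typical formal group laws. $ABP=MGL_{(p)}/(a_i\mid i\neq p^j-1)$ is the motivic Brown-Peterson spectrum at $p$ (a commutative ring spectrum up to homotopy), and $v_0=p$, $v_i=a_{p^i-1}\in ABP_{2(p^i-1),p^i-1}$ for $i\ge1$. The pair $(ABP_{**},ABP_{**}ABP)$ is a flat Hopf algebroid, with $ABP_{**}ABP\cong ABP_{**}\otimes_{BP_*}BP_*BP$; a comodule means a comodule over this Hopf algebroid (a left $ABP_{**}$-module $M$ with a counital coassociative coaction $M\to ABP_{**}ABP\otimes_{ABP_{**}}M$). An element $x$ of an $ABP_{**}$-module is $v_n$-torsion if $v_n^jx=0$ for some $j\ge1$. *)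

theory Defs
  imports
    Complex_Main
    "HOL-Algebra.Module"
    "HOL-Algebra.AbelCoset"
    "HOL-Library.Poly_Mapping"
    "HOL-Computational_Algebra.Primes"
begin

section \<open>Tensor products over a possibly non-commutative ring\<close>

text \<open>
  Coefficient rings of motivic ring spectra are only graded commutative, so the tensor product
  of a right and a left module is needed. The list
  \<open>[(x\<^sub>1, y\<^sub>1), \<dots>, (x\<^sub>r, y\<^sub>r)]\<close> stands for the sum of the \<open>x\<^sub>i \<otimes> y\<^sub>i\<close>, and elements of the tensor
  product are classes of such lists. Negatives are
  represented by \<open>- (x \<otimes> y) = (- x) \<otimes> y\<close>.
\<close>

inductive sum_cong :: "'e set \<Rightarrow> ('e list \<Rightarrow> 'e list \<Rightarrow> bool) \<Rightarrow> 'e list \<Rightarrow> 'e list \<Rightarrow> bool"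
  for E and step
  where
    base: "step s t \<Longrightarrow> sum_cong E step s t"
  | refl: "s \<in> lists E \<Longrightarrow> sum_cong E step s s"
  | sym: "sum_cong E step s t \<Longrightarrow> sum_cong E step t s"
  | trans: "sum_cong E step s t \<Longrightarrow> sum_cong E step t u \<Longrightarrow> sum_cong E step s u"
  | app: "sum_cong E step s t \<Longrightarrow> sum_cong E step s' t' \<Longrightarrow> sum_cong E step (s @ s') (t @ t')"
  | comm: "s \<in> lists E \<Longrightarrow> t \<in> lists E \<Longrightarrow> sum_cong E step (s @ t) (t @ s)"

text \<open>Here \<open>U\<close> is a right module with action \<open>ra\<close> and \<open>Y\<close> a left module with action \<open>la\<close> over
  \<open>R\<close>; only the additive structure of \<open>U\<close> and \<open>Y\<close> is used.\<close>

inductive tensor_step ::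
  "('r, 'c) ring_scheme \<Rightarrow> ('x, 'd) ring_scheme \<Rightarrow> ('x \<Rightarrow> 'r \<Rightarrow> 'x) \<Rightarrow>
   ('y, 'e) ring_scheme \<Rightarrow> ('r \<Rightarrow> 'y \<Rightarrow> 'y) \<Rightarrow> ('x \<times> 'y) list \<Rightarrow> ('x \<times> 'y) list \<Rightarrow> bool"
  for R U ra Y la
  where
    zero: "y \<in> carrier Y \<Longrightarrow> tensor_step R U ra Y la [(\<zero>\<^bsub>U\<^esub>, y)] []"
  | add_left: "x \<in> carrier U \<Longrightarrow> x' \<in> carrier U \<Longrightarrow> y \<in> carrier Y \<Longrightarrow>
      tensor_step R U ra Y la [(x \<oplus>\<^bsub>U\<^esub> x', y)] [(x, y), (x', y)]"
  | add_right: "x \<in> carrier U \<Longrightarrow> y \<in> carrier Y \<Longrightarrow> y' \<in> carrier Y \<Longrightarrow>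
      tensor_step R U ra Y la [(x, y \<oplus>\<^bsub>Y\<^esub> y')] [(x, y), (x, y')]"
  | balance: "x \<in> carrier U \<Longrightarrow> r \<in> carrier R \<Longrightarrow> y \<in> carrier Y \<Longrightarrow>
      tensor_step R U ra Y la [(ra x r, y)] [(x, la r y)]"

definition tensor_eq ::
  "('r, 'c) ring_scheme \<Rightarrow> ('x, 'd) ring_scheme \<Rightarrow> ('x \<Rightarrow> 'r \<Rightarrow> 'x) \<Rightarrow>
   ('y, 'e) ring_scheme \<Rightarrow> ('r \<Rightarrow> 'y \<Rightarrow> 'y) \<Rightarrow> ('x \<times> 'y) list \<Rightarrow> ('x \<times> 'y) list \<Rightarrow> bool"
  where "tensor_eq R U ra Y la = sum_cong (carrier U \<times> carrier Y) (tensor_step R U ra Y la)"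

definition tensor ::
  "('r, 'c) ring_scheme \<Rightarrow> ('x, 'd) ring_scheme \<Rightarrow> ('x \<Rightarrow> 'r \<Rightarrow> 'x) \<Rightarrow>
   ('y, 'e) ring_scheme \<Rightarrow> ('r \<Rightarrow> 'y \<Rightarrow> 'y) \<Rightarrow> ('x \<times> 'y) list set set"
  where "tensor R U ra Y la =
    lists (carrier U \<times> carrier Y) // {(s, t). tensor_eq R U ra Y la s t}"

text \<open>The threefold tensor product of \<open>U\<close>, an \<open>R\<close>-bimodule \<open>U'\<close> with actions \<open>la'\<close>, \<open>ra'\<close>,
  and \<open>Y\<close>.\<close>

inductive tensor3_step ::
  "('r, 'c) ring_scheme \<Rightarrow> ('x, 'd) ring_scheme \<Rightarrow> ('x \<Rightarrow> 'r \<Rightarrow> 'x) \<Rightarrow>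
   ('z, 'f) ring_scheme \<Rightarrow> ('r \<Rightarrow> 'z \<Rightarrow> 'z) \<Rightarrow> ('z \<Rightarrow> 'r \<Rightarrow> 'z) \<Rightarrow>
   ('y, 'e) ring_scheme \<Rightarrow> ('r \<Rightarrow> 'y \<Rightarrow> 'y) \<Rightarrow>
   ('x \<times> 'z \<times> 'y) list \<Rightarrow> ('x \<times> 'z \<times> 'y) list \<Rightarrow> bool"
  for R U ra U' la' ra' Y la
  where
    zero: "z \<in> carrier U' \<Longrightarrow> y \<in> carrier Y \<Longrightarrow>
      tensor3_step R U ra U' la' ra' Y la [(\<zero>\<^bsub>U\<^esub>, z, y)] []"
  | add1: "x \<in> carrier U \<Longrightarrow> x' \<in> carrier U \<Longrightarrow> z \<in> carrier U' \<Longrightarrow> y \<in> carrier Y \<Longrightarrow>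
      tensor3_step R U ra U' la' ra' Y la [(x \<oplus>\<^bsub>U\<^esub> x', z, y)] [(x, z, y), (x', z, y)]"
  | add2: "x \<in> carrier U \<Longrightarrow> z \<in> carrier U' \<Longrightarrow> z' \<in> carrier U' \<Longrightarrow> y \<in> carrier Y \<Longrightarrow>
      tensor3_step R U ra U' la' ra' Y la [(x, z \<oplus>\<^bsub>U'\<^esub> z', y)] [(x, z, y), (x, z', y)]"
  | add3: "x \<in> carrier U \<Longrightarrow> z \<in> carrier U' \<Longrightarrow> y \<in> carrier Y \<Longrightarrow> y' \<in> carrier Y \<Longrightarrow>
      tensor3_step R U ra U' la' ra' Y la [(x, z, y \<oplus>\<^bsub>Y\<^esub> y')] [(x, z, y), (x, z, y')]"
  | balance1: "x \<in> carrier U \<Longrightarrow> r \<in> carrier R \<Longrightarrow> z \<in> carrier U' \<Longrightarrow> y \<in> carrier Y \<Longrightarrow>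
      tensor3_step R U ra U' la' ra' Y la [(ra x r, z, y)] [(x, la' r z, y)]"
  | balance2: "x \<in> carrier U \<Longrightarrow> z \<in> carrier U' \<Longrightarrow> r \<in> carrier R \<Longrightarrow> y \<in> carrier Y \<Longrightarrow>
      tensor3_step R U ra U' la' ra' Y la [(x, ra' z r, y)] [(x, z, la r y)]"

definition tensor3_eq ::
  "('r, 'c) ring_scheme \<Rightarrow> ('x, 'd) ring_scheme \<Rightarrow> ('x \<Rightarrow> 'r \<Rightarrow> 'x) \<Rightarrow>
   ('z, 'f) ring_scheme \<Rightarrow> ('r \<Rightarrow> 'z \<Rightarrow> 'z) \<Rightarrow> ('z \<Rightarrow> 'r \<Rightarrow> 'z) \<Rightarrow>
   ('y, 'e) ring_scheme \<Rightarrow> ('r \<Rightarrow> 'y \<Rightarrow> 'y) \<Rightarrow>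
   ('x \<times> 'z \<times> 'y) list \<Rightarrow> ('x \<times> 'z \<times> 'y) list \<Rightarrow> bool"
  where "tensor3_eq R U ra U' la' ra' Y la =
    sum_cong (carrier U \<times> carrier U' \<times> carrier Y) (tensor3_step R U ra U' la' ra' Y la)"

definition list_sum :: "('a, 'c) ring_scheme \<Rightarrow> 'a list \<Rightarrow> 'a"
  where "list_sum R xs = foldr (\<lambda>x y. x \<oplus>\<^bsub>R\<^esub> y) xs \<zero>\<^bsub>R\<^esub>"


section \<open>Bigraded rings and left modules\<close>

text \<open>Bidegrees are pairs (topological degree, weight); the commutation sign is governed by the
  topological degree, as for modules over the algebraic cobordism spectrum.\<close>

definition koszul :: "('a, 'c) ring_scheme \<Rightarrow> int \<Rightarrow> 'a \<Rightarrow> 'a"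
  where "koszul R e x = (if even e then x else \<ominus>\<^bsub>R\<^esub> x)"

locale bigraded_ring = ring R for R (structure) +
  fixes G :: "int \<Rightarrow> int \<Rightarrow> 'a set"
  assumes subgroup: "additive_subgroup (G s w) R"
    and one_degree: "\<one> \<in> G 0 0"
    and mult_degree: "x \<in> G s w \<Longrightarrow> y \<in> G s' w' \<Longrightarrow> x \<otimes> y \<in> G (s + s') (w + w')"
    and spans: "x \<in> carrier R \<Longrightarrow>
      \<exists>F f. finite F \<and> (\<forall>(s, w)\<in>F. f (s, w) \<in> G s w) \<and> x = (\<Oplus>d\<in>F. f d)"
    and independent: "finite F \<Longrightarrow> (\<And>s w. (s, w) \<in> F \<Longrightarrow> f (s, w) \<in> G s w) \<Longrightarrow>
      (\<Oplus>d\<in>F. f d) = \<zero> \<Longrightarrow> d \<in> F \<Longrightarrow> f d = \<zero>"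
    and graded_commute: "x \<in> G s w \<Longrightarrow> y \<in> G s' w' \<Longrightarrow> x \<otimes> y = koszul R (s * s') (y \<otimes> x)"

text \<open>The library locale \<open>module\<close> requires a commutative base ring.\<close>

locale left_module = R?: ring R + M?: abelian_group M for R (structure) and M (structure) +
  assumes smult_closed: "a \<in> carrier R \<Longrightarrow> x \<in> carrier M \<Longrightarrow> a \<odot>\<^bsub>M\<^esub> x \<in> carrier M"
    and smult_l_distr: "a \<in> carrier R \<Longrightarrow> b \<in> carrier R \<Longrightarrow> x \<in> carrier M \<Longrightarrow>
      (a \<oplus>\<^bsub>R\<^esub> b) \<odot>\<^bsub>M\<^esub> x = a \<odot>\<^bsub>M\<^esub> x \<oplus>\<^bsub>M\<^esub> b \<odot>\<^bsub>M\<^esub> x"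
    and smult_r_distr: "a \<in> carrier R \<Longrightarrow> x \<in> carrier M \<Longrightarrow> y \<in> carrier M \<Longrightarrow>
      a \<odot>\<^bsub>M\<^esub> (x \<oplus>\<^bsub>M\<^esub> y) = a \<odot>\<^bsub>M\<^esub> x \<oplus>\<^bsub>M\<^esub> a \<odot>\<^bsub>M\<^esub> y"
    and smult_assoc: "a \<in> carrier R \<Longrightarrow> b \<in> carrier R \<Longrightarrow> x \<in> carrier M \<Longrightarrow>
      (a \<otimes>\<^bsub>R\<^esub> b) \<odot>\<^bsub>M\<^esub> x = a \<odot>\<^bsub>M\<^esub> (b \<odot>\<^bsub>M\<^esub> x)"
    and smult_one: "x \<in> carrier M \<Longrightarrow> \<one>\<^bsub>R\<^esub> \<odot>\<^bsub>M\<^esub> x = x"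


section \<open>Hopf algebroids and comodules\<close>

record ('a, 'g) hopf_data =
  base :: "'a ring"
  base_gr :: "int \<Rightarrow> int \<Rightarrow> 'a set"
  total :: "'g ring"
  total_gr :: "int \<Rightarrow> int \<Rightarrow> 'g set"
  lunit :: "'a \<Rightarrow> 'g"
  runit :: "'a \<Rightarrow> 'g"
  counit :: "'g \<Rightarrow> 'a"
  conj :: "'g \<Rightarrow> 'g"
  comult :: "'g \<Rightarrow> ('g \<times> 'g) list set"

text \<open>The total ring is a bimodule over the base: on the left through the left unit, on the right
  through the right unit.\<close>

definition lact :: "('a, 'g) hopf_data \<Rightarrow> 'a \<Rightarrow> 'g \<Rightarrow> 'g"
  where "lact H a g = lunit H a \<otimes>\<^bsub>total H\<^esub> g"

definition ract :: "('a, 'g) hopf_data \<Rightarrow> 'g \<Rightarrow> 'a \<Rightarrow> 'g"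
  where "ract H g a = g \<otimes>\<^bsub>total H\<^esub> runit H a"

definition total_tensor ::
  "('a, 'g) hopf_data \<Rightarrow> ('y, 'e) ring_scheme \<Rightarrow> ('a \<Rightarrow> 'y \<Rightarrow> 'y) \<Rightarrow> ('g \<times> 'y) list set set"
  where "total_tensor H Y la = tensor (base H) (total H) (ract H) Y la"

text \<open>\<open>(\<Delta> \<otimes> 1) \<circ> \<psi> = (1 \<otimes> \<psi>) \<circ> \<psi>\<close>; \<open>D\<close> and \<open>P\<close> are choices of representatives of the values
  of \<open>\<Delta>\<close> and \<open>\<psi>\<close>.\<close>

definition coassociative ::
  "('a, 'g) hopf_data \<Rightarrow> ('y, 'e) ring_scheme \<Rightarrow> ('a \<Rightarrow> 'y \<Rightarrow> 'y) \<Rightarrow>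
   ('y \<Rightarrow> ('g \<times> 'y) list set) \<Rightarrow> bool"
  where "coassociative H Y la \<psi> \<longleftrightarrow>
    (\<forall>y\<in>carrier Y. \<forall>s\<in>\<psi> y. \<forall>D P.
      (\<forall>g\<in>carrier (total H). D g \<in> comult H g) \<longrightarrow> (\<forall>z\<in>carrier Y. P z \<in> \<psi> z) \<longrightarrow>
      tensor3_eq (base H) (total H) (ract H) (total H) (lact H) (ract H) Y la
        [(g', g'', z). (g, z) \<leftarrow> s, (g', g'') \<leftarrow> D g]
        [(g, h, z'). (g, z) \<leftarrow> s, (h, z') \<leftarrow> P z])"

locale hopf_algebroid =
  fixes H :: "('a, 'g) hopf_data"
  assumes base_ring: "bigraded_ring (base H) (base_gr H)"
    and total_ring: "bigraded_ring (total H) (total_gr H)"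
    and lunit_hom: "lunit H \<in> ring_hom (base H) (total H)"
    and runit_hom: "runit H \<in> ring_hom (base H) (total H)"
    and counit_hom: "counit H \<in> ring_hom (total H) (base H)"
    and conj_hom: "conj H \<in> ring_hom (total H) (total H)"
    and lunit_degree: "a \<in> base_gr H i j \<Longrightarrow> lunit H a \<in> total_gr H i j"
    and runit_degree: "a \<in> base_gr H i j \<Longrightarrow> runit H a \<in> total_gr H i j"
    and counit_degree: "g \<in> total_gr H i j \<Longrightarrow> counit H g \<in> base_gr H i j"
    and conj_degree: "g \<in> total_gr H i j \<Longrightarrow> conj H g \<in> total_gr H i j"
    and counit_lunit: "a \<in> carrier (base H) \<Longrightarrow> counit H (lunit H a) = a"
    and counit_runit: "a \<in> carrier (base H) \<Longrightarrow> counit H (runit H a) = a"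
    and conj_lunit: "a \<in> carrier (base H) \<Longrightarrow> conj H (lunit H a) = runit H a"
    and conj_runit: "a \<in> carrier (base H) \<Longrightarrow> conj H (runit H a) = lunit H a"
    and conj_conj: "g \<in> carrier (total H) \<Longrightarrow> conj H (conj H g) = g"
    and comult_closed: "g \<in> carrier (total H) \<Longrightarrow>
      comult H g \<in> total_tensor H (total H) (lact H)"
    and comult_degree: "g \<in> total_gr H i j \<Longrightarrow>
      \<exists>s\<in>comult H g. \<forall>(x, y)\<in>set s. \<exists>i' j'. x \<in> total_gr H i' j' \<and> y \<in> total_gr H (i - i') (j - j')"
    and comult_add: "g \<in> carrier (total H) \<Longrightarrow> h \<in> carrier (total H) \<Longrightarrow>
      s \<in> comult H g \<Longrightarrow> t \<in> comult H h \<Longrightarrow> s @ t \<in> comult H (g \<oplus>\<^bsub>total H\<^esub> h)"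
    \<comment> \<open>\<open>(x \<otimes> y) (x' \<otimes> y') = (-1)\<^bsup>|y| |x'|\<^esup> x x' \<otimes> y y'\<close>; the function \<open>d\<close> records topological degrees.\<close>
    and comult_mult: "g \<in> carrier (total H) \<Longrightarrow> h \<in> carrier (total H) \<Longrightarrow>
      s \<in> comult H g \<Longrightarrow> t \<in> comult H h \<Longrightarrow>
      (\<And>x y. (x, y) \<in> set s \<Longrightarrow> \<exists>w. y \<in> total_gr H (d y) w) \<Longrightarrow>
      (\<And>x y. (x, y) \<in> set t \<Longrightarrow> \<exists>w. x \<in> total_gr H (d x) w) \<Longrightarrow>
      [(koszul (total H) (d y * d x') (x \<otimes>\<^bsub>total H\<^esub> x'), y \<otimes>\<^bsub>total H\<^esub> y').
         (x, y) \<leftarrow> s, (x', y') \<leftarrow> t] \<in> comult H (g \<otimes>\<^bsub>total H\<^esub> h)"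
    and comult_lunit: "a \<in> carrier (base H) \<Longrightarrow> [(lunit H a, \<one>\<^bsub>total H\<^esub>)] \<in> comult H (lunit H a)"
    and comult_runit: "a \<in> carrier (base H) \<Longrightarrow> [(\<one>\<^bsub>total H\<^esub>, runit H a)] \<in> comult H (runit H a)"
    and counit_left: "g \<in> carrier (total H) \<Longrightarrow> s \<in> comult H g \<Longrightarrow>
      list_sum (total H) [lact H (counit H x) y. (x, y) \<leftarrow> s] = g"
    and counit_right: "g \<in> carrier (total H) \<Longrightarrow> s \<in> comult H g \<Longrightarrow>
      list_sum (total H) [ract H x (counit H y). (x, y) \<leftarrow> s] = g"
    and coassoc: "coassociative H (total H) (lact H) (comult H)"
    and conj_left: "g \<in> carrier (total H) \<Longrightarrow> s \<in> comult H g \<Longrightarrow>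
      list_sum (total H) [conj H x \<otimes>\<^bsub>total H\<^esub> y. (x, y) \<leftarrow> s] = runit H (counit H g)"
    and conj_right: "g \<in> carrier (total H) \<Longrightarrow> s \<in> comult H g \<Longrightarrow>
      list_sum (total H) [x \<otimes>\<^bsub>total H\<^esub> conj H y. (x, y) \<leftarrow> s] = lunit H (counit H g)"

locale comodule = left_module "base H" M
  for H :: "('a, 'g) hopf_data" and M :: "('a, 'm) module" +
  fixes \<psi> :: "'m \<Rightarrow> ('g \<times> 'm) list set"
  assumes coact_closed: "x \<in> carrier M \<Longrightarrow> \<psi> x \<in> total_tensor H M (smult M)"
    and coact_add: "x \<in> carrier M \<Longrightarrow> y \<in> carrier M \<Longrightarrow>
      s \<in> \<psi> x \<Longrightarrow> t \<in> \<psi> y \<Longrightarrow> s @ t \<in> \<psi> (x \<oplus>\<^bsub>M\<^esub> y)"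
    and coact_smult: "a \<in> carrier (base H) \<Longrightarrow> x \<in> carrier M \<Longrightarrow> s \<in> \<psi> x \<Longrightarrow>
      [(lact H a g, z). (g, z) \<leftarrow> s] \<in> \<psi> (a \<odot>\<^bsub>M\<^esub> x)"
    and coact_counit: "x \<in> carrier M \<Longrightarrow> s \<in> \<psi> x \<Longrightarrow>
      list_sum M [counit H g \<odot>\<^bsub>M\<^esub> z. (g, z) \<leftarrow> s] = x"
    and coact_coassoc: "coassociative H M (smult M) \<psi>"

definition torsion_element :: "('a, 'c) ring_scheme \<Rightarrow> ('a, 'm, 'd) module_scheme \<Rightarrow> 'a \<Rightarrow> 'm \<Rightarrow> bool"
  where "torsion_element A M v x \<longleftrightarrow> (\<exists>j\<ge>1. (v [^]\<^bsub>A\<^esub> (j::nat)) \<odot>\<^bsub>M\<^esub> x = \<zero>\<^bsub>M\<^esub>)"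


section \<open>The Hopf algebroid of the topological Brown-Peterson spectrum\<close>

text \<open>
  \<open>BP\<^sub>*\<close> is realised inside the rational polynomial ring on the logarithm coefficients
  \<open>\<ell>\<^sub>1, \<ell>\<^sub>2, \<dots>\<close> of the universal \<open>p\<close>-typical formal group law, as the
  polynomial ring over the integers localised at \<open>p\<close> on the Hazewinkel generators. \<open>BP\<^sub>*BP\<close> adjoins \<open>t\<^sub>1, t\<^sub>2, \<dots>\<close>; since
  \<open>BP\<^sub>*BP \<otimes> BP\<^sub>*BP = BP\<^sub>*[t\<^sub>i \<otimes> 1, 1 \<otimes> t\<^sub>i]\<close>, a second family of variables \<open>T2\<close> for the
  \<open>1 \<otimes> t\<^sub>i\<close> suffices to describe the diagonal. The variables with index \<open>0\<close> are
  never used: \<open>\<ell>\<^sub>0 = t\<^sub>0 = 1\<close>.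
\<close>

datatype bp_var = Log nat | T nat | T2 nat

type_synonym bp_poly = "(bp_var \<Rightarrow>\<^sub>0 nat) \<Rightarrow>\<^sub>0 rat"

definition bp_const :: "rat \<Rightarrow> bp_poly"
  where "bp_const c = Poly_Mapping.single 0 c"

definition bp_X :: "bp_var \<Rightarrow> bp_poly"
  where "bp_X v = Poly_Mapping.single (Poly_Mapping.single v 1) 1"

definition bp_subst :: "(bp_var \<Rightarrow> bp_poly) \<Rightarrow> bp_poly \<Rightarrow> bp_poly"
  where "bp_subst f P = (\<Sum>m\<in>Poly_Mapping.keys P. bp_const (Poly_Mapping.lookup P m) *
    (\<Prod>v\<in>Poly_Mapping.keys m. f v ^ Poly_Mapping.lookup m v))"

definition log_c :: "nat \<Rightarrow> bp_poly"
  where "log_c n = (if n = 0 then 1 else bp_X (Log n))"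

definition tt :: "nat \<Rightarrow> bp_poly"
  where "tt n = (if n = 0 then 1 else bp_X (T n))"

definition tt2 :: "nat \<Rightarrow> bp_poly"
  where "tt2 n = (if n = 0 then 1 else bp_X (T2 n))"

definition localised_int :: "nat \<Rightarrow> rat set"
  where "localised_int p = {of_int a / of_int b | a b. \<not> int p dvd b}"

inductive_set poly_alg :: "nat \<Rightarrow> bp_poly set \<Rightarrow> bp_poly set" for p S
  where
    const: "c \<in> localised_int p \<Longrightarrow> bp_const c \<in> poly_alg p S"
  | gen: "P \<in> S \<Longrightarrow> P \<in> poly_alg p S"
  | add: "P \<in> poly_alg p S \<Longrightarrow> Q \<in> poly_alg p S \<Longrightarrow> P + Q \<in> poly_alg p S"
  | mult: "P \<in> poly_alg p S \<Longrightarrow> Q \<in> poly_alg p S \<Longrightarrow> P * Q \<in> poly_alg p S"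

text \<open>Hazewinkel's relation \<open>p \<ell>\<^sub>n = \<Sum>\<^bsub>0 \<le> i < n\<^esub> \<ell>\<^sub>i v\<^bsub>n-i\<^esub>\<^bsup>p^i\<^esup>\<close>, solved for \<open>v\<^sub>n\<close>.\<close>

fun hazewinkel :: "nat \<Rightarrow> nat \<Rightarrow> bp_poly"
  where "hazewinkel p n =
    of_nat p * log_c n - (\<Sum>i\<in>{1..<n}. log_c i * hazewinkel p (n - i) ^ (p ^ i))"

declare hazewinkel.simps [simp del]

definition BP :: "nat \<Rightarrow> bp_poly set"
  where "BP p = poly_alg p {hazewinkel p n | n. n \<ge> 1}"

definition BPBP :: "nat \<Rightarrow> bp_poly set"
  where "BPBP p = poly_alg p ({hazewinkel p n | n. n \<ge> 1} \<union> {tt n | n. n \<ge> 1})"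

definition poly_ring :: "bp_poly set \<Rightarrow> bp_poly ring"
  where "poly_ring S = \<lparr>carrier = S, monoid.mult = (*), one = 1, zero = 0, add = (+)\<rparr>"

text \<open>Half the topological degree: \<open>\<ell>\<^sub>n\<close>, \<open>v\<^sub>n\<close> and \<open>t\<^sub>n\<close> have topological degree \<open>2 (p\<^sup>n - 1)\<close>.\<close>

fun var_weight :: "nat \<Rightarrow> bp_var \<Rightarrow> nat"
  where
    "var_weight p (Log n) = p ^ n - 1"
  | "var_weight p (T n) = p ^ n - 1"
  | "var_weight p (T2 n) = p ^ n - 1"

definition bp_homogeneous :: "nat \<Rightarrow> nat \<Rightarrow> bp_poly \<Rightarrow> bool"
  where "bp_homogeneous p e P \<longleftrightarrow> (\<forall>m\<in>Poly_Mapping.keys P.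
    (\<Sum>v\<in>Poly_Mapping.keys m. Poly_Mapping.lookup m v * var_weight p v) = e)"

text \<open>The right unit \<open>\<eta>\<^sub>R(\<ell>\<^sub>n) = \<Sum>\<^bsub>i+j=n\<^esub> \<ell>\<^sub>i t\<^sub>j\<^bsup>p^i\<^esup>\<close> on \<open>BP\<^sub>*\<close> (the left unit is the inclusion)\<close>

definition log_right :: "nat \<Rightarrow> nat \<Rightarrow> bp_poly"
  where "log_right p n = (\<Sum>i\<le>n. log_c i * tt (n - i) ^ (p ^ i))"

definition bp_runit :: "nat \<Rightarrow> bp_poly \<Rightarrow> bp_poly"
  where "bp_runit p = bp_subst (\<lambda>v. case v of Log n \<Rightarrow> log_right p n | _ \<Rightarrow> bp_X v)"

definition bp_counit :: "bp_poly \<Rightarrow> bp_poly"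
  where "bp_counit = bp_subst (\<lambda>v. case v of Log n \<Rightarrow> bp_X v | _ \<Rightarrow> 0)"

text \<open>The diagonal is determined by
  \<open>\<Sum>\<^bsub>i+j=n\<^esub> \<ell>\<^sub>i \<Delta>(t\<^sub>j)\<^bsup>p^i\<^esup> = \<Sum>\<^bsub>i+j+k=n\<^esub> \<ell>\<^sub>i t\<^sub>j\<^bsup>p^i\<^esup> \<otimes> t\<^sub>k\<^bsup>p^(i+j)\<^esup>\<close>.\<close>

fun t_diag :: "nat \<Rightarrow> nat \<Rightarrow> bp_poly"
  where "t_diag p n =
    (\<Sum>i\<le>n. \<Sum>j\<le>n - i. log_c i * tt j ^ (p ^ i) * tt2 (n - i - j) ^ (p ^ (i + j)))
    - (\<Sum>i\<in>{1..n}. log_c i * t_diag p (n - i) ^ (p ^ i))"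

declare t_diag.simps [simp del]

definition bp_diag :: "nat \<Rightarrow> bp_poly \<Rightarrow> bp_poly"
  where "bp_diag p = bp_subst (\<lambda>v. case v of T n \<Rightarrow> t_diag p n | _ \<Rightarrow> bp_X v)"

text \<open>The conjugation is determined by \<open>c(\<ell>\<^sub>n) = \<eta>\<^sub>R(\<ell>\<^sub>n)\<close> and
  \<open>\<Sum>\<^bsub>i+j+k=n\<^esub> \<ell>\<^sub>i t\<^sub>j\<^bsup>p^i\<^esup> c(t\<^sub>k)\<^bsup>p^(i+j)\<^esup> = \<ell>\<^sub>n\<close>.\<close>

fun t_conj :: "nat \<Rightarrow> nat \<Rightarrow> bp_poly"
  where "t_conj p n = log_c n -
    (\<Sum>k\<in>{0..<n}. \<Sum>i\<le>n - k. log_c i * tt (n - k - i) ^ (p ^ i) * t_conj p k ^ (p ^ (n - k)))"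

declare t_conj.simps [simp del]

definition bp_conj :: "nat \<Rightarrow> bp_poly \<Rightarrow> bp_poly"
  where "bp_conj p = bp_subst (\<lambda>v. case v of Log n \<Rightarrow> log_right p n | T n \<Rightarrow> t_conj p n
    | T2 n \<Rightarrow> bp_X v)"

text \<open>The inclusion \<open>y \<mapsto> 1 \<otimes> y\<close> of the second tensor factor; \<open>x \<otimes> y\<close> corresponds to
  \<open>x * bp_second p y\<close>.\<close>

definition bp_second :: "nat \<Rightarrow> bp_poly \<Rightarrow> bp_poly"
  where "bp_second p = bp_subst (\<lambda>v. case v of Log n \<Rightarrow> log_right p n | T n \<Rightarrow> tt2 n
    | T2 n \<Rightarrow> bp_X v)"

text \<open>\<open>BP\<^sub>* = \<int>\<^bsub>(p)\<^esub>[w\<^sub>1, w\<^sub>2, \<dots>]\<close> with \<open>w\<^sub>i\<close> of degree \<open>2 (p\<^sup>i - 1)\<close>, and \<open>w\<^sub>0 = p\<close>.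
  The images of the generators \<open>a\<^bsub>p^i-1\<^esub>\<close> of \<open>MU\<^sub>*\<close> under \<open>MU\<^sub>* \<rightarrow> BP\<^sub>*\<close> are such a system.\<close>

definition bp_generators :: "nat \<Rightarrow> (nat \<Rightarrow> bp_poly) \<Rightarrow> bool"
  where "bp_generators p w \<longleftrightarrow>
    w 0 = of_nat p \<and>
    (\<forall>i\<ge>1. w i \<in> BP p \<and> bp_homogeneous p (p ^ i - 1) (w i)) \<and>
    BP p = poly_alg p {w i | i. i \<ge> 1} \<and>
    inj_on (bp_subst (\<lambda>v. case v of Log n \<Rightarrow> w n | _ \<Rightarrow> 0)) (poly_alg p {bp_X (Log n) | n. n \<ge> 1})"


section \<open>Hopf algebroids of Brown-Peterson type\<close>

text \<open>
  This locale records what is known about the pair \<open>(ABP\<^sub>*\<^sub>*, ABP\<^sub>*\<^sub>*ABP)\<close> of the motivic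
  Brown-Peterson spectrum: it is a Hopf algebroid receiving a
  map \<open>(\<phi>, \<Phi>)\<close> of Hopf algebroids from \<open>(BP\<^sub>*, BP\<^sub>*BP)\<close>, which places
  topological degree \<open>2 e\<close> in bidegree \<open>(2 e, e)\<close>, and the induced map
  \<open>ABP\<^sub>*\<^sub>* \<otimes> BP\<^sub>*BP \<rightarrow> ABP\<^sub>*\<^sub>*ABP\<close> over \<open>BP\<^sub>*\<close> is bijective. Flatness follows, because
  \<open>BP\<^sub>*BP\<close> is free over \<open>BP\<^sub>*\<close> and the conjugation exchanges the two units.
  The motivic homotopy category is not constructed: a base field \<open>k\<close> enters only through the
  pair it determines. The right unit need not be the one extended trivially from \<open>BP\<^sub>*\<close>.
\<close>

locale motivic_bp_hopf_algebroid = hopf_algebroid H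
  for H :: "('a, 'g) hopf_data" +
  fixes p :: nat and \<phi> :: "bp_poly \<Rightarrow> 'a" and \<Phi> :: "bp_poly \<Rightarrow> 'g"
  assumes p_prime: "prime p"
    and base_hom: "\<phi> \<in> ring_hom (poly_ring (BP p)) (base H)"
    and total_hom: "\<Phi> \<in> ring_hom (poly_ring (BPBP p)) (total H)"
    and base_hom_degree: "b \<in> BP p \<Longrightarrow> bp_homogeneous p e b \<Longrightarrow>
      \<phi> b \<in> base_gr H (2 * int e) (int e)"
    and total_hom_degree: "b \<in> BPBP p \<Longrightarrow> bp_homogeneous p e b \<Longrightarrow>
      \<Phi> b \<in> total_gr H (2 * int e) (int e)"
    and hom_lunit: "b \<in> BP p \<Longrightarrow> \<Phi> b = lunit H (\<phi> b)"
    and hom_runit: "b \<in> BP p \<Longrightarrow> \<Phi> (bp_runit p b) = runit H (\<phi> b)"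
    and hom_counit: "b \<in> BPBP p \<Longrightarrow> \<phi> (bp_counit b) = counit H (\<Phi> b)"
    and hom_conj: "b \<in> BPBP p \<Longrightarrow> \<Phi> (bp_conj p b) = conj H (\<Phi> b)"
    and hom_comult: "b \<in> BPBP p \<Longrightarrow> s \<in> lists (BPBP p \<times> BPBP p) \<Longrightarrow>
      bp_diag p b = (\<Sum>(x, y)\<leftarrow>s. x * bp_second p y) \<Longrightarrow>
      [(\<Phi> x, \<Phi> y). (x, y) \<leftarrow> s] \<in> comult H (\<Phi> b)"
    and base_change_surj: "g \<in> carrier (total H) \<Longrightarrow>
      \<exists>s\<in>lists (carrier (base H) \<times> BPBP p).
        g = list_sum (total H) [lact H a (\<Phi> b). (a, b) \<leftarrow> s]"
    and base_change_inj: "r \<in> lists (carrier (base H) \<times> BPBP p) \<Longrightarrow>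
      list_sum (total H) [lact H a (\<Phi> b). (a, b) \<leftarrow> r] = \<zero>\<^bsub>total H\<^esub> \<Longrightarrow>
      tensor_eq (poly_ring (BP p)) (base H) (\<lambda>a b. a \<otimes>\<^bsub>base H\<^esub> \<phi> b)
        (poly_ring (BPBP p)) (\<lambda>b x. b * x) r []"

end

theory Submission
  imports Defs "HOL-Computational_Algebra.Polynomial"
begin

text \<open>
  Writing the total ring as a free right module over the base (conjugate the isomorphism
  \<open>ABP \<otimes> BP\<^sub>*BP \<rightarrow> ABP\<^sub>*\<^sub>*ABP\<close>) and keeping only the powers of one variable \<open>t\<^sub>m\<close>, a coaction becomes
  a map \<open>M \<rightarrow> M[t]\<close> whose constant coefficient is the identity, by counitality. An element \<open>b\<close> of
  \<open>BP\<^sub>*\<close> acts on the left of \<open>M[t]\<close> by multiplication with the polynomial obtained from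
  \<open>\<eta>\<^sub>R(b)\<close>. So if a power of \<open>w\<^sub>n\<close> kills \<open>x\<close>, then a power of the polynomial of \<open>\<eta>\<^sub>R(w\<^sub>n)\<close> kills
  an element of \<open>M[t]\<close> with constant coefficient \<open>x\<close>, and a leading coefficient argument shows
  that every coefficient of that polynomial acts nilpotently on \<open>x\<close>. The elements of \<open>BP\<^sub>*\<close> that
  act nilpotently on \<open>x\<close> form an ideal, and the coefficient of \<open>t\<^bsub>n-i\<^esub>\<close> to the power \<open>p\<^sup>i\<close> in \<open>\<eta>\<^sub>R(w\<^sub>n)\<close>
  is a unit multiple of \<open>v\<^sub>i\<close> modulo \<open>v\<^sub>1, \<dots>, v\<^bsub>i-1\<^esub>\<close>. By induction this ideal contains
  \<open>v\<^sub>0, \<dots>, v\<^bsub>n-1\<^esub>\<close>, hence \<open>w\<^bsub>n-1\<^esub>\<close>.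

  That \<open>\<eta>\<^sub>R\<close> maps \<open>BP\<^sub>*\<close> to \<open>BP\<^sub>*BP\<close> is not part of the hypotheses. It follows as in
  Hazewinkel's functional equation lemma, from a lift of Frobenius.
\<close>

section \<open>Evaluation of polynomials\<close>

text \<open>The coaction takes values in a tensor product formed over the right unit, whereas the
  base change hypothesis describes the total ring as a left module over the base. Conjugation
  exchanges the two units, and this is why a scalar acting on the left turns into its right unit.
  Since \<open>w\<close> is an arbitrary system of generators, there is no formula for the right
  unit of \<open>w n\<close>. What remains computable is its class modulo \<open>p^2\<close> in the
  larger ring of p-locally integral polynomials in the \<ell>_i. There \<open>w n\<close> is a unit
  times \<open>p * log_c n\<close>, and the right unit of \<open>log_c n\<close>, with every t_j
  except t_m set to zero, has for m \<le> n just two terms: \<open>log_c n\<close>, and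
  \<open>log_c (n - m)\<close> times the power \<open>p ^ (n - m)\<close> of t_m. The choice m = n -
  i isolates \<ell>_i. The base is only graded commutative, and neither is the comodule graded nor
  \<open>x\<close> homogeneous; hence the polynomial argument runs over the commutative ring BP_*,
  which acts through \<open>\<phi>\<close>.\<close>

definition mon_val :: "('v \<Rightarrow> 'b::comm_monoid_mult) \<Rightarrow> ('v \<Rightarrow>\<^sub>0 nat) \<Rightarrow> 'b"
  where "mon_val f m = (\<Prod>v\<in>Poly_Mapping.keys m. f v ^ Poly_Mapping.lookup m v)"

text \<open>The coefficient map \<open>h\<close> is a parameter because the targets differ:
  \<open>bp_subst\<close> is the case \<open>h = bp_const\<close>, while \<open>grade\<close>,
  \<open>lin_part\<close> and \<open>t_part\<close> take values in univariate polynomials. All of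
  them are then ring homomorphisms for the same reason.\<close>

definition mpoly_eval ::
  "('c::zero \<Rightarrow> 'b::comm_ring_1) \<Rightarrow> ('v \<Rightarrow> 'b) \<Rightarrow> (('v \<Rightarrow>\<^sub>0 nat) \<Rightarrow>\<^sub>0 'c) \<Rightarrow> 'b"
  where "mpoly_eval h f P = (\<Sum>m\<in>Poly_Mapping.keys P. h (Poly_Mapping.lookup P m) * mon_val f m)"

lemma mon_val_superset:
  assumes "finite S" "Poly_Mapping.keys m \<subseteq> S"
  shows "mon_val f m = (\<Prod>v\<in>S. f v ^ Poly_Mapping.lookup m v)"
  unfolding mon_val_def
  by (rule prod.mono_neutral_left) (use assms in \<open>auto simp: in_keys_iff\<close>)

lemma mon_val_zero [simp]: "mon_val f 0 = 1"
  by (simp add: mon_val_def)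

lemma mon_val_single [simp]: "mon_val f (Poly_Mapping.single v k) = f v ^ k"
  by (cases "k = 0") (simp_all add: mon_val_def)

lemma mon_val_add: "mon_val f (m + m') = mon_val f m * mon_val f m'"
proof -
  let ?S = "Poly_Mapping.keys m \<union> Poly_Mapping.keys m'"
  have "mon_val f (m + m') = (\<Prod>v\<in>?S. f v ^ Poly_Mapping.lookup (m + m') v)"
    by (rule mon_val_superset) (auto simp: in_keys_iff lookup_add)
  moreover have "mon_val f m = (\<Prod>v\<in>?S. f v ^ Poly_Mapping.lookup m v)"
    by (rule mon_val_superset) auto
  moreover have "mon_val f m' = (\<Prod>v\<in>?S. f v ^ Poly_Mapping.lookup m' v)"
    by (rule mon_val_superset) auto
  ultimately show ?thesis
    by (simp add: lookup_add power_add prod.distrib)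
qed

lemma poly_mapping_sum_single:
  "P = (\<Sum>m\<in>Poly_Mapping.keys P. Poly_Mapping.single m (Poly_Mapping.lookup P m))"
proof (rule poly_mapping_eqI)
  fix k
  have "(\<Sum>m\<in>Poly_Mapping.keys P. Poly_Mapping.lookup P m when m = k) = Poly_Mapping.lookup P k"
    unfolding when_def by (simp add: in_keys_iff)
  then show "Poly_Mapping.lookup P k = Poly_Mapping.lookup
      (\<Sum>m\<in>Poly_Mapping.keys P. Poly_Mapping.single m (Poly_Mapping.lookup P m)) k"
    by (simp add: lookup_sum lookup_single)
qed

locale coeff_hom =
  fixes h :: "'c::comm_ring_1 \<Rightarrow> 'b::comm_ring_1"
  assumes hom_1: "h 1 = 1"
    and hom_add: "h (a + b) = h a + h b"
    and hom_mult: "h (a * b) = h a * h b"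
begin

lemma hom_0 [simp]: "h 0 = 0"
  using hom_add[of 0 0] by simp

lemma eval_superset:
  assumes "finite S" "Poly_Mapping.keys P \<subseteq> S"
  shows "mpoly_eval h f P = (\<Sum>m\<in>S. h (Poly_Mapping.lookup P m) * mon_val f m)"
  unfolding mpoly_eval_def
  by (rule sum.mono_neutral_left) (use assms in \<open>auto simp: in_keys_iff\<close>)

lemma eval_0 [simp]: "mpoly_eval h f 0 = 0"
  by (simp add: mpoly_eval_def)

lemma eval_single [simp]: "mpoly_eval h f (Poly_Mapping.single m c) = h c * mon_val f m"
  by (cases "c = 0") (simp_all add: mpoly_eval_def)

lemma eval_1 [simp]: "mpoly_eval h f 1 = 1"
  using eval_single[of f 0 1] by (simp add: hom_1)

lemma eval_add: "mpoly_eval h f (P + Q) = mpoly_eval h f P + mpoly_eval h f Q"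
proof -
  let ?S = "Poly_Mapping.keys P \<union> Poly_Mapping.keys Q"
  have "mpoly_eval h f (P + Q) =
      (\<Sum>m\<in>?S. h (Poly_Mapping.lookup (P + Q) m) * mon_val f m)"
    by (rule eval_superset) (use keys_add[of P Q] in auto)
  moreover have "mpoly_eval h f P = (\<Sum>m\<in>?S. h (Poly_Mapping.lookup P m) * mon_val f m)"
    by (rule eval_superset) auto
  moreover have "mpoly_eval h f Q = (\<Sum>m\<in>?S. h (Poly_Mapping.lookup Q m) * mon_val f m)"
    by (rule eval_superset) auto
  ultimately show ?thesis
    by (simp add: lookup_add hom_add distrib_right sum.distrib)
qed

lemma eval_sum: "mpoly_eval h f (\<Sum>i\<in>I. P i) = (\<Sum>i\<in>I. mpoly_eval h f (P i))"
  by (induction I rule: infinite_finite_induct) (simp_all add: eval_add)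

lemma eval_mult: "mpoly_eval h f (P * Q) = mpoly_eval h f P * mpoly_eval h f Q"
proof -
  have "P * Q = (\<Sum>m\<in>Poly_Mapping.keys P. Poly_Mapping.single m (Poly_Mapping.lookup P m)) *
      (\<Sum>m\<in>Poly_Mapping.keys Q. Poly_Mapping.single m (Poly_Mapping.lookup Q m))"
    using poly_mapping_sum_single[of P] poly_mapping_sum_single[of Q] by simp
  then show ?thesis
    by (simp add: sum_product eval_sum mult_single hom_mult mon_val_add mpoly_eval_def[of h f P]
        mpoly_eval_def[of h f Q] mult_ac)
qed

end

text \<open>Serves to write composites as evaluations. It identifies the constant coefficient of
  \<open>t_part\<close> with the counit, and gives \<open>t_part\<close> after
  \<open>bp_runit\<close> the form to which the weight count applies.\<close>

lemma hom_mpoly_eval: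
  fixes F :: "'b::comm_ring_1 \<Rightarrow> 'd::comm_ring_1"
  assumes "coeff_hom F"
  shows "F (mpoly_eval h f P) = mpoly_eval (\<lambda>c. F (h c)) (\<lambda>v. F (f v)) P"
proof -
  interpret coeff_hom F by fact
  have pow: "F (x ^ k) = F x ^ k" for x k
    by (induction k) (simp_all add: hom_1 hom_mult)
  have s: "F (\<Sum>i\<in>I. g i) = (\<Sum>i\<in>I. F (g i))" for I and g :: "'x \<Rightarrow> 'b"
    by (induction I rule: infinite_finite_induct) (simp_all add: hom_add)
  have pr: "F (\<Prod>i\<in>I. g i) = (\<Prod>i\<in>I. F (g i))" for I and g :: "'x \<Rightarrow> 'b"
    by (induction I rule: infinite_finite_induct) (simp_all add: hom_1 hom_mult)
  show ?thesis
    unfolding mpoly_eval_def mon_val_def by (simp add: s pr pow hom_mult)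
qed

section \<open>Ring homomorphisms out of the rational polynomial ring\<close>

lemma bp_const_0 [simp]: "bp_const 0 = 0"
  and bp_const_1 [simp]: "bp_const 1 = 1"
  by (simp_all add: bp_const_def)

interpretation bp_const: coeff_hom bp_const
  by unfold_locales (simp_all add: bp_const_def single_add mult_single)

lemma bp_const_uminus: "bp_const (- c) = - bp_const c"
  by (simp add: bp_const_def single_uminus)

lemma bp_const_of_nat: "bp_const (of_nat k) = of_nat k"
  by (simp add: bp_const_def)

lemma bp_const_power: "bp_const (c ^ k) = bp_const c ^ k"
  by (induction k) (simp_all add: bp_const.hom_mult)

lemma bp_subst_eq: "bp_subst = mpoly_eval bp_const"
  by (simp add: fun_eq_iff bp_subst_def mpoly_eval_def mon_val_def)

lemma mpoly_eval_const:
  fixes h :: "rat \<Rightarrow> 'b::comm_ring_1"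
  assumes "coeff_hom h" shows "mpoly_eval h f (bp_const c) = h c"
  unfolding bp_const_def using coeff_hom.eval_single[OF assms, of f 0 c] by simp

lemma mpoly_eval_X:
  fixes h :: "rat \<Rightarrow> 'b::comm_ring_1"
  assumes "coeff_hom h" shows "mpoly_eval h f (bp_X v) = f v"
  unfolding bp_X_def using coeff_hom.eval_single[OF assms, of f "Poly_Mapping.single v 1" 1]
  by (simp add: coeff_hom.hom_1[OF assms])

lemma coeff_hom_mpoly_eval:
  fixes h :: "'c::comm_ring_1 \<Rightarrow> 'b::comm_ring_1" and f :: "'v \<Rightarrow> 'b"
  assumes "coeff_hom h" shows "coeff_hom (mpoly_eval h f)"
  by unfold_locales
    (simp_all add: coeff_hom.eval_1[OF assms] coeff_hom.eval_add[OF assms]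
      coeff_hom.eval_mult[OF assms])

lemma coeff_hom_compose:
  fixes h :: "'a::comm_ring_1 \<Rightarrow> 'b::comm_ring_1" and g :: "'b \<Rightarrow> 'c::comm_ring_1"
  assumes "coeff_hom h" "coeff_hom g" shows "coeff_hom (\<lambda>x. g (h x))"
  using assms unfolding coeff_hom_def by simp

lemma coeff_hom_poly_const: "coeff_hom (\<lambda>c::'a::comm_ring_1. [:c:])"
  by unfold_locales (simp_all add: one_pCons)

lemma coeff_hom_coeff_0: "coeff_hom (\<lambda>P::'a::comm_ring_1 poly. coeff P 0)"
  by unfold_locales (simp_all add: coeff_mult_0)

context coeff_hom
begin

lemma hom_uminus: "h (- a) = - h a"
  using hom_add[of a "- a"] by (simp add: eq_neg_iff_add_eq_0 add.commute)

lemma hom_diff: "h (a - b) = h a - h b"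
  using hom_add[of a "- b"] by (simp add: hom_uminus)

lemma hom_power: "h (a ^ k) = h a ^ k"
  by (induction k) (simp_all add: hom_1 hom_mult)

lemma hom_sum: "h (\<Sum>i\<in>I. g i) = (\<Sum>i\<in>I. h (g i))"
  by (induction I rule: infinite_finite_induct) (simp_all add: hom_add)

lemma hom_of_nat: "h (of_nat k) = of_nat k"
  by (induction k) (simp_all add: hom_add hom_1)

lemmas hom_simps = hom_1 hom_add hom_uminus hom_diff hom_mult hom_power hom_sum hom_of_nat

end

section \<open>Localised integers and the rings they generate\<close>

lemma localised_int_of_int [simp]: "prime p \<Longrightarrow> of_int a \<in> localised_int p"
  unfolding localised_int_def
  by (rule CollectI, rule exI[of _ a], rule exI[of _ 1]) (use prime_gt_1_nat[of p] in auto)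

lemma localised_int_of_nat [simp]: "prime p \<Longrightarrow> of_nat a \<in> localised_int p"
  using localised_int_of_int[of p "int a"] by simp

lemma localised_int_0 [simp]: "prime p \<Longrightarrow> 0 \<in> localised_int p"
  using localised_int_of_int[of p 0] by simp

lemma localised_int_1 [simp]: "prime p \<Longrightarrow> 1 \<in> localised_int p"
  using localised_int_of_int[of p 1] by simp

lemma prime_int_dvd_mult: "prime p \<Longrightarrow> int p dvd a * b \<longleftrightarrow> int p dvd a \<or> int p dvd b"
  by (simp add: prime_dvd_mult_iff)

lemma localised_int_mult:
  assumes "prime p" "c \<in> localised_int p" "d \<in> localised_int p"
  shows "c * d \<in> localised_int p"
proof -
  obtain a b a' b' where "c = of_int a / of_int b" "\<not> int p dvd b"
    "d = of_int a' / of_int b'" "\<not> int p dvd b'"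
    using assms unfolding localised_int_def by blast
  then have "c * d = of_int (a * a') / of_int (b * b')" "\<not> int p dvd b * b'"
    by (simp_all add: prime_int_dvd_mult[OF assms(1)])
  then show ?thesis unfolding localised_int_def by blast
qed

lemma localised_int_add:
  assumes "prime p" "c \<in> localised_int p" "d \<in> localised_int p"
  shows "c + d \<in> localised_int p"
proof -
  obtain a b a' b' where *: "c = of_int a / of_int b" "\<not> int p dvd b"
    "d = of_int a' / of_int b'" "\<not> int p dvd b'"
    using assms unfolding localised_int_def by blast
  then have "b \<noteq> 0" "b' \<noteq> 0" by auto
  with * have "c + d = of_int (a * b' + a' * b) / of_int (b * b')" "\<not> int p dvd b * b'"
    by (simp_all add: prime_int_dvd_mult[OF assms(1)] field_simps)
  then show ?thesis unfolding localised_int_def by blast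
qed

lemma localised_int_uminus:
  assumes "prime p" "c \<in> localised_int p" shows "- c \<in> localised_int p"
  using localised_int_mult[OF assms(1) localised_int_of_int[OF assms(1), of "-1"] assms(2)]
  by simp

text \<open>The localisation is a local ring: a numerator divisible by \<open>p\<close> would make
  the fraction a multiple of \<open>p\<close>, so otherwise the fraction can be turned over.\<close>

lemma localised_int_unit:
  assumes "prime p" "c \<in> localised_int p" "\<And>d. d \<in> localised_int p \<Longrightarrow> c \<noteq> of_nat p * d"
  shows "inverse c \<in> localised_int p" "c \<noteq> 0"
proof -
  obtain a b where *: "c = of_int a / of_int b" "\<not> int p dvd b"
    using assms unfolding localised_int_def by blast
  have "\<not> int p dvd a"
  proof
    assume "int p dvd a"
    then obtain k where "a = int p * k" by blast
    with * have "c = of_nat p * (of_int k / of_int b)" by simp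
    moreover have "of_int k / of_int b \<in> localised_int p"
      using * unfolding localised_int_def by blast
    ultimately show False using assms(3) by blast
  qed
  moreover have "inverse c = of_int b / of_int a" using * by simp
  ultimately show "inverse c \<in> localised_int p" unfolding localised_int_def by blast
  show "c \<noteq> 0" using assms(3)[of 0] assms(1) by auto
qed

text \<open>Clearing the denominator would make it divisible by \<open>p\<close>. The arguments that
  some rational coefficient is a unit end in this contradiction.\<close>

lemma prime_not_unit:
  assumes "prime p" "d \<in> localised_int p"
  shows "of_nat p * d \<noteq> 1"
proof
  assume 1: "of_nat p * d = 1"
  obtain a b where *: "d = of_int a / of_int b" "\<not> int p dvd b"
    using assms unfolding localised_int_def by blast
  then have "of_int b \<noteq> (0::rat)" by auto
  with 1 * have "(of_int (int p * a) :: rat) = of_int b"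
    by (simp only: of_int_mult of_int_of_nat_eq times_divide_eq_right divide_eq_1_iff)
  then have "int p * a = b" by (simp only: of_int_eq_iff)
  with *(2) show False by (metis dvd_triv_left)
qed

text \<open>One interface for the three algebras over the localised integers that occur,
  \<open>BP p\<close>, \<open>BPBP p\<close> and \<open>int_poly p\<close>. All are subsets of one
  type, so integrality is a membership statement.\<close>

locale local_alg =
  fixes p :: nat and S :: "bp_poly set"
  assumes prime_p: "prime p"
    and const_in: "c \<in> localised_int p \<Longrightarrow> bp_const c \<in> S"
    and add_in: "a \<in> S \<Longrightarrow> b \<in> S \<Longrightarrow> a + b \<in> S"
    and mult_in: "a \<in> S \<Longrightarrow> b \<in> S \<Longrightarrow> a * b \<in> S"
begin

lemma zero_in [simp]: "0 \<in> S" and one_in [simp]: "1 \<in> S"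
  using const_in[of 0] const_in[of 1] prime_p by simp_all

lemma of_nat_in [simp]: "of_nat k \<in> S"
  using const_in[of "of_nat k"] prime_p by (simp add: bp_const_of_nat)

lemma uminus_in: "a \<in> S \<Longrightarrow> - a \<in> S"
  using mult_in[of "bp_const (-1)" a] const_in[of "-1"] prime_p
    localised_int_of_int[of p "-1"] by (simp add: bp_const_uminus)

lemma diff_in: "a \<in> S \<Longrightarrow> b \<in> S \<Longrightarrow> a - b \<in> S"
  using add_in[of a "- b"] uminus_in by simp

lemma power_in: "a \<in> S \<Longrightarrow> a ^ k \<in> S"
  by (induction k) (simp_all add: mult_in)

lemma sum_in: "(\<And>i. i \<in> I \<Longrightarrow> f i \<in> S) \<Longrightarrow> (\<Sum>i\<in>I. f i) \<in> S"
  by (induction I rule: infinite_finite_induct) (simp_all add: add_in)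

lemmas closed = const_in add_in mult_in uminus_in diff_in power_in

end

lemma local_alg_poly_alg: "prime p \<Longrightarrow> local_alg p (poly_alg p S)"
  by unfold_locales (auto intro: poly_alg.intros)

lemma local_alg_BP: "prime p \<Longrightarrow> local_alg p (BP p)"
  unfolding BP_def by (rule local_alg_poly_alg)

lemma local_alg_BPBP: "prime p \<Longrightarrow> local_alg p (BPBP p)"
  unfolding BPBP_def by (rule local_alg_poly_alg)

lemma poly_alg_mono: "P \<in> poly_alg p S \<Longrightarrow> S \<subseteq> S' \<Longrightarrow> P \<in> poly_alg p S'"
  by (induction P rule: poly_alg.induct) (auto intro: poly_alg.intros)

lemma BP_subset_BPBP: "P \<in> BP p \<Longrightarrow> P \<in> BPBP p"
  unfolding BP_def BPBP_def by (erule poly_alg_mono) blast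

lemma hazewinkel_0 [simp]: "hazewinkel p 0 = of_nat p"
  by (subst hazewinkel.simps) (simp add: log_c_def)

lemma hazewinkel_in_BP: "prime p \<Longrightarrow> hazewinkel p n \<in> BP p"
proof (cases "n = 0")
  case True
  assume "prime p"
  with True show ?thesis by (simp add: local_alg.of_nat_in[OF local_alg_BP])
next
  case False
  then show ?thesis unfolding BP_def by (intro poly_alg.gen) (auto simp: Suc_le_eq)
qed

lemma tt_in_BPBP: "prime p \<Longrightarrow> tt n \<in> BPBP p"
proof (cases "n = 0")
  case True
  assume "prime p"
  with True show ?thesis by (simp add: tt_def local_alg.one_in[OF local_alg_BPBP])
next
  case False
  then show ?thesis unfolding BPBP_def by (intro poly_alg.gen) (auto simp: Suc_le_eq)
qed

lemma hazewinkel_recursion: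
  "of_nat p * log_c n = hazewinkel p n + (\<Sum>i\<in>{1..<n}. log_c i * hazewinkel p (n - i) ^ (p ^ i))"
  by (subst hazewinkel.simps) simp

lemma hazewinkel_recursion':
  assumes "n \<ge> 1"
  shows "of_nat p * log_c n = (\<Sum>i<n. log_c i * hazewinkel p (n - i) ^ (p ^ i))"
proof -
  have "{..<n} = insert 0 {1..<n}" using assms by auto
  then show ?thesis
    by (simp add: hazewinkel_recursion log_c_def[of 0])
qed

section \<open>Integrality of the right unit\<close>

text \<open>The coefficients \<open>c\<close> are chosen before \<open>x\<close> and
  \<open>y\<close>. The quotient by \<open>p\<close> is thus a polynomial in \<open>x\<close> and
  \<open>y\<close> with natural coefficients, and lies in every subring that contains both.\<close>

lemma prime_binomial_expansion:
  assumes "prime p"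
  shows "\<exists>c. \<forall>x y. (x + y :: 'a::comm_ring_1) ^ p =
    x ^ p + y ^ p + of_nat p * (\<Sum>k\<in>{1..<p}. of_nat (c k) * (x ^ k * y ^ (p - k)))"
proof -
  have "\<exists>d. p choose k = p * d" if "k \<in> {1..<p}" for k
    using dvd_choose_prime[of k p] that assms by auto
  then obtain c where c: "\<And>k. k \<in> {1..<p} \<Longrightarrow> p choose k = p * c k" by metis
  have split: "{..p} = insert 0 (insert p {1..<p})" by auto
  have "p > 0" using assms by (simp add: prime_gt_0_nat)
  have "(x + y) ^ p =
    x ^ p + y ^ p + of_nat p * (\<Sum>k\<in>{1..<p}. of_nat (c k) * (x ^ k * y ^ (p - k)))" for x y :: 'a
    using \<open>p > 0\<close>
    by (simp add: binomial_ring split c sum_distrib_left mult_ac)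
  then show ?thesis by blast
qed

text \<open>Passing from \<open>x\<close> to \<open>x + 1\<close> changes \<open>x ^ p - x\<close>
  by a multiple of \<open>p\<close>, so induction can run in both directions from 0.\<close>

lemma fermat_int:
  assumes "prime p" shows "int p dvd a ^ p - a"
proof -
  obtain c where c: "\<And>x y :: int. (x + y) ^ p =
      x ^ p + y ^ p + of_nat p * (\<Sum>k\<in>{1..<p}. of_nat (c k) * (x ^ k * y ^ (p - k)))"
    using prime_binomial_expansion[OF assms] by blast
  have step: "int p dvd ((x + 1) ^ p - (x + 1)) - (x ^ p - x)" for x :: int
    by (simp add: c)
  show ?thesis
  proof (induction a rule: int_induct[where k = 0])
    case base
    then show ?case using prime_gt_0_nat[OF assms] by (simp add: zero_power)
  next
    case (step1 i)
    then show ?case using dvd_add[OF step[of i], of "i ^ p - i"] by (simp add: algebra_simps)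
  next
    case (step2 i)
    have "int p dvd (i ^ p - i) - ((i - 1) ^ p - (i - 1))"
      using step[of "i - 1"] by simp
    from dvd_diff[OF step2(2) this] show ?case by (simp add: algebra_simps)
  qed
qed

text \<open>For \<open>c = a / b\<close>, cross-multiplying \<open>a ^ p = a + p k\<close> and
  \<open>b ^ p = b + p l\<close> leaves \<open>p\<close> times \<open>k b - l a\<close> over
  \<open>b ^ p * b\<close>, a denominator still prime to \<open>p\<close>. This is the Frobenius
  congruence on constants, which the lift fixes.\<close>

lemma fermat_localised_int:
  assumes "prime p" "c \<in> localised_int p"
  shows "\<exists>d\<in>localised_int p. c ^ p = c + of_nat p * d"
proof -
  obtain a b where *: "c = of_int a / of_int b" "\<not> int p dvd b"
    using assms unfolding localised_int_def by blast
  obtain k l where kl: "a ^ p = a + int p * k" "b ^ p = b + int p * l"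
    using fermat_int[OF assms(1), of a] fermat_int[OF assms(1), of b]
    by (metis add.commute diff_add_cancel dvd_def)
  have "b \<noteq> 0" using * by auto
  have "(of_int (a ^ p) :: rat) * of_int b = of_int (b ^ p) * of_int a + of_nat p * of_int (k * b - l * a)"
    unfolding kl by (simp add: algebra_simps)
  then have "c ^ p = c + of_nat p * (of_int (k * b - l * a) / of_int (b ^ p * b))"
    using \<open>b \<noteq> 0\<close> by (simp add: * power_divide field_simps)
  moreover have "\<not> int p dvd b ^ p * b"
    using *(2) assms(1) by (metis prime_dvd_power_int prime_int_dvd_mult prime_nat_int_transfer)
  ultimately show ?thesis
    unfolding localised_int_def by blast
qed

context local_alg
begin

lemma freshman:
  assumes "x \<in> S" "y \<in> S"
  shows "\<exists>z\<in>S. (x + y) ^ p = x ^ p + y ^ p + of_nat p * z"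
proof -
  obtain c where c: "\<And>x y :: bp_poly. (x + y) ^ p =
      x ^ p + y ^ p + of_nat p * (\<Sum>k\<in>{1..<p}. of_nat (c k) * (x ^ k * y ^ (p - k)))"
    using prime_binomial_expansion[OF prime_p] by blast
  then show ?thesis
    by (intro bexI[of _ "\<Sum>k\<in>{1..<p}. of_nat (c k) * (x ^ k * y ^ (p - k))"])
      (auto intro!: sum_in mult_in power_in assms)
qed

lemma power_cong_p:
  assumes "x = y + of_nat p * z" "y \<in> S" "z \<in> S"
  shows "\<exists>u\<in>S. x ^ i = y ^ i + of_nat p * u"
proof (induction i)
  case 0
  then show ?case by (intro bexI[of _ 0]) simp_all
next
  case (Suc i)
  then obtain u where u: "u \<in> S" "x ^ i = y ^ i + of_nat p * u" by blast
  have "x ^ Suc i = y ^ Suc i + of_nat p * (y * u + z * y ^ i + z * of_nat p * u)"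
  proof -
    have "x ^ Suc i = (y + of_nat p * z) * (y ^ i + of_nat p * u)"
      by (simp only: power_Suc u(2) assms(1)[symmetric])
    then show ?thesis by (simp add: algebra_simps)
  qed
  then show ?case
    by (intro bexI[of _ "y * u + z * y ^ i + z * of_nat p * u"])
      (auto intro!: add_in mult_in power_in u assms)
qed

text \<open>When \<open>x - y\<close> is split off from \<open>x ^ p - y ^ p\<close>, the cofactor
  is a sum of \<open>p\<close> terms, each congruent to \<open>y ^ (p - 1)\<close> modulo
  \<open>p\<close>. It is therefore divisible by \<open>p\<close> and contributes one more
  power.\<close>

lemma power_p_cong:
  assumes "x = y + of_nat p ^ Suc k * z" "y \<in> S" "z \<in> S"
  shows "\<exists>u\<in>S. x ^ p = y ^ p + of_nat p ^ Suc (Suc k) * u"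
proof -
  have "x = y + of_nat p * (of_nat p ^ k * z)" using assms by (simp add: mult_ac)
  then have "\<exists>u\<in>S. x ^ i = y ^ i + of_nat p * u" for i
    by (rule power_cong_p) (auto intro!: mult_in power_in assms)
  then obtain u where u: "\<And>i. u i \<in> S" "\<And>i. x ^ i = y ^ i + of_nat p * u i" by metis
  have "(\<Sum>i<p. y ^ (p - Suc i) * x ^ i) = (\<Sum>i::nat<p. y ^ (p - 1)) + of_nat p * (\<Sum>i<p. y ^ (p - Suc i) * u i)"
    unfolding sum_distrib_left sum.distrib[symmetric]
  proof (intro sum.cong HOL.refl)
    fix i assume "i \<in> {..<p}"
    then have "p - 1 = (p - Suc i) + i" by simp
    then have "y ^ (p - 1) = y ^ (p - Suc i) * y ^ i" by (metis power_add)
    then show "y ^ (p - Suc i) * x ^ i = y ^ (p - 1) + of_nat p * (y ^ (p - Suc i) * u i)"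
      by (simp add: u(2) algebra_simps)
  qed
  then have sum: "(\<Sum>i<p. y ^ (p - Suc i) * x ^ i) =
      of_nat p * (y ^ (p - 1) + (\<Sum>i<p. y ^ (p - Suc i) * u i))"
    by (simp add: algebra_simps)
  have "x ^ p - y ^ p = (x - y) * (\<Sum>i<p. y ^ (p - Suc i) * x ^ i)"
    by (rule power_diff_sumr2)
  also have "x - y = of_nat p ^ Suc k * z" using assms(1) by simp
  finally have "x ^ p = y ^ p + of_nat p ^ Suc (Suc k) *
      (z * (y ^ (p - 1) + (\<Sum>i<p. y ^ (p - Suc i) * u i)))"
    unfolding sum by (simp add: algebra_simps)
  then show ?thesis
    by (rule bexI) (auto intro!: mult_in add_in power_in sum_in assms u)
qed

text \<open>The exponent count behind integrality: the gain of \<open>p ^ j\<close> matches the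
  denominator \<open>p ^ j\<close> of the j-th logarithm coefficient, and one factor
  \<open>p\<close> is left over.\<close>

lemma power_p_power_cong:
  assumes "x = y + of_nat p * z" "y \<in> S" "z \<in> S"
  shows "\<exists>u\<in>S. x ^ (p ^ j) = y ^ (p ^ j) + of_nat p ^ Suc j * u"
proof (induction j)
  case 0
  then show ?case using assms by auto
next
  case (Suc j)
  then obtain u where "u \<in> S" "x ^ (p ^ j) = y ^ (p ^ j) + of_nat p ^ Suc j * u" by blast
  from power_p_cong[OF this(2) power_in[OF assms(2)] this(1)] show ?case
    by (simp add: power_mult[symmetric] mult.commute)
qed

end

text \<open>The Frobenius lift is determined by \<open>v\<^sub>n \<mapsto> v\<^sub>n\<^sup>p\<close> and \<open>t\<^sub>n \<mapsto> t\<^sub>n\<^sup>p\<close>. Its value at \<open>\<ell>\<^sub>n\<close> is obtained by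
  applying it to Hazewinkel's relation.\<close>

fun log_frob :: "nat \<Rightarrow> nat \<Rightarrow> bp_poly"
  where "log_frob p n = (if n = 0 then 1 else
    bp_const (1 / of_nat p) * (\<Sum>i\<in>{..<n}. log_frob p i * hazewinkel p (n - i) ^ (p ^ Suc i)))"

declare log_frob.simps [simp del]

definition frob :: "nat \<Rightarrow> bp_poly \<Rightarrow> bp_poly"
  where "frob p = mpoly_eval bp_const
    (\<lambda>v. case v of Log n \<Rightarrow> log_frob p n | T n \<Rightarrow> bp_X (T n) ^ p | T2 n \<Rightarrow> bp_X (T2 n) ^ p)"

lemma coeff_hom_bp_const: "coeff_hom bp_const"
  by unfold_locales

lemma coeff_hom_frob_power: "coeff_hom ((frob p) ^^ s)"
proof (induction s)
  case 0
  then show ?case by unfold_locales simp_all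
next
  case (Suc s)
  from coeff_hom_compose[OF this coeff_hom_mpoly_eval[OF coeff_hom_bp_const]]
  show ?case by (simp add: frob_def comp_def)
qed

interpretation frob: coeff_hom "frob p" for p
  using coeff_hom_frob_power[where p = p and s = 1] by simp

lemma p_cancel:
  assumes "prime p" "of_nat p * a = of_nat p * (b::bp_poly)" shows "a = b"
proof -
  have *: "bp_const (1 / of_nat p) * of_nat p = 1"
    using assms(1) prime_gt_0_nat[of p]
    by (simp add: bp_const_of_nat[symmetric] bp_const.hom_mult[symmetric])
  have "bp_const (1 / of_nat p) * (of_nat p * a) = bp_const (1 / of_nat p) * (of_nat p * b)"
    using assms by simp
  then show ?thesis
    by (simp only: mult.assoc[symmetric] * mult_1_left)
qed

lemma log_frob_recursion:
  assumes "prime p" "n \<ge> 1"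
  shows "of_nat p * log_frob p n = (\<Sum>i<n. log_frob p i * hazewinkel p (n - i) ^ (p ^ Suc i))"
proof -
  have *: "of_nat p * bp_const (1 / of_nat p) = 1"
    using assms(1) prime_gt_0_nat[of p]
    by (simp add: bp_const_of_nat[symmetric] bp_const.hom_mult[symmetric])
  show ?thesis
    by (subst log_frob.simps) (use assms in \<open>simp add: mult.assoc[symmetric] *\<close>)
qed

lemma frob_log: "frob p (log_c n) = log_frob p n"
  by (simp add: frob_def log_c_def mpoly_eval_X[OF coeff_hom_bp_const] log_frob.simps[of p 0]
      coeff_hom.eval_1[OF coeff_hom_bp_const])

lemma frob_tt: "frob p (tt n) = tt n ^ p"
  by (simp add: frob_def tt_def mpoly_eval_X[OF coeff_hom_bp_const]
      coeff_hom.eval_1[OF coeff_hom_bp_const])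

lemma frob_hazewinkel:
  assumes "prime p"
  shows "n \<ge> 1 \<Longrightarrow> frob p (hazewinkel p n) = hazewinkel p n ^ p"
proof (induction n rule: less_induct)
  case (less n)
  have split: "{..<n} = insert 0 {1..<n}" using less.prems by auto
  have "frob p (hazewinkel p n) =
      frob p (of_nat p * log_c n - (\<Sum>i\<in>{1..<n}. log_c i * hazewinkel p (n - i) ^ (p ^ i)))"
    by (simp only: hazewinkel_recursion add_diff_cancel_right')
  also have "\<dots> = of_nat p * log_frob p n -
      (\<Sum>i\<in>{1..<n}. log_frob p i * frob p (hazewinkel p (n - i)) ^ (p ^ i))"
    by (simp add: frob.hom_simps frob_log)
  also have "(\<Sum>i\<in>{1..<n}. log_frob p i * frob p (hazewinkel p (n - i)) ^ (p ^ i)) =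
      (\<Sum>i\<in>{1..<n}. log_frob p i * hazewinkel p (n - i) ^ (p ^ Suc i))"
    by (intro sum.cong HOL.refl, subst less.IH) (auto simp: power_mult)
  also have "of_nat p * log_frob p n - \<dots> = hazewinkel p n ^ p"
    using log_frob_recursion[OF assms less.prems]
    by (simp add: split log_frob.simps[of p 0])
  finally show ?case .
qed

lemma frob_power_hazewinkel:
  assumes "prime p" "n \<ge> 1"
  shows "((frob p) ^^ s) (hazewinkel p n) = hazewinkel p n ^ (p ^ s)"
  by (induction s)
    (simp_all add: frob.hom_power frob_hazewinkel[OF assms] power_mult[symmetric] mult.commute)

lemma frob_power_tt: "((frob p) ^^ s) (tt n) = tt n ^ (p ^ s)"
  by (induction s) (simp_all add: frob.hom_power frob_tt power_mult[symmetric] mult.commute)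

section \<open>Functional equations for the logarithm coefficients and their right units\<close>

lemma sum_triangle_swap:
  fixes f :: "nat \<Rightarrow> nat \<Rightarrow> 'a::comm_monoid_add"
  shows "(\<Sum>i\<in>{1..<n}. \<Sum>s\<in>{1..i}. f s (i - s)) = (\<Sum>s\<in>{1..<n}. \<Sum>j<n - s. f s j)"
  unfolding sum.Sigma[of _ "\<lambda>i. {1..i}", simplified] sum.Sigma[of _ "\<lambda>s. {..<n - s}", simplified]
  by (subst sum.Sigma, simp, simp, subst sum.Sigma, simp, simp)
    (rule sum.reindex_bij_witness[of _ "\<lambda>(s, j). (s + j, s)" "\<lambda>(i, s). (s, i - s)"], auto)

text \<open>Hazewinkel's functional equation, coefficient by coefficient. Multiply the defining
  recursion by \<open>p\<close>, replace each \<open>p * log_c i\<close> by the induction hypothesis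
  and interchange the sums: for fixed \<open>s\<close> the inner sum is the s-th iterate of the lift
  applied to the recursion for \<open>n - s\<close>.\<close>

lemma log_frob_expansion:
  assumes "prime p" "n \<ge> 1"
  shows "of_nat p * log_c n = (\<Sum>s\<in>{1..n}. hazewinkel p s * ((frob p) ^^ s) (log_c (n - s)))"
  using \<open>n \<ge> 1\<close>
proof (induction n rule: less_induct)
  case (less n)
  let ?F = "\<lambda>s. (frob p) ^^ s"
  interpret F: coeff_hom "?F s" for s by (rule coeff_hom_frob_power)
  have "of_nat p * (of_nat p * log_c n) = of_nat p * hazewinkel p n +
      (\<Sum>i\<in>{1..<n}. (of_nat p * log_c i) * hazewinkel p (n - i) ^ (p ^ i))"
    by (subst hazewinkel_recursion) (simp add: distrib_left sum_distrib_left mult_ac)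
  also have "(\<Sum>i\<in>{1..<n}. (of_nat p * log_c i) * hazewinkel p (n - i) ^ (p ^ i)) =
     (\<Sum>i\<in>{1..<n}. \<Sum>s\<in>{1..i}. hazewinkel p s *
        ?F s (log_c (i - s) * hazewinkel p (n - s - (i - s)) ^ (p ^ (i - s))))"
  proof (intro sum.cong HOL.refl)
    fix i assume i: "i \<in> {1..<n}"
    have "(of_nat p * log_c i) * hazewinkel p (n - i) ^ (p ^ i) =
      (\<Sum>s\<in>{1..i}. hazewinkel p s * ?F s (log_c (i - s)) * hazewinkel p (n - i) ^ (p ^ i))"
      using less.IH[of i] i by (simp add: sum_distrib_right)
    also have "\<dots> = (\<Sum>s\<in>{1..i}. hazewinkel p s *
        ?F s (log_c (i - s) * hazewinkel p (n - s - (i - s)) ^ (p ^ (i - s))))"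
    proof (intro sum.cong HOL.refl)
      fix s assume s: "s \<in> {1..i}"
      \<comment> \<open>The s-th iterate of the lift raises \<open>hazewinkel p (n - i)\<close> to
        the power \<open>p ^ s\<close>, so only the exponent \<open>p ^ (i - s)\<close> has to stay
        inside.\<close>
      then have "n - s - (i - s) = n - i" "p ^ s * p ^ (i - s) = p ^ i"
        by (simp_all add: power_add[symmetric])
      then show "hazewinkel p s * ?F s (log_c (i - s)) * hazewinkel p (n - i) ^ (p ^ i) =
         hazewinkel p s * ?F s (log_c (i - s) * hazewinkel p (n - s - (i - s)) ^ (p ^ (i - s)))"
        using i frob_power_hazewinkel[OF assms(1), of "n - i" s]
        by (simp add: F.hom_simps power_mult[symmetric] mult.assoc Suc_le_eq)
    qed
    finally show "(of_nat p * log_c i) * hazewinkel p (n - i) ^ (p ^ i) = \<dots>" .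
  qed
  also have "\<dots> = (\<Sum>s\<in>{1..<n}. \<Sum>j<n - s. hazewinkel p s *
        ?F s (log_c j * hazewinkel p (n - s - j) ^ (p ^ j)))"
    by (rule sum_triangle_swap)
  also have "\<dots> = (\<Sum>s\<in>{1..<n}. hazewinkel p s * ?F s (of_nat p * log_c (n - s)))"
  proof (intro sum.cong HOL.refl)
    fix s assume "s \<in> {1..<n}"
    then have "1 \<le> n - s" by auto
    then show "(\<Sum>j<n - s. hazewinkel p s * ?F s (log_c j * hazewinkel p (n - s - j) ^ (p ^ j))) =
        hazewinkel p s * ?F s (of_nat p * log_c (n - s))"
      by (simp only: hazewinkel_recursion' F.hom_sum sum_distrib_left)
  qed
  also have "of_nat p * hazewinkel p n + \<dots> =
      of_nat p * (\<Sum>s\<in>{1..n}. hazewinkel p s * ?F s (log_c (n - s)))"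
  proof -
    have "{1..n} = insert n {1..<n}" using less.prems by auto
    then show ?thesis
      by (simp add: F.hom_simps log_c_def[of 0] sum_distrib_left distrib_left mult_ac)
  qed
  finally show ?case by (rule p_cancel[OF assms(1)])
qed

text \<open>The rearrangement of \<open>log_frob_expansion\<close> applies again because the lift
  raises t_n to its p-th power too. Only the summand \<open>i = 0\<close> has no expansion, and it
  becomes the inhomogeneous term \<open>p * tt n\<close>.\<close>

lemma log_right_frob_expansion:
  assumes "prime p"
  shows "of_nat p * log_right p n =
    of_nat p * tt n + (\<Sum>s\<in>{1..n}. hazewinkel p s * ((frob p) ^^ s) (log_right p (n - s)))"
proof -
  let ?F = "\<lambda>s. (frob p) ^^ s"
  interpret F: coeff_hom "?F s" for s by (rule coeff_hom_frob_power)
  have split: "{..n} = insert 0 {1..<Suc n}" by auto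
  have "of_nat p * log_right p n =
      of_nat p * tt n + (\<Sum>i\<in>{1..<Suc n}. (of_nat p * log_c i) * tt (n - i) ^ (p ^ i))"
    unfolding log_right_def split
    by (simp add: log_c_def[of 0] distrib_left sum_distrib_left mult_ac)
  also have "(\<Sum>i\<in>{1..<Suc n}. (of_nat p * log_c i) * tt (n - i) ^ (p ^ i)) =
     (\<Sum>i\<in>{1..<Suc n}. \<Sum>s\<in>{1..i}. hazewinkel p s *
        ?F s (log_c (i - s) * tt (n - s - (i - s)) ^ (p ^ (i - s))))"
  proof (intro sum.cong HOL.refl)
    fix i assume i: "i \<in> {1..<Suc n}"
    have "(of_nat p * log_c i) * tt (n - i) ^ (p ^ i) =
      (\<Sum>s\<in>{1..i}. hazewinkel p s * ?F s (log_c (i - s)) * tt (n - i) ^ (p ^ i))"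
      using log_frob_expansion[OF assms, of i] i by (simp add: sum_distrib_right)
    also have "\<dots> = (\<Sum>s\<in>{1..i}. hazewinkel p s *
        ?F s (log_c (i - s) * tt (n - s - (i - s)) ^ (p ^ (i - s))))"
    proof (intro sum.cong HOL.refl)
      fix s assume s: "s \<in> {1..i}"
      then have "n - s - (i - s) = n - i" "p ^ s * p ^ (i - s) = p ^ i"
        by (simp_all add: power_add[symmetric])
      then show "hazewinkel p s * ?F s (log_c (i - s)) * tt (n - i) ^ (p ^ i) =
         hazewinkel p s * ?F s (log_c (i - s) * tt (n - s - (i - s)) ^ (p ^ (i - s)))"
        by (simp add: F.hom_simps frob_power_tt power_mult[symmetric] mult_ac)
    qed
    finally show "(of_nat p * log_c i) * tt (n - i) ^ (p ^ i) = \<dots>" .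
  qed
  also have "\<dots> = (\<Sum>s\<in>{1..<Suc n}. \<Sum>j<Suc n - s. hazewinkel p s *
        ?F s (log_c j * tt (n - s - j) ^ (p ^ j)))"
    by (rule sum_triangle_swap)
  also have "\<dots> = (\<Sum>s\<in>{1..n}. hazewinkel p s * ?F s (log_right p (n - s)))"
    by (intro sum.cong)
      (auto simp: log_right_def F.hom_sum sum_distrib_left Suc_diff_le lessThan_Suc_atMost)
  finally show ?thesis .
qed

text \<open>True on generators, where the lift is the p-th power itself, and on constants by Fermat.
  The congruence survives sums because the p-th power is additive modulo \<open>p\<close>.\<close>

lemma frob_in_BPBP_cong:
  assumes "prime p" "b \<in> BPBP p"
  shows "frob p b \<in> BPBP p \<and> (\<exists>z\<in>BPBP p. frob p b = b ^ p + of_nat p * z)"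
proof -
  interpret S: local_alg p "BPBP p" using assms(1) by (rule local_alg_BPBP)
  have "b \<in> poly_alg p ({hazewinkel p n | n. n \<ge> 1} \<union> {tt n | n. n \<ge> 1}) \<Longrightarrow>
      b \<in> BPBP p \<and> (\<exists>z\<in>BPBP p. frob p b = b ^ p + of_nat p * z)" for b
  proof (induction rule: poly_alg.induct)
    case (const c)
    have c: "frob p (bp_const c) = bp_const c"
      by (simp add: frob_def mpoly_eval_const[OF coeff_hom_bp_const])
    from fermat_localised_int[OF assms(1) const] obtain d
      where d: "d \<in> localised_int p" "c ^ p = c + of_nat p * d" by blast
    have "c = c ^ p + of_nat p * (- d)" using d(2) by simp
    then have "bp_const c = bp_const c ^ p + of_nat p * bp_const (- d)"
      by (metis bp_const.hom_add bp_const.hom_mult bp_const_of_nat bp_const_power)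
    moreover have "bp_const (- d) \<in> BPBP p"
      by (intro S.const_in localised_int_uminus assms d)
    ultimately show ?case using S.const_in[OF const] c by metis
  next
    case (gen P)
    then have "frob p P = P ^ p"
      by (auto simp: frob_tt frob_hazewinkel[OF assms(1)])
    moreover have "P \<in> BPBP p"
      using gen tt_in_BPBP[OF assms(1)] BP_subset_BPBP hazewinkel_in_BP[OF assms(1)] by blast
    ultimately show ?case by (intro conjI bexI[of _ 0]) simp_all
  next
    case (add P Q)
    then obtain z z' where z: "z \<in> BPBP p" "frob p P = P ^ p + of_nat p * z"
      "z' \<in> BPBP p" "frob p Q = Q ^ p + of_nat p * z'" "P \<in> BPBP p" "Q \<in> BPBP p" by blast
    obtain u where u: "u \<in> BPBP p" "(P + Q) ^ p = P ^ p + Q ^ p + of_nat p * u"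
      using S.freshman z by blast
    have "frob p (P + Q) = (P + Q) ^ p + of_nat p * (z + z' - u)"
      by (simp add: frob.hom_add z u algebra_simps)
    then show ?case using z u by (intro conjI bexI[of _ "z + z' - u"] S.closed) auto
  next
    case (mult P Q)
    then obtain z z' where z: "z \<in> BPBP p" "frob p P = P ^ p + of_nat p * z"
      "z' \<in> BPBP p" "frob p Q = Q ^ p + of_nat p * z'" "P \<in> BPBP p" "Q \<in> BPBP p" by blast
    have "frob p (P * Q) = (P * Q) ^ p + of_nat p * (z * Q ^ p + P ^ p * z' + of_nat p * (z * z'))"
      by (simp add: frob.hom_mult z power_mult_distrib algebra_simps)
    then show ?case using z
      by (intro conjI bexI[of _ "z * Q ^ p + P ^ p * z' + of_nat p * (z * z')"] S.closed) auto
  qed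
  then obtain z where "z \<in> BPBP p" "frob p b = b ^ p + of_nat p * z"
    using assms(2) unfolding BPBP_def by blast
  then show ?thesis
    using assms(2) by (auto intro!: S.closed)
qed

lemma frob_power_in_BPBP:
  assumes "prime p" "b \<in> BPBP p" shows "((frob p) ^^ s) b \<in> BPBP p"
  by (induction s) (use assms frob_in_BPBP_cong in auto)

lemma frob_power_cong:
  assumes "prime p" "b \<in> BPBP p"
  shows "\<exists>z\<in>BPBP p. ((frob p) ^^ s) b = b ^ (p ^ s) + of_nat p * z"
proof (induction s)
  case 0
  interpret S: local_alg p "BPBP p" using assms(1) by (rule local_alg_BPBP)
  show ?case by (intro bexI[of _ 0]) simp_all
next
  case (Suc s)
  interpret S: local_alg p "BPBP p" using assms(1) by (rule local_alg_BPBP)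
  from Suc obtain z where z: "z \<in> BPBP p" "((frob p) ^^ s) b = b ^ (p ^ s) + of_nat p * z" by blast
  obtain u where u: "u \<in> BPBP p" "frob p b = b ^ p + of_nat p * u"
    using frob_in_BPBP_cong[OF assms] by blast
  obtain u' where u': "u' \<in> BPBP p" "frob p b ^ (p ^ s) = (b ^ p) ^ (p ^ s) + of_nat p * u'"
    using S.power_cong_p[OF u(2) S.power_in[OF assms(2)] u(1)] by blast
  have "((frob p) ^^ Suc s) b = frob p b ^ (p ^ s) + of_nat p * frob p z"
    by (simp add: z frob.hom_simps)
  also have "\<dots> = b ^ (p ^ Suc s) + of_nat p * (u' + frob p z)"
    by (simp add: u' power_mult[symmetric] algebra_simps)
  finally show ?case
    using u' frob_in_BPBP_cong[OF assms(1) z(1)]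
    by (intro bexI[of _ "u' + frob p z"] S.add_in) auto
qed

text \<open>Each step of the recursion costs one division by \<open>p\<close>, so the denominator of
  \<ell>_n is at most \<open>p ^ n\<close>.\<close>

lemma p_power_log_in_BP:
  assumes "prime p" shows "of_nat p ^ n * log_c n \<in> BP p"
proof (induction n rule: less_induct)
  case (less n)
  interpret S: local_alg p "BP p" using assms(1) by (rule local_alg_BP)
  show ?case
  proof (cases n)
    case 0
    then show ?thesis by (simp add: log_c_def)
  next
    case (Suc m)
    have "of_nat p ^ n * log_c n = of_nat p ^ m * (of_nat p * log_c n)"
      by (simp add: Suc mult_ac)
    also have "\<dots> = (\<Sum>i<n. (of_nat p ^ (m - i) * (of_nat p ^ i * log_c i)) * hazewinkel p (n - i) ^ (p ^ i))"
    proof (subst hazewinkel_recursion'[where n = n and p = p])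
      show "1 \<le> n" using Suc by simp
      show "of_nat p ^ m * (\<Sum>i<n. log_c i * hazewinkel p (n - i) ^ (p ^ i)) =
        (\<Sum>i<n. (of_nat p ^ (m - i) * (of_nat p ^ i * log_c i)) * hazewinkel p (n - i) ^ (p ^ i))"
        unfolding sum_distrib_left
        by (intro sum.cong HOL.refl) (auto simp: Suc mult.assoc[symmetric] power_add[symmetric])
    qed
    also have "\<dots> \<in> BP p"
      by (intro S.sum_in S.mult_in[OF S.mult_in[OF S.power_in[OF S.of_nat_in] less.IH]]
          S.power_in hazewinkel_in_BP assms) auto
    finally show ?thesis .
  qed
qed

lemma p_power_log_right_in_BPBP:
  assumes "prime p" shows "of_nat p ^ n * log_right p n \<in> BPBP p"
proof -
  interpret S: local_alg p "BPBP p" using assms(1) by (rule local_alg_BPBP)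
  have "of_nat p ^ n * log_right p n =
      (\<Sum>i\<le>n. (of_nat p ^ (n - i) * (of_nat p ^ i * log_c i)) * tt (n - i) ^ (p ^ i))"
    unfolding log_right_def sum_distrib_left
    by (intro sum.cong HOL.refl) (auto simp: mult.assoc[symmetric] power_add[symmetric])
  also have "\<dots> \<in> BPBP p"
    by (intro S.sum_in S.mult_in[OF S.mult_in[OF S.power_in[OF S.of_nat_in]
          BP_subset_BPBP[OF p_power_log_in_BP]]] S.power_in tt_in_BPBP assms)
  finally show ?thesis .
qed

lemma bp_runit_eq: "bp_runit p = mpoly_eval bp_const (\<lambda>v. case v of Log n \<Rightarrow> log_right p n | _ \<Rightarrow> bp_X v)"
  by (simp add: bp_runit_def bp_subst_eq)

interpretation bp_runit: coeff_hom "bp_runit p" for p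
  unfolding bp_runit_eq by (rule coeff_hom_mpoly_eval[OF coeff_hom_bp_const])

lemma bp_runit_const [simp]: "bp_runit p (bp_const c) = bp_const c"
  by (simp add: bp_runit_eq mpoly_eval_const[OF coeff_hom_bp_const])

lemma bp_runit_log: "bp_runit p (log_c n) = log_right p n"
  by (simp add: bp_runit_eq log_c_def mpoly_eval_X[OF coeff_hom_bp_const] log_right_def tt_def
      coeff_hom.eval_1[OF coeff_hom_bp_const])

text \<open>\<open>p * (p * log_right p n)\<close> is computed twice, with \<open>V k\<close> the
  right unit of v_k. Hazewinkel's recursion followed by the functional equation produces the powers
  \<open>V (n - s - j) ^ (p ^ (s + j))\<close>; the opposite order produces the
  \<open>p ^ j\<close>-th power of the s-th iterate of the lift at \<open>V (n - s - j)\<close>.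
  These differ by a multiple of \<open>p ^ Suc j\<close>: the part \<open>p ^ j\<close> clears the
  denominator of \<open>log_right p j\<close>, and the remaining \<open>p\<close> cancels when the
  comparison is solved for \<open>V n\<close>.\<close>

lemma bp_runit_hazewinkel:
  assumes "prime p" "n \<ge> 1" shows "bp_runit p (hazewinkel p n) \<in> BPBP p"
  using \<open>n \<ge> 1\<close>
proof (induction n rule: less_induct)
  case (less n)
  interpret S: local_alg p "BPBP p" using assms(1) by (rule local_alg_BPBP)
  let ?F = "\<lambda>s. (frob p) ^^ s" and ?L = "log_right p"
  interpret F: coeff_hom "?F s" for s by (rule coeff_hom_frob_power)
  define V where "V k = bp_runit p (hazewinkel p k)" for k
  have V_in: "V k \<in> BPBP p" if "k \<ge> 1" "k < n" for k
    unfolding V_def using less.IH that by blast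
  have rec: "of_nat p * ?L m = (\<Sum>i<m. ?L i * V (m - i) ^ (p ^ i))" if "m \<ge> 1" for m
    using arg_cong[OF hazewinkel_recursion'[OF that, of p], of "bp_runit p"]
    by (simp add: bp_runit.hom_simps bp_runit_log V_def)
  have split: "{..<n} = insert 0 {1..<n}" "{1..n} = insert n {1..<n}" using less.prems by auto
  have L0: "?L 0 = 1" by (simp add: log_right_def log_c_def tt_def)
  have "of_nat p * (of_nat p * ?L n) = of_nat p * (\<Sum>i<n. ?L i * V (n - i) ^ (p ^ i))"
    using rec[OF less.prems] by simp
  also have "\<dots> = of_nat p * V n + (\<Sum>i\<in>{1..<n}. (of_nat p * ?L i) * V (n - i) ^ (p ^ i))"
    by (simp add: split(1) L0 distrib_left sum_distrib_left mult_ac)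
  also have "(\<Sum>i\<in>{1..<n}. (of_nat p * ?L i) * V (n - i) ^ (p ^ i)) =
      of_nat p * (\<Sum>i\<in>{1..<n}. tt i * V (n - i) ^ (p ^ i)) +
      (\<Sum>i\<in>{1..<n}. \<Sum>s\<in>{1..i}. hazewinkel p s * ?F s (?L (i - s)) * V (n - s - (i - s)) ^ (p ^ (s + (i - s))))"
    unfolding sum_distrib_left[of "of_nat p"] sum.distrib[symmetric]
  proof (intro sum.cong HOL.refl)
    fix i assume "i \<in> {1..<n}"
    have "(of_nat p * ?L i) * V (n - i) ^ (p ^ i) = of_nat p * (tt i * V (n - i) ^ (p ^ i)) +
        (\<Sum>s\<in>{1..i}. hazewinkel p s * ?F s (?L (i - s)) * V (n - i) ^ (p ^ i))"
      by (subst log_right_frob_expansion[OF assms(1)])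
        (simp add: distrib_right sum_distrib_right mult.assoc)
    also have "(\<Sum>s\<in>{1..i}. hazewinkel p s * ?F s (?L (i - s)) * V (n - i) ^ (p ^ i)) =
        (\<Sum>s\<in>{1..i}. hazewinkel p s * ?F s (?L (i - s)) *
          V (n - s - (i - s)) ^ (p ^ (s + (i - s))))"
      by (intro sum.cong HOL.refl) simp
    finally show "(of_nat p * ?L i) * V (n - i) ^ (p ^ i) = of_nat p * (tt i * V (n - i) ^ (p ^ i)) +
        (\<Sum>s\<in>{1..i}. hazewinkel p s * ?F s (?L (i - s)) *
          V (n - s - (i - s)) ^ (p ^ (s + (i - s))))" .
  qed
  also have "(\<Sum>i\<in>{1..<n}. \<Sum>s\<in>{1..i}. hazewinkel p s * ?F s (?L (i - s)) * V (n - s - (i - s)) ^ (p ^ (s + (i - s)))) =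
      (\<Sum>s\<in>{1..<n}. \<Sum>j<n - s. hazewinkel p s * ?F s (?L j) * V (n - s - j) ^ (p ^ (s + j)))"
    by (rule sum_triangle_swap)
  finally have 1: "of_nat p * (of_nat p * ?L n) = of_nat p * V n +
      (of_nat p * (\<Sum>i\<in>{1..<n}. tt i * V (n - i) ^ (p ^ i)) +
      (\<Sum>s\<in>{1..<n}. \<Sum>j<n - s. hazewinkel p s * ?F s (?L j) * V (n - s - j) ^ (p ^ (s + j))))" .
  have "of_nat p * (of_nat p * ?L n) = of_nat p * (of_nat p * tt n) +
      (\<Sum>s\<in>{1..n}. hazewinkel p s * ?F s (of_nat p * ?L (n - s)))"
    by (subst log_right_frob_expansion[OF assms(1)])
      (simp add: F.hom_simps distrib_left sum_distrib_left mult_ac)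
  also have "(\<Sum>s\<in>{1..n}. hazewinkel p s * ?F s (of_nat p * ?L (n - s))) =
      of_nat p * hazewinkel p n + (\<Sum>s\<in>{1..<n}. hazewinkel p s * ?F s (of_nat p * ?L (n - s)))"
    unfolding split(2) by (simp add: L0 F.hom_simps mult_ac)
  also have "(\<Sum>s\<in>{1..<n}. hazewinkel p s * ?F s (of_nat p * ?L (n - s))) =
      (\<Sum>s\<in>{1..<n}. \<Sum>j<n - s. hazewinkel p s * ?F s (?L j) * ?F s (V (n - s - j)) ^ (p ^ j))"
  proof (intro sum.cong HOL.refl)
    fix s assume "s \<in> {1..<n}"
    then have "of_nat p * ?L (n - s) = (\<Sum>j<n - s. ?L j * V (n - s - j) ^ (p ^ j))"
      by (intro rec) auto
    then show "hazewinkel p s * ?F s (of_nat p * ?L (n - s)) =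
        (\<Sum>j<n - s. hazewinkel p s * ?F s (?L j) * ?F s (V (n - s - j)) ^ (p ^ j))"
      by (simp only: F.hom_simps sum_distrib_left mult.assoc)
  qed
  finally have 2: "of_nat p * (of_nat p * ?L n) = of_nat p * (of_nat p * tt n) +
      (of_nat p * hazewinkel p n +
      (\<Sum>s\<in>{1..<n}. \<Sum>j<n - s. hazewinkel p s * ?F s (?L j) * ?F s (V (n - s - j)) ^ (p ^ j)))" .
  have "\<exists>u\<in>BPBP p. hazewinkel p s * ?F s (?L j) * ?F s (V (n - s - j)) ^ (p ^ j) -
      hazewinkel p s * ?F s (?L j) * V (n - s - j) ^ (p ^ (s + j)) = of_nat p * u"
    if s: "s \<in> {1..<n}" and j: "j < n - s" for s j
  proof -
    let ?v = "V (n - s - j)"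
    \<comment> \<open>The index lies between 1 and \<open>n - 1\<close> because
      \<open>s \<ge> 1\<close>. The induction hypothesis is indispensable here, as the lift is
      congruent to a power only on integral elements.\<close>
    have v: "?v \<in> BPBP p" using V_in s j by auto
    obtain z where z: "z \<in> BPBP p" "?F s ?v = ?v ^ (p ^ s) + of_nat p * z"
      using frob_power_cong[OF assms(1) v] by blast
    obtain u where u: "u \<in> BPBP p"
      "?F s ?v ^ (p ^ j) = (?v ^ (p ^ s)) ^ (p ^ j) + of_nat p ^ Suc j * u"
      using S.power_p_power_cong[OF z(2) S.power_in[OF v] z(1)] by blast
    have "hazewinkel p s * ?F s (?L j) * ?F s ?v ^ (p ^ j) -
        hazewinkel p s * ?F s (?L j) * ?v ^ (p ^ (s + j)) =
        of_nat p * (hazewinkel p s * ?F s (of_nat p ^ j * ?L j) * u)"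
      unfolding u(2) by (simp add: power_mult[symmetric] power_add F.hom_simps algebra_simps)
    moreover have "hazewinkel p s * ?F s (of_nat p ^ j * ?L j) * u \<in> BPBP p"
      by (intro S.mult_in u frob_power_in_BPBP p_power_log_right_in_BPBP BP_subset_BPBP
          hazewinkel_in_BP assms)
    ultimately show ?thesis by blast
  qed
  then obtain u where u: "\<And>s j. s \<in> {1..<n} \<Longrightarrow> j < n - s \<Longrightarrow> u s j \<in> BPBP p \<and>
      hazewinkel p s * ?F s (?L j) * ?F s (V (n - s - j)) ^ (p ^ j) -
      hazewinkel p s * ?F s (?L j) * V (n - s - j) ^ (p ^ (s + j)) = of_nat p * u s j"
    by metis
  have "(\<Sum>s\<in>{1..<n}. \<Sum>j<n - s. hazewinkel p s * ?F s (?L j) * ?F s (V (n - s - j)) ^ (p ^ j)) -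
      (\<Sum>s\<in>{1..<n}. \<Sum>j<n - s. hazewinkel p s * ?F s (?L j) * V (n - s - j) ^ (p ^ (s + j))) =
      of_nat p * (\<Sum>s\<in>{1..<n}. \<Sum>j<n - s. u s j)"
    unfolding sum_subtractf[symmetric] sum_distrib_left
    by (intro sum.cong HOL.refl) (use u in auto)
  with 1 2 have "of_nat p * V n = of_nat p * (of_nat p * tt n + hazewinkel p n -
      (\<Sum>i\<in>{1..<n}. tt i * V (n - i) ^ (p ^ i)) + (\<Sum>s\<in>{1..<n}. \<Sum>j<n - s. u s j))"
    by (simp add: algebra_simps)
  from p_cancel[OF assms(1) this]
  have "V n = of_nat p * tt n + hazewinkel p n -
      (\<Sum>i\<in>{1..<n}. tt i * V (n - i) ^ (p ^ i)) + (\<Sum>s\<in>{1..<n}. \<Sum>j<n - s. u s j)" .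
  also have "\<dots> \<in> BPBP p"
    using u V_in
    by (intro S.add_in S.diff_in S.sum_in S.mult_in S.power_in tt_in_BPBP
        BP_subset_BPBP[OF hazewinkel_in_BP] assms S.of_nat_in) auto
  finally show ?case by (simp add: V_def)
qed

text \<open>Used twice: \<open>\<Phi>\<close> can be evaluated at the right unit as a ring
  homomorphism, and the t_m-coefficients of the right unit lie in BP_*, so that they act on a
  comodule through \<open>\<phi>\<close>.\<close>

theorem bp_runit_in_BPBP:
  assumes "prime p" "b \<in> BP p" shows "bp_runit p b \<in> BPBP p"
proof -
  interpret S: local_alg p "BPBP p" using assms(1) by (rule local_alg_BPBP)
  from assms(2) show ?thesis
    unfolding BP_def
    by (induction rule: poly_alg.induct)
      (auto simp: bp_runit.hom_simps intro: S.closed bp_runit_hazewinkel[OF assms(1)])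
qed

section \<open>Weights and linear coefficients\<close>

text \<open>The auxiliary variable records the weight, so its e-th coefficient is the component of
  weight e. As a ring homomorphism it reduces components of products to Cauchy products, and
  homogeneity to being a monomial.\<close>

definition grade :: "nat \<Rightarrow> bp_poly \<Rightarrow> bp_poly poly"
  where "grade p = mpoly_eval (\<lambda>c. [:bp_const c:]) (\<lambda>v. monom (bp_X v) (var_weight p v))"

definition mon_weight :: "nat \<Rightarrow> (bp_var \<Rightarrow>\<^sub>0 nat) \<Rightarrow> nat"
  where "mon_weight p m = (\<Sum>v\<in>Poly_Mapping.keys m. Poly_Mapping.lookup m v * var_weight p v)"

lemma coeff_hom_poly_bp_const: "coeff_hom (\<lambda>c. [:bp_const c:])"
  by (rule coeff_hom_compose[OF coeff_hom_bp_const coeff_hom_poly_const])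

interpretation grade: coeff_hom "grade p" for p
  unfolding grade_def by (rule coeff_hom_mpoly_eval[OF coeff_hom_poly_bp_const])

lemma grade_const: "grade p (bp_const c) = [:bp_const c:]"
  by (simp add: grade_def mpoly_eval_const[OF coeff_hom_poly_bp_const])

lemma mon_val_X: "mon_val bp_X m = Poly_Mapping.single m 1"
proof -
  have pow: "bp_X v ^ k = Poly_Mapping.single (Poly_Mapping.single v k) 1" for v k
    by (induction k) (simp_all add: bp_X_def mult_single single_add[symmetric])
  have "(\<Prod>i\<in>I. Poly_Mapping.single (g i) 1) = (Poly_Mapping.single (\<Sum>i\<in>I. g i) 1 :: bp_poly)"
    for I :: "bp_var set" and g
    by (induction I rule: infinite_finite_induct) (simp_all add: mult_single)
  then show ?thesis
    by (simp add: mon_val_def pow poly_mapping_sum_single[symmetric])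
qed

lemma mon_val_monom:
  "mon_val (\<lambda>v. monom (bp_X v) (var_weight p v)) m = monom (Poly_Mapping.single m 1) (mon_weight p m)"
proof -
  have "(\<Prod>i\<in>I. monom (g i) (d i)) = monom (\<Prod>i\<in>I. g i) (\<Sum>i\<in>I. d i)"
    for I :: "bp_var set" and g :: "bp_var \<Rightarrow> bp_poly" and d
    by (induction I rule: infinite_finite_induct) (simp_all add: mult_monom)
  then have "mon_val (\<lambda>v. monom (bp_X v) (var_weight p v)) m = monom (mon_val bp_X m) (mon_weight p m)"
    by (simp add: mon_val_def monom_power mon_weight_def mult.commute)
  then show ?thesis by (simp add: mon_val_X)
qed

lemma lookup_coeff_grade:
  "Poly_Mapping.lookup (coeff (grade p P) e) m =
    (if mon_weight p m = e then Poly_Mapping.lookup P m else 0)"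
proof -
  have "grade p P = (\<Sum>m\<in>Poly_Mapping.keys P.
      monom (Poly_Mapping.single m (Poly_Mapping.lookup P m)) (mon_weight p m))"
    unfolding grade_def mpoly_eval_def mon_val_monom
    by (intro sum.cong HOL.refl) (simp add: bp_const_def mult_single smult_monom)
  then have "Poly_Mapping.lookup (coeff (grade p P) e) m = (\<Sum>m'\<in>Poly_Mapping.keys P.
      Poly_Mapping.lookup (coeff (monom (Poly_Mapping.single m' (Poly_Mapping.lookup P m'))
        (mon_weight p m')) e) m)"
    by (simp only: coeff_sum lookup_sum)
  also have "\<dots> = (\<Sum>m'\<in>Poly_Mapping.keys P.
      if m' = m then (if mon_weight p m = e then Poly_Mapping.lookup P m else 0) else 0)"
    by (intro sum.cong HOL.refl) (auto simp: lookup_single)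
  finally show ?thesis
    by (auto simp: in_keys_iff)
qed

lemma bp_homogeneous_iff: "bp_homogeneous p e P \<longleftrightarrow> grade p P = monom P e"
proof
  assume h: "bp_homogeneous p e P"
  have h': "mon_weight p m = e" if "Poly_Mapping.lookup P m \<noteq> 0" for m
    using h that by (simp add: bp_homogeneous_def in_keys_iff mon_weight_def)
  show "grade p P = monom P e"
    by (intro poly_eqI poly_mapping_eqI) (auto simp: lookup_coeff_grade dest: h')
next
  assume g: "grade p P = monom P e"
  show "bp_homogeneous p e P"
    unfolding bp_homogeneous_def
  proof
    fix m assume "m \<in> Poly_Mapping.keys P"
    then have "Poly_Mapping.lookup P m \<noteq> 0" by (simp add: in_keys_iff)
    then have "mon_weight p m = e"
      using lookup_coeff_grade[of p P "mon_weight p m" m] by (auto simp: g split: if_splits)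
    then show "(\<Sum>v\<in>Poly_Mapping.keys m. Poly_Mapping.lookup m v * var_weight p v) = e"
      by (simp add: mon_weight_def)
  qed
qed

text \<open>\<open>H e a\<close> is read as "a is homogeneous of degree e" for a grading of the
  target. It is left abstract because that grading varies: powers of \<ell>_i for
  \<open>lin_part\<close>, weight combined with the power of t_m for \<open>t_part\<close>.\<close>

lemma homogeneous_mpoly_eval:
  assumes P: "bp_homogeneous p e P"
    and zero: "\<And>e. H e 0"
    and add: "\<And>e a b. H e a \<Longrightarrow> H e b \<Longrightarrow> H e (a + b)"
    and mult: "\<And>e e' a b. H e a \<Longrightarrow> H e' b \<Longrightarrow> H (e + e') (a * b)"
    and const: "\<And>c. H 0 (h c)"
    and one: "H 0 1"
    and var: "\<And>v. H (var_weight p v) (f v)"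
  shows "H e (mpoly_eval h f P)"
proof -
  have pow: "H (k * d) (a ^ k)" if "H d a" for a d k
    by (induction k) (use one mult that in auto)
  have "H (\<Sum>v\<in>I. Poly_Mapping.lookup m v * var_weight p v) (\<Prod>v\<in>I. f v ^ Poly_Mapping.lookup m v)"
    for I m
    by (induction I rule: infinite_finite_induct) (use one mult pow var in auto)
  then have mon: "H (mon_weight p m) (mon_val f m)" for m
    by (simp add: mon_weight_def mon_val_def)
  have sum: "(\<And>i. i \<in> I \<Longrightarrow> H e (g i)) \<Longrightarrow> H e (\<Sum>i\<in>I. g i)"
    for I :: "(bp_var \<Rightarrow>\<^sub>0 nat) set" and g
    by (induction I rule: infinite_finite_induct) (use zero add in auto)
  show ?thesis
    unfolding mpoly_eval_def
  proof (rule sum)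
    fix m assume "m \<in> Poly_Mapping.keys P"
    then have "mon_weight p m = e" using P by (simp add: bp_homogeneous_def mon_weight_def)
    then show "H e (h (Poly_Mapping.lookup P m) * mon_val f m)"
      using mult[OF const mon[of m]] by simp
  qed
qed

lemma grade_X: "grade p (bp_X v) = monom (bp_X v) (var_weight p v)"
  by (simp add: grade_def mpoly_eval_X[OF coeff_hom_poly_bp_const])

lemma grade_log: "grade p (log_c n) = monom (log_c n) (p ^ n - 1)"
  by (simp add: log_c_def grade.hom_1 grade_X)

lemma grade_tt: "grade p (tt n) = monom (tt n) (p ^ n - 1)"
  by (simp add: tt_def grade.hom_1 grade_X)

text \<open>The weight of \<ell>_i times the power \<open>p ^ i\<close> of v_{n-i} or t_{n-i}. It
  makes Hazewinkel's recursion and the right unit homogeneous.\<close>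

lemma prime_power_weight:
  assumes "prime p" "i \<le> n"
  shows "p ^ i - 1 + p ^ i * (p ^ (n - i) - 1) = p ^ n - (1::nat)"
proof -
  have "p ^ i * p ^ (n - i) = p ^ n" using assms by (simp add: power_add[symmetric])
  moreover have "p ^ i \<ge> 1" "p ^ i \<le> p ^ n" using assms prime_gt_0_nat[of p] by (auto intro: power_increasing)
  ultimately show ?thesis by (simp add: diff_mult_distrib2)
qed

lemma grade_hazewinkel:
  assumes "prime p" shows "grade p (hazewinkel p n) = monom (hazewinkel p n) (p ^ n - 1)"
proof (induction n rule: less_induct)
  case (less n)
  have eq: "hazewinkel p n =
      of_nat p * log_c n - (\<Sum>i\<in>{1..<n}. log_c i * hazewinkel p (n - i) ^ (p ^ i))"
    by (simp add: hazewinkel_recursion)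
  have "grade p (of_nat p * log_c n - (\<Sum>i\<in>{1..<n}. log_c i * hazewinkel p (n - i) ^ (p ^ i))) =
     of_nat p * monom (log_c n) (p ^ n - 1) -
      (\<Sum>i\<in>{1..<n}. monom (log_c i * hazewinkel p (n - i) ^ (p ^ i)) (p ^ n - 1))"
    unfolding grade.hom_simps grade_log
  proof (intro arg_cong2[of _ _ _ _ "(-)"] sum.cong HOL.refl)
    fix i assume i: "i \<in> {1..<n}"
    then have "p ^ i - 1 + p ^ i * (p ^ (n - i) - 1) = p ^ n - (1::nat)"
      by (intro prime_power_weight assms) simp
    then show "monom (log_c i) (p ^ i - 1) * grade p (hazewinkel p (n - i)) ^ p ^ i =
        monom (log_c i * hazewinkel p (n - i) ^ p ^ i) (p ^ n - 1)"
      using less.IH[of "n - i"] i by (simp add: monom_power mult_monom mult.commute)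
  qed
  also have "\<dots> = monom (of_nat p * log_c n -
      (\<Sum>i\<in>{1..<n}. log_c i * hazewinkel p (n - i) ^ (p ^ i))) (p ^ n - 1)"
  proof -
    have "of_nat p * monom (log_c n) (p ^ n - 1) = monom (of_nat p * log_c n) (p ^ n - 1)"
      by (simp add: of_nat_monom mult_monom)
    moreover have "(\<Sum>i\<in>I. monom (g i) d) = monom (\<Sum>i\<in>I. g i) d"
      for I :: "nat set" and g :: "nat \<Rightarrow> bp_poly" and d
      by (induction I rule: infinite_finite_induct) (simp_all add: add_monom)
    ultimately show ?thesis by (simp add: diff_monom)
  qed
  finally show ?case by (simp only: eq[symmetric])
qed

text \<open>Coefficients of a product are sums of products of coefficients, so membership in
  \<open>R\<close> can be tested on constants and generators. The coefficients of
  \<open>grade\<close>, \<open>lin_part\<close> and \<open>t_part\<close> are all located this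
  way.\<close>

lemma poly_alg_coeff_closed:
  fixes F :: "bp_poly \<Rightarrow> 'b::comm_ring_1 poly"
  assumes "coeff_hom F" "b \<in> poly_alg p S"
    and "0 \<in> R" "\<And>x y. x \<in> R \<Longrightarrow> y \<in> R \<Longrightarrow> x + y \<in> R" "\<And>x y. x \<in> R \<Longrightarrow> y \<in> R \<Longrightarrow> x * y \<in> R"
    and "\<And>c k. c \<in> localised_int p \<Longrightarrow> coeff (F (bp_const c)) k \<in> R"
    and "\<And>P k. P \<in> S \<Longrightarrow> coeff (F P) k \<in> R"
  shows "coeff (F b) k \<in> R"
  using assms(2)
proof (induction arbitrary: k rule: poly_alg.induct)
  case (mult P Q)
  then show ?case
    unfolding coeff_hom.hom_mult[OF assms(1)]
    by (intro coeff_mult_semiring_closed) (use assms in auto)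
qed (use assms in \<open>auto simp: coeff_hom.hom_add[OF assms(1)]\<close>)

lemma coeff_poly_const: "coeff [:a:] k = (if k = 0 then a else 0)"
  by (cases k) simp_all

lemma coeff_grade_in_BP:
  assumes "prime p" "b \<in> BP p" shows "coeff (grade p b) e \<in> BP p"
proof -
  interpret S: local_alg p "BP p" using assms(1) by (rule local_alg_BP)
  show ?thesis
    by (rule poly_alg_coeff_closed[OF grade.coeff_hom_axioms assms(2)[unfolded BP_def]])
      (auto intro!: S.closed simp: grade_const grade_hazewinkel[OF assms(1)] coeff_poly_const
        hazewinkel_in_BP[OF assms(1)])
qed

text \<open>An integral ring larger than BP_*, in which each v_n is divisible by \<open>p\<close>
  and congruent to \<open>p * log_c n\<close> modulo \<open>p^2\<close>; the class modulo
  \<open>p^2\<close> is what detects v_n. Restricted to the variables \<ell>_i it is the p-local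
  homology of BP.\<close>

definition int_poly :: "nat \<Rightarrow> bp_poly set"
  where "int_poly p = poly_alg p (range bp_X)"

lemma local_alg_int_poly: "prime p \<Longrightarrow> local_alg p (int_poly p)"
  unfolding int_poly_def by (rule local_alg_poly_alg)

lemma X_in_int_poly: "bp_X v \<in> int_poly p"
  unfolding int_poly_def by (auto intro: poly_alg.gen)

lemma log_in_int_poly: "prime p \<Longrightarrow> log_c n \<in> int_poly p"
  by (simp add: log_c_def X_in_int_poly local_alg.one_in[OF local_alg_int_poly])

lemma coeff_grade_in_int_poly:
  assumes "prime p" "b \<in> int_poly p" shows "coeff (grade p b) e \<in> int_poly p"
proof -
  interpret S: local_alg p "int_poly p" using assms(1) by (rule local_alg_int_poly)
  show ?thesis
    by (rule poly_alg_coeff_closed[OF grade.coeff_hom_axioms assms(2)[unfolded int_poly_def]])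
      (auto intro!: S.closed simp: grade_const coeff_poly_const X_in_int_poly
        grade_X)
qed

text \<open>Each correction term contains some v_{n-i} with exponent \<open>p ^ i \<ge> 2\<close>,
  and by induction v_{n-i} is a multiple of \<open>p\<close>.\<close>

lemma hazewinkel_mod_p_squared:
  assumes "prime p"
  shows "n \<ge> 1 \<Longrightarrow> \<exists>z\<in>int_poly p. hazewinkel p n = of_nat p * log_c n + of_nat p ^ 2 * z"
proof (induction n rule: less_induct)
  case (less n)
  interpret S: local_alg p "int_poly p" using assms(1) by (rule local_alg_int_poly)
  have "\<exists>u\<in>int_poly p. log_c i * hazewinkel p (n - i) ^ (p ^ i) = of_nat p ^ 2 * u"
    if i: "i \<in> {1..<n}" for i
  proof -
    obtain z where z: "z \<in> int_poly p"
      "hazewinkel p (n - i) = of_nat p * log_c (n - i) + of_nat p ^ 2 * z"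
      using less.IH[of "n - i"] i by fastforce
    define y where "y = log_c (n - i) + of_nat p * z"
    have y: "y \<in> int_poly p" "hazewinkel p (n - i) = of_nat p * y"
      unfolding y_def using z by (auto intro!: S.closed log_in_int_poly assms simp: algebra_simps power2_eq_square)
    have "p ^ i \<ge> p ^ 1" using i prime_gt_0_nat[OF assms] by (intro power_increasing) auto
    then have "p ^ i \<ge> 2" using prime_ge_2_nat[OF assms] by simp
    then obtain k where k: "p ^ i = 2 + k" using le_Suc_ex by blast
    have "log_c i * hazewinkel p (n - i) ^ (p ^ i) =
        of_nat p ^ 2 * (log_c i * of_nat p ^ k * y ^ (2 + k))"
      by (simp only: y k power_mult_distrib power_add mult_ac)
    then show ?thesis
      by (intro bexI[of _ "log_c i * of_nat p ^ k * y ^ (2 + k)"])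
        (auto intro!: S.closed log_in_int_poly assms y)
  qed
  then obtain u where u: "\<And>i. i \<in> {1..<n} \<Longrightarrow> u i \<in> int_poly p \<and>
      log_c i * hazewinkel p (n - i) ^ (p ^ i) = of_nat p ^ 2 * u i" by metis
  have "hazewinkel p n =
      of_nat p * log_c n - (\<Sum>i\<in>{1..<n}. log_c i * hazewinkel p (n - i) ^ (p ^ i))"
    by (simp add: hazewinkel_recursion)
  also have "(\<Sum>i\<in>{1..<n}. log_c i * hazewinkel p (n - i) ^ (p ^ i)) = of_nat p ^ 2 * (\<Sum>i\<in>{1..<n}. u i)"
    unfolding sum_distrib_left by (intro sum.cong HOL.refl) (use u in auto)
  finally have "hazewinkel p n = of_nat p * log_c n + of_nat p ^ 2 * (- (\<Sum>i\<in>{1..<n}. u i))"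
    by simp
  then show ?case
    by (rule bexI) (use u in \<open>auto intro!: S.closed S.sum_in\<close>)
qed

lemma hazewinkel_dvd_p:
  assumes "prime p"
  shows "\<exists>z\<in>int_poly p. hazewinkel p n = of_nat p * z"
proof (cases "n = 0")
  case True
  then show ?thesis
    by (intro bexI[of _ 1]) (simp_all add: local_alg.one_in[OF local_alg_int_poly[OF assms]])
next
  case False
  interpret S: local_alg p "int_poly p" using assms(1) by (rule local_alg_int_poly)
  obtain z where "z \<in> int_poly p" "hazewinkel p n = of_nat p * log_c n + of_nat p ^ 2 * z"
    using hazewinkel_mod_p_squared[OF assms, of n] False by auto
  then show ?thesis
    by (intro bexI[of _ "log_c n + of_nat p * z"])
      (auto intro!: S.closed log_in_int_poly assms simp: algebra_simps power2_eq_square)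
qed

lemma BP_subset_int_poly:
  assumes "prime p" "b \<in> BP p" shows "b \<in> int_poly p"
proof -
  interpret S: local_alg p "int_poly p" using assms(1) by (rule local_alg_int_poly)
  have "hazewinkel p n \<in> int_poly p" for n
    using hazewinkel_dvd_p[OF assms(1), of n] by (auto intro!: S.closed)
  with assms(2)[unfolded BP_def] show ?thesis
    by (induction rule: poly_alg.induct) (auto intro!: S.closed)
qed

section \<open>Weight components of elements of BP_*\<close>

lemma prime_power_minus_1_eq_iff:
  assumes "prime p" shows "p ^ k - 1 = p ^ n - (1::nat) \<longleftrightarrow> k = n"
proof -
  have "p ^ k \<ge> 1" "p ^ n \<ge> 1" using prime_gt_0_nat[OF assms] by simp_all
  then have "p ^ k - 1 = p ^ n - (1::nat) \<longleftrightarrow> p ^ k = p ^ n" by linarith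
  then show ?thesis using prime_gt_1_nat[OF assms] by simp
qed

lemma prime_power_minus_1_pos:
  assumes "prime p" "k \<ge> 1" shows "p ^ k - 1 > (0::nat)"
  using one_less_power[OF prime_gt_1_nat[OF assms(1)], of k] assms(2) by simp

text \<open>All generators have positive weight, so only constants are visible in weight 0.\<close>

lemma coeff_grade_0:
  assumes "prime p" "b \<in> BP p"
  shows "\<exists>c\<in>localised_int p. coeff (grade p b) 0 = bp_const c"
proof -
  have h: "coeff_hom (\<lambda>b. coeff (grade p b) 0)"
    by (rule coeff_hom_compose[OF grade.coeff_hom_axioms coeff_hom_coeff_0])
  from assms(2)[unfolded BP_def] show ?thesis
  proof (induction rule: poly_alg.induct)
    case (const c)
    then show ?case by (auto simp: grade_const)
  next
    case (gen P)
    then obtain k where k: "P = hazewinkel p k" "k \<ge> 1" by blast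
    have "p ^ k - 1 \<noteq> 0" using prime_power_minus_1_pos[OF assms(1) k(2)] by simp
    then have "coeff (grade p P) 0 = bp_const 0"
      unfolding k(1) grade_hazewinkel[OF assms(1)] coeff_monom by simp
    then show ?case using assms(1) localised_int_0 by blast
  next
    case (add P Q)
    then show ?case
      by (auto simp: grade.hom_add bp_const.hom_add[symmetric] intro!: localised_int_add assms)
  next
    case (mult P Q)
    then show ?case
      by (auto simp: grade.hom_mult coeff_mult_0 bp_const.hom_mult[symmetric]
          intro!: localised_int_mult assms)
  qed
qed

text \<open>Generators are multiples of \<open>p\<close>, and in a product of positive total weight
  at least one of the two components has positive weight.\<close>

lemma coeff_grade_pos_dvd_p:
  assumes "prime p" "b \<in> BP p" "e > 0"
  shows "\<exists>z\<in>int_poly p. coeff (grade p b) e = of_nat p * z"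
proof -
  interpret S: local_alg p "int_poly p" using assms(1) by (rule local_alg_int_poly)
  define pL where "pL = {of_nat p * z | z. z \<in> int_poly p}"
  have pL_I: "of_nat p * z \<in> pL" if "z \<in> int_poly p" for z
    using that unfolding pL_def by blast
  have pL_E: "\<exists>z\<in>int_poly p. x = of_nat p * z" if "x \<in> pL" for x
    using that unfolding pL_def by blast
  have pL_mult: "x * y \<in> pL" if x: "x \<in> pL" and y: "y \<in> int_poly p" for x y
  proof -
    obtain z where "z \<in> int_poly p" "x = of_nat p * z" using pL_E[OF x] by blast
    then show ?thesis using pL_I[of "z * y"] S.mult_in y by (simp add: mult.assoc)
  qed
  have pL_add: "x + y \<in> pL" if x: "x \<in> pL" and y: "y \<in> pL" for x y
  proof -
    obtain z z' where "z \<in> int_poly p" "x = of_nat p * z" "z' \<in> int_poly p" "y = of_nat p * z'"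
      using pL_E[OF x] pL_E[OF y] by blast
    then show ?thesis using pL_I[of "z + z'"] S.add_in by (simp add: distrib_left)
  qed
  have pL_0: "0 \<in> pL" using pL_I[of 0] by simp
  have pL_sum: "(\<And>i. i \<in> I \<Longrightarrow> g i \<in> pL) \<Longrightarrow> (\<Sum>i\<in>I. g i) \<in> pL" for I :: "nat set" and g
    by (induction I rule: infinite_finite_induct) (use pL_0 pL_add in simp_all)
  have "b \<in> BP p \<and> (\<forall>e>0. coeff (grade p b) e \<in> pL)"
    using assms(2)[unfolded BP_def]
  proof (induction rule: poly_alg.induct)
    case (const c)
    from local_alg.const_in[OF local_alg_BP[OF assms(1)] const] pL_0 show ?case
      by (auto simp: grade_const coeff_poly_const)
  next
    case (gen P)
    then obtain k where k: "P = hazewinkel p k" by blast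
    have "P \<in> pL" using hazewinkel_dvd_p[OF assms(1), of k] pL_I k by auto
    with k pL_0 hazewinkel_in_BP[OF assms(1)] show ?case
      by (auto simp: grade_hazewinkel[OF assms(1)])
  next
    case (add P Q)
    then show ?case
      by (auto simp: grade.hom_add intro: pL_add local_alg.add_in[OF local_alg_BP[OF assms(1)]])
  next
    case (mult P Q)
    have "coeff (grade p (P * Q)) e \<in> pL" if "e > 0" for e
      unfolding grade.hom_mult coeff_mult
    proof (rule pL_sum)
      fix i assume i: "i \<in> {..e}"
      have *: "coeff (grade p P) i \<in> int_poly p" "coeff (grade p Q) (e - i) \<in> int_poly p"
        using mult.IH BP_subset_int_poly[OF assms(1)] coeff_grade_in_int_poly[OF assms(1)] by blast+
      show "coeff (grade p P) i * coeff (grade p Q) (e - i) \<in> pL"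
      proof (cases "i = 0")
        case True
        then have "coeff (grade p Q) (e - i) \<in> pL" using mult.IH \<open>e > 0\<close> by auto
        then show ?thesis using * pL_mult by (subst mult.commute) blast
      next
        case False
        then have "coeff (grade p P) i \<in> pL" using mult.IH by auto
        then show ?thesis using * pL_mult by blast
      qed
    qed
    then show ?case
      using mult.IH by (auto intro: local_alg.mult_in[OF local_alg_BP[OF assms(1)]])
  qed
  then show ?thesis using assms(3) pL_E by blast
qed

text \<open>A product of two components of positive weight is divisible by \<open>p^2\<close>, and
  v_k with k different from n has another weight. Modulo \<open>p^2\<close> only a multiple of v_n,
  hence of \<open>p * log_c n\<close>, survives.\<close>

lemma coeff_grade_mod_p_squared:
  assumes "prime p" "b \<in> BP p" "n \<ge> 1"
  shows "\<exists>a\<in>localised_int p. \<exists>z\<in>int_poly p.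
    coeff (grade p b) (p ^ n - 1) = bp_const (of_nat p * a) * log_c n + of_nat p ^ 2 * z"
proof -
  interpret S: local_alg p "int_poly p" using assms(1) by (rule local_alg_int_poly)
  define W where "W = {bp_const (of_nat p * a) * log_c n + of_nat p ^ 2 * z | a z.
    a \<in> localised_int p \<and> z \<in> int_poly p}"
  define d where "d = p ^ n - 1"
  have d: "d > 0" unfolding d_def by (rule prime_power_minus_1_pos[OF assms(1,3)])
  have W_I: "bp_const (of_nat p * a) * log_c n + of_nat p ^ 2 * z \<in> W"
    if "a \<in> localised_int p" "z \<in> int_poly p" for a z
    using that unfolding W_def by blast
  have W_0: "0 \<in> W"
    using W_I[of 0 0] assms(1) by simp
  have W_add: "x + y \<in> W" if "x \<in> W" "y \<in> W" for x y
  proof -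
    from that obtain a z a' z' where *: "a \<in> localised_int p" "z \<in> int_poly p"
      "a' \<in> localised_int p" "z' \<in> int_poly p"
      "x = bp_const (of_nat p * a) * log_c n + of_nat p ^ 2 * z"
      "y = bp_const (of_nat p * a') * log_c n + of_nat p ^ 2 * z'"
      unfolding W_def by blast
    then have "x + y = bp_const (of_nat p * (a + a')) * log_c n + of_nat p ^ 2 * (z + z')"
      by (simp add: distrib_left distrib_right bp_const.hom_add)
    then show ?thesis using W_I[of "a + a'" "z + z'"] * localised_int_add[OF assms(1)] S.add_in by simp
  qed
  have W_const: "bp_const c * x \<in> W" if "x \<in> W" "c \<in> localised_int p" for c x
  proof -
    from that obtain a z where *: "a \<in> localised_int p" "z \<in> int_poly p"
      "x = bp_const (of_nat p * a) * log_c n + of_nat p ^ 2 * z"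
      unfolding W_def by blast
    then have "bp_const c * x = bp_const (of_nat p * (c * a)) * log_c n + of_nat p ^ 2 * (bp_const c * z)"
      by (simp add: distrib_left bp_const.hom_mult mult_ac)
    then show ?thesis
      using W_I[of "c * a" "bp_const c * z"] * that localised_int_mult[OF assms(1)] S.closed by simp
  qed
  have W_sum: "(\<And>i. i \<in> I \<Longrightarrow> g i \<in> W) \<Longrightarrow> (\<Sum>i\<in>I. g i) \<in> W" for I :: "nat set" and g
    by (induction I rule: infinite_finite_induct) (use W_0 W_add in simp_all)
  have "b \<in> BP p \<and> coeff (grade p b) d \<in> W"
    using assms(2)[unfolded BP_def]
  proof (induction rule: poly_alg.induct)
    case (const c)
    from local_alg.const_in[OF local_alg_BP[OF assms(1)] const] W_0 d show ?case
      by (simp add: grade_const coeff_poly_const)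
  next
    case (gen P)
    then obtain k where k: "P = hazewinkel p k" "k \<ge> 1" by blast
    have "coeff (grade p P) d \<in> W"
    proof (cases "k = n")
      case True
      obtain z where "z \<in> int_poly p" "hazewinkel p k = of_nat p * log_c k + of_nat p ^ 2 * z"
        using hazewinkel_mod_p_squared[OF assms(1) k(2)] by blast
      then have "hazewinkel p n \<in> W"
        using W_I[of 1 z] True assms(1) by (simp add: bp_const_of_nat)
      then show ?thesis
        using True by (simp add: k grade_hazewinkel[OF assms(1)] d_def)
    next
      case False
      then show ?thesis
        using W_0 by (simp add: k grade_hazewinkel[OF assms(1)] d_def prime_power_minus_1_eq_iff[OF assms(1)]
            del: One_nat_def)
    qed
    then show ?case using k hazewinkel_in_BP[OF assms(1)] by simp
  next
    case (add P Q)
    then show ?case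
      by (auto simp: grade.hom_add intro: W_add local_alg.add_in[OF local_alg_BP[OF assms(1)]])
  next
    case (mult P Q)
    have "coeff (grade p P) i * coeff (grade p Q) (d - i) \<in> W" if i: "i \<in> {..d}" for i
    proof -
      consider "i = 0" | "i = d" | "i > 0" "d - i > 0" using i by force
      then show ?thesis
      proof cases
        case 1
        then show ?thesis using coeff_grade_0[OF assms(1)] W_const mult.IH by fastforce
      next
        case 2
        then show ?thesis using coeff_grade_0[OF assms(1), of Q] W_const mult.IH
          by (fastforce simp: mult.commute[of "coeff (grade p P) d"])
      next
        case 3
        then obtain z z' where "z \<in> int_poly p" "coeff (grade p P) i = of_nat p * z"
          "z' \<in> int_poly p" "coeff (grade p Q) (d - i) = of_nat p * z'"
          using coeff_grade_pos_dvd_p[OF assms(1)] mult.IH by meson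
        then show ?thesis
          using W_I[of 0 "z * z'"] assms(1) S.mult_in by (simp add: power2_eq_square mult_ac)
      qed
    qed
    then show ?case
      using mult.IH
      by (auto simp: grade.hom_mult coeff_mult
          intro: W_sum local_alg.mult_in[OF local_alg_BP[OF assms(1)]])
  qed
  then show ?thesis unfolding W_def d_def by blast
qed

text \<open>A monomial of weight \<open>p ^ i - 1\<close> in the v_j is either v_i or contains only
  v_j with j < i, which lie in \<open>I\<close>. The induction has to carry all positive weights up
  to this one, since the factors of a product have smaller weight; strictly below it the components
  lie in \<open>I\<close> itself.\<close>

lemma coeff_grade_mod_ideal:
  assumes "prime p" "b \<in> BP p" "i \<ge> 1"
    and I: "0 \<in> I" "\<And>x y. x \<in> I \<Longrightarrow> y \<in> I \<Longrightarrow> x + y \<in> I"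
      "\<And>x y. x \<in> BP p \<Longrightarrow> y \<in> I \<Longrightarrow> x * y \<in> I" "I \<subseteq> BP p"
    and v: "\<And>j. 1 \<le> j \<Longrightarrow> j < i \<Longrightarrow> hazewinkel p j \<in> I"
  shows "\<exists>a\<in>localised_int p. \<exists>y\<in>I. coeff (grade p b) (p ^ i - 1) = bp_const a * hazewinkel p i + y"
proof -
  interpret S: local_alg p "BP p" using assms(1) by (rule local_alg_BP)
  define d where "d = p ^ i - 1"
  have d: "d > 0" unfolding d_def by (rule prime_power_minus_1_pos[OF assms(1,3)])
  define W where "W e = (if e = d then {bp_const a * hazewinkel p i + y | a y. a \<in> localised_int p \<and> y \<in> I} else I)" for e
  have W_I: "bp_const a * hazewinkel p i + y \<in> W d" if "a \<in> localised_int p" "y \<in> I" for a y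
    using that unfolding W_def by auto
  have I_W: "x \<in> W e" if "x \<in> I" for x e
    using that W_I[of 0 x] assms(1) by (cases "e = d") (simp_all add: W_def)
  have W_add: "x + y \<in> W e" if "x \<in> W e" "y \<in> W e" for x y e
  proof (cases "e = d")
    case True
    with that obtain a z a' z' where *: "a \<in> localised_int p" "z \<in> I"
      "a' \<in> localised_int p" "z' \<in> I"
      "x = bp_const a * hazewinkel p i + z"
      "y = bp_const a' * hazewinkel p i + z'"
      unfolding W_def by auto
    have "x + y = bp_const (a + a') * hazewinkel p i + (z + z')"
      unfolding * by (simp add: distrib_right bp_const.hom_add)
    then show ?thesis using W_I[of "a + a'" "z + z'"] *(1-4) localised_int_add[OF assms(1)] I(2) True by simp
  next
    case False
    then show ?thesis using that I unfolding W_def by simp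
  qed
  have W_const: "bp_const c * x \<in> W e" if "x \<in> W e" "c \<in> localised_int p" for c x e
  proof (cases "e = d")
    case True
    with that obtain a z where *: "a \<in> localised_int p" "z \<in> I"
      "x = bp_const a * hazewinkel p i + z"
      unfolding W_def by auto
    then have "bp_const c * x = bp_const (c * a) * hazewinkel p i + bp_const c * z"
      by (simp add: distrib_left bp_const.hom_mult mult_ac)
    then show ?thesis
      using W_I[of "c * a" "bp_const c * z"] * that localised_int_mult[OF assms(1)] I S.closed True by simp
  next
    case False
    then show ?thesis using that I S.const_in unfolding W_def by simp
  qed
  have W_sum: "(\<And>i. i \<in> J \<Longrightarrow> g i \<in> W e) \<Longrightarrow> (\<Sum>i\<in>J. g i) \<in> W e" for J :: "nat set" and g e
    by (induction J rule: infinite_finite_induct) (use I_W I(1) W_add in simp_all)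
  have "b \<in> BP p \<and> (\<forall>e. 0 < e \<longrightarrow> e \<le> d \<longrightarrow> coeff (grade p b) e \<in> W e)"
    using assms(2)[unfolded BP_def]
  proof (induction rule: poly_alg.induct)
    case (const c)
    then show ?case using I_W[OF I(1)]
      by (auto simp: grade_const coeff_poly_const intro: S.const_in)
  next
    case (gen P)
    then obtain k where k: "P = hazewinkel p k" "k \<ge> 1" by blast
    have "coeff (grade p P) e \<in> W e" if "0 < e" "e \<le> d" for e
    proof (cases "e = p ^ k - 1")
      case True
      with that have "p ^ k \<le> p ^ i" unfolding d_def
        using prime_gt_0_nat[OF assms(1)] by (simp add: le_diff_iff)
      then have "k \<le> i" using prime_gt_1_nat[OF assms(1)] by simp
      then consider "k = i" | "k < i" by linarith
      then show ?thesis
      proof cases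
        case 1
        then show ?thesis using True W_I[of 1 0] assms(1) I(1)
          by (simp add: k grade_hazewinkel d_def)
      next
        case 2
        then show ?thesis using True v[OF k(2)] I_W assms(1)
          by (simp add: k grade_hazewinkel)
      qed
    next
      case False
      then show ?thesis using I_W[OF I(1)] by (simp add: k grade_hazewinkel[OF assms(1)])
    qed
    then show ?case using k hazewinkel_in_BP[OF assms(1)] by simp
  next
    case (add P Q)
    then show ?case
      by (auto simp: grade.hom_add intro: W_add S.add_in)
  next
    case (mult P Q)
    have "coeff (grade p P) i * coeff (grade p Q) (e - i) \<in> W e"
      if e: "0 < e" "e \<le> d" and i: "i \<in> {..e}" for i e
    proof -
      consider "i = 0" | "i = e" | "i > 0" "e - i > 0" using i by force
      then show ?thesis
      proof cases
        case 1
        then show ?thesis using coeff_grade_0[OF assms(1), of P] W_const mult.IH e by fastforce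
      next
        case 2
        then show ?thesis using coeff_grade_0[OF assms(1), of Q] W_const mult.IH e
          by (fastforce simp: mult.commute[of "coeff (grade p P) e"])
      next
        case 3
        \<comment> \<open>Both factors have positive weight, so the first stays below
          \<open>d\<close>. There the induction gives membership in \<open>I\<close> without a
          multiple of the generator.\<close>
        then have "i \<noteq> d" "i \<le> d" using e i by auto
        then have "coeff (grade p P) i \<in> W i" using mult.IH 3 by blast
        with \<open>i \<noteq> d\<close> have "coeff (grade p P) i \<in> I" unfolding W_def by simp
        moreover have "coeff (grade p Q) (e - i) \<in> BP p"
          using coeff_grade_in_BP[OF assms(1)] mult.IH by blast
        ultimately have "coeff (grade p Q) (e - i) * coeff (grade p P) i \<in> I" by (intro I(3))
        then show ?thesis using I_W by (simp add: mult.commute)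
      qed
    qed
    then show ?case
      using mult.IH by (auto simp: grade.hom_mult coeff_mult intro: W_sum S.mult_in)
  qed
  then have "coeff (grade p b) d \<in> W d" using d by blast
  then show ?thesis unfolding W_def d_def by auto
qed

text \<open>Only the coefficients \<open>0\<close> and \<open>1\<close> are used: the constant term and the coefficient of \<open>\<ell>\<^sub>i\<close>.\<close>

definition lin_part :: "nat \<Rightarrow> bp_poly \<Rightarrow> rat poly"
  where "lin_part i = mpoly_eval (\<lambda>c. [:c:]) (\<lambda>v. if v = Log i then [:0, 1:] else 0)"

interpretation lin_part: coeff_hom "lin_part i" for i
  unfolding lin_part_def by (rule coeff_hom_mpoly_eval[OF coeff_hom_poly_const])

lemma lin_part_const: "lin_part i (bp_const c) = [:c:]"
  by (simp add: lin_part_def mpoly_eval_const[OF coeff_hom_poly_const])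

lemma lin_part_X: "lin_part i (bp_X v) = (if v = Log i then [:0, 1:] else 0)"
  by (simp add: lin_part_def mpoly_eval_X[OF coeff_hom_poly_const])

lemma coeff_lin_part_in:
  assumes "prime p" "b \<in> int_poly p" shows "coeff (lin_part i b) k \<in> localised_int p"
  by (rule poly_alg_coeff_closed[OF lin_part.coeff_hom_axioms assms(2)[unfolded int_poly_def]])
    (use assms(1) in \<open>auto simp: localised_int_add localised_int_mult lin_part_const lin_part_X
      coeff_poly_const coeff_pCons split: nat.splits\<close>)

lemma sum_neq_0_obtains:
  assumes "(\<Sum>i\<in>A. f i) \<noteq> (0::'a::comm_monoid_add)"
  obtains i where "i \<in> A" "f i \<noteq> 0"
  using assms sum.neutral by metis

text \<open>The one surviving variable \<ell>_i has weight \<open>p ^ i - 1\<close>. Consequently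
  the linear coefficient vanishes on homogeneous elements of any other weight.\<close>

lemma lin_part_homogeneous:
  assumes "bp_homogeneous p e b" "coeff (lin_part i b) k \<noteq> 0"
  shows "k * (p ^ i - 1) = e"
proof -
  let ?H = "\<lambda>e F. \<forall>k. coeff F k \<noteq> 0 \<longrightarrow> k * (p ^ i - 1) = e"
  have "?H e (mpoly_eval (\<lambda>c. [:c:]) (\<lambda>v. if v = Log i then [:0, 1:] else 0 :: rat poly) b)"
  proof (rule homogeneous_mpoly_eval[where H = ?H, OF assms(1)])
    show "?H e (A + B)" if "?H e A" "?H e B" for e and A B :: "rat poly"
      using that by (auto dest: add_nonneg_eq_0_iff) (metis add.right_neutral)
    show "?H (e + e') (A * B)" if *: "?H e A" "?H e' B" for e e' and A B :: "rat poly"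
    proof (intro allI impI)
      fix k assume "coeff (A * B) k \<noteq> 0"
      then obtain a where a: "a \<in> {..k}" "coeff A a * coeff B (k - a) \<noteq> 0"
        unfolding coeff_mult by (rule sum_neq_0_obtains)
      then have "a * (p ^ i - 1) = e" "(k - a) * (p ^ i - 1) = e'" using * by auto
      moreover have "k = a + (k - a)" using a by simp
      ultimately show "k * (p ^ i - 1) = e + e'" by (metis add_mult_distrib)
    qed
    show "?H 0 [:c:]" for c :: rat
      by (simp add: coeff_poly_const)
    show "?H 0 (1 :: rat poly)"
      by (simp add: one_pCons coeff_poly_const)
    show "?H (var_weight p v) (if v = Log i then [:0, 1:] else 0 :: rat poly)" for v
      by (auto simp: coeff_pCons split: nat.splits)
  qed simp
  then show ?thesis using assms(2) unfolding lin_part_def by blast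
qed

section \<open>Restriction to one of the variables of \<open>BP\<^sub>*BP\<close>\<close>

text \<open>On BP_*BP this is the reduction to BP_*[t_m]. One variable suffices, as the coefficient
  that yields v_i involves only t_{n-i}, and it keeps the nilpotence argument univariate.\<close>

definition t_part :: "nat \<Rightarrow> bp_poly \<Rightarrow> bp_poly poly"
  where "t_part m = mpoly_eval (\<lambda>c. [:bp_const c:])
    (\<lambda>v. case v of Log n \<Rightarrow> [:bp_X (Log n):] | T j \<Rightarrow> if j = m then [:0, 1:] else 0 | T2 j \<Rightarrow> 0)"

interpretation t_part: coeff_hom "t_part m" for m
  unfolding t_part_def by (rule coeff_hom_mpoly_eval[OF coeff_hom_poly_bp_const])

lemma t_part_const: "t_part m (bp_const c) = [:bp_const c:]"
  by (simp add: t_part_def mpoly_eval_const[OF coeff_hom_poly_bp_const])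

lemma t_part_X: "t_part m (bp_X v) =
    (case v of Log n \<Rightarrow> [:bp_X (Log n):] | T j \<Rightarrow> if j = m then [:0, 1:] else 0 | T2 j \<Rightarrow> 0)"
  by (simp add: t_part_def mpoly_eval_X[OF coeff_hom_poly_bp_const])

lemma t_part_log: "t_part m (log_c n) = [:log_c n:]"
  by (simp add: log_c_def t_part_X t_part.hom_1 one_pCons)

lemma t_part_tt:
  "t_part m (tt j) = (if j = 0 then 1 else if j = m then [:0, 1:] else 0)"
  by (simp add: tt_def t_part_X t_part.hom_1)

interpretation poly_const: coeff_hom "\<lambda>c::'a::comm_ring_1. [:c:]"
  by (rule coeff_hom_poly_const)

lemma t_part_hazewinkel: "t_part m (hazewinkel p n) = [:hazewinkel p n:]"
proof (induction n rule: less_induct)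
  case (less n)
  have eq: "hazewinkel p n =
      of_nat p * log_c n - (\<Sum>i\<in>{1..<n}. log_c i * hazewinkel p (n - i) ^ (p ^ i))"
    by (simp add: hazewinkel_recursion)
  have "t_part m (of_nat p * log_c n - (\<Sum>i\<in>{1..<n}. log_c i * hazewinkel p (n - i) ^ (p ^ i))) =
      [:of_nat p * log_c n - (\<Sum>i\<in>{1..<n}. log_c i * hazewinkel p (n - i) ^ (p ^ i)):]"
    unfolding t_part.hom_simps poly_const.hom_simps t_part_log
    by (intro arg_cong2[of _ _ _ _ "(-)"] sum.cong HOL.refl) (use less.IH in auto)
  then show ?case by (simp only: eq[symmetric])
qed

lemma t_part_BP: "b \<in> BP p \<Longrightarrow> t_part m b = [:b:]"
  unfolding BP_def
  by (induction rule: poly_alg.induct)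
    (auto simp: t_part_const t_part.hom_simps t_part_hazewinkel)

lemma coeff_t_part_in_BP:
  assumes "prime p" "b \<in> BPBP p" shows "coeff (t_part m b) k \<in> BP p"
proof -
  interpret S: local_alg p "BP p" using assms(1) by (rule local_alg_BP)
  show ?thesis
    by (rule poly_alg_coeff_closed[OF t_part.coeff_hom_axioms assms(2)[unfolded BPBP_def]])
      (auto intro!: S.closed hazewinkel_in_BP[OF assms(1)] simp: t_part_const t_part_hazewinkel
        t_part_tt coeff_poly_const coeff_pCons split: nat.splits)
qed

text \<open>Setting t_m to zero as well kills every t_j, which is the counit. This is the source of
  the identity as constant coefficient of the coaction.\<close>

lemma coeff_t_part_0: "coeff (t_part m b) 0 = bp_counit b"
  unfolding t_part_def bp_counit_def bp_subst_eq hom_mpoly_eval[OF coeff_hom_coeff_0]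
  by (rule arg_cong2[where f = "\<lambda>h f. mpoly_eval h f b"]) (auto split: bp_var.split)

text \<open>Only t_0 = 1 and t_m survive, so just the summands \<open>i = n\<close> and
  \<open>i = n - m\<close> of the right unit remain.\<close>

lemma t_part_log_right:
  assumes "m \<ge> 1" "prime p"
  shows "t_part m (log_right p n) =
    [:log_c n:] + (if m \<le> n then monom (log_c (n - m)) (p ^ (n - m)) else 0)"
proof -
  have pos: "p ^ i > 0" for i using prime_gt_0_nat[OF assms(2)] by simp
  have X: "[:0, 1:] ^ k = (monom 1 k :: bp_poly poly)" for k
    by (induction k) (simp_all add: monom_Suc one_pCons monom_0)
  have "t_part m (log_right p n) = (\<Sum>i\<le>n. [:log_c i:] * t_part m (tt (n - i)) ^ (p ^ i))"
    by (simp add: log_right_def t_part.hom_simps t_part_log)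
  \<comment> \<open>For \<open>m > n\<close> the truncated difference \<open>n - m\<close> is 0,
    which is a legitimate index; hence the inner guard \<open>m \<le> n\<close>.\<close>
  also have "\<dots> = (\<Sum>i\<le>n. (if i = n then [:log_c n:] else 0) +
      (if i = n - m then if m \<le> n then monom (log_c (n - m)) (p ^ (n - m)) else 0 else 0))"
  proof (intro sum.cong HOL.refl)
    fix i assume "i \<in> {..n}"
    then consider "i = n" | "i < n" "n - i = m" | "i < n" "n - i \<noteq> m" by force
    then show "[:log_c i:] * t_part m (tt (n - i)) ^ (p ^ i) = (if i = n then [:log_c n:] else 0) +
      (if i = n - m then if m \<le> n then monom (log_c (n - m)) (p ^ (n - m)) else 0 else 0)"
    proof cases
      case 1
      then show ?thesis using assms(1) by (auto simp: t_part_tt)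
    next
      case 2
      then have "i = n - m" "m \<le> n" "i \<noteq> n" by auto
      with 2 show ?thesis using assms(1) by (simp add: t_part_tt X smult_monom)
    next
      case 3
      then have "\<not> (i = n - m \<and> m \<le> n)" by auto
      with 3 show ?thesis using pos[of i] by (auto simp: t_part_tt zero_power)
    qed
  qed
  also have "\<dots> = [:log_c n:] + (if m \<le> n then monom (log_c (n - m)) (p ^ (n - m)) else 0)"
    by (simp add: sum.distrib)
  finally show ?thesis .
qed

lemma coeff_hom_t_part_runit: "coeff_hom (\<lambda>b. t_part m (bp_runit p b))"
  by (rule coeff_hom_compose[OF bp_runit.coeff_hom_axioms t_part.coeff_hom_axioms])

lemma bp_runit_X: "bp_runit p (bp_X v) = (case v of Log n \<Rightarrow> log_right p n | _ \<Rightarrow> bp_X v)"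
  by (simp add: bp_runit_eq mpoly_eval_X[OF coeff_hom_bp_const])

lemma coeff_t_part_runit_in_int_poly:
  assumes "prime p" "m \<ge> 1" "b \<in> int_poly p"
  shows "coeff (t_part m (bp_runit p b)) k \<in> int_poly p"
proof -
  interpret S: local_alg p "int_poly p" using assms(1) by (rule local_alg_int_poly)
  show ?thesis
  proof (rule poly_alg_coeff_closed[OF coeff_hom_t_part_runit assms(3)[unfolded int_poly_def]])
    fix P k assume "P \<in> range bp_X"
    then obtain v where v: "P = bp_X v" by blast
    show "coeff (t_part m (bp_runit p P)) k \<in> int_poly p"
    proof (cases v)
      case (Log n)
      then show ?thesis
        using S.add_in log_in_int_poly[OF assms(1)] S.zero_in
        by (simp add: v bp_runit_X t_part_log_right[OF assms(2,1)] coeff_poly_const)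
    qed (auto simp: v bp_runit_X t_part_X coeff_pCons split: nat.split)
  qed (auto intro!: S.closed simp: t_part_const coeff_poly_const)
qed

text \<open>The right unit preserves weight once t_m is given weight \<open>p ^ m - 1\<close>; each
  power of t_m that is split off lowers the weight of the coefficient accordingly.\<close>

lemma grade_coeff_t_part_runit:
  assumes "prime p" "m \<ge> 1" "bp_homogeneous p e b"
    and "coeff (grade p (coeff (t_part m (bp_runit p b)) k)) j \<noteq> 0"
  shows "j + k * (p ^ m - 1) = e"
proof -
  let ?H = "\<lambda>e F. \<forall>k j. coeff (grade p (coeff F k)) j \<noteq> 0 \<longrightarrow> j + k * (p ^ m - 1) = e"
  have eq: "t_part m (bp_runit p b) = mpoly_eval (\<lambda>c. t_part m (bp_const c))
      (\<lambda>v. t_part m (case v of Log n \<Rightarrow> log_right p n | _ \<Rightarrow> bp_X v)) b"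
    unfolding bp_runit_eq by (rule hom_mpoly_eval[OF t_part.coeff_hom_axioms])
  have H_add: "?H e (A + B)" if "?H e A" "?H e B" for e A B
    using that unfolding coeff_add grade.hom_add by (metis add.right_neutral add.left_neutral)
  have "?H e (t_part m (bp_runit p b))"
    unfolding eq
  proof (rule homogeneous_mpoly_eval[where H = ?H, OF assms(3)])
    show "?H e (A + B)" if "?H e A" "?H e B" for e A B
      using that by (rule H_add)
    show "?H (e + e') (A * B)" if *: "?H e A" "?H e' B" for e e' A B
    proof (intro allI impI)
      fix k j assume "coeff (grade p (coeff (A * B) k)) j \<noteq> 0"
      then have "(\<Sum>a\<le>k. coeff (grade p (coeff A a * coeff B (k - a))) j) \<noteq> 0"
        by (simp add: coeff_mult grade.hom_sum coeff_sum)
      then obtain a where a: "a \<in> {..k}" "coeff (grade p (coeff A a * coeff B (k - a))) j \<noteq> 0"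
        by (rule sum_neq_0_obtains)
      then have "(\<Sum>b\<le>j. coeff (grade p (coeff A a)) b * coeff (grade p (coeff B (k - a))) (j - b)) \<noteq> 0"
        by (simp add: grade.hom_mult coeff_mult)
      then obtain b where b: "b \<in> {..j}"
        "coeff (grade p (coeff A a)) b * coeff (grade p (coeff B (k - a))) (j - b) \<noteq> 0"
        by (rule sum_neq_0_obtains)
      then have "coeff (grade p (coeff A a)) b \<noteq> 0" "coeff (grade p (coeff B (k - a))) (j - b) \<noteq> 0"
        by auto
      then have "b + a * (p ^ m - 1) = e" "(j - b) + (k - a) * (p ^ m - 1) = e'" using * by auto
      moreover have "k * (p ^ m - 1) = a * (p ^ m - 1) + (k - a) * (p ^ m - 1)"
        using a by (simp add: add_mult_distrib[symmetric])
      moreover have "j = b + (j - b)" using b by simp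
      ultimately show "j + k * (p ^ m - 1) = e + e'" by linarith
    qed
    show "?H 0 (t_part m (bp_const c))" for c
      by (auto simp: t_part_const coeff_poly_const grade_const split: if_splits)
    show "?H 0 (1 :: bp_poly poly)"
      by (auto simp: one_pCons coeff_poly_const grade.hom_1 split: if_splits)
    show "?H (var_weight p v) (t_part m (case v of Log n \<Rightarrow> log_right p n | _ \<Rightarrow> bp_X v))" for v
    proof (cases v)
      case (Log n)
      have "?H (p ^ n - 1) [:log_c n:]"
        by (auto simp: coeff_poly_const grade_log split: if_splits)
      moreover have "?H (p ^ n - 1) (if m \<le> n then monom (log_c (n - m)) (p ^ (n - m)) else 0)"
      proof (intro allI impI)
        fix k j
        assume "coeff (grade p (coeff (if m \<le> n then monom (log_c (n - m)) (p ^ (n - m)) else 0) k)) j \<noteq> 0"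
        then have "m \<le> n" "k = p ^ (n - m)" "j = p ^ (n - m) - 1"
          by (auto simp: grade_log split: if_splits)
        then show "j + k * (p ^ m - 1) = p ^ n - 1"
          using prime_power_weight[OF assms(1), of "n - m" n] by simp
      qed
      ultimately have "?H (p ^ n - 1) ([:log_c n:] + (if m \<le> n then monom (log_c (n - m)) (p ^ (n - m)) else 0))"
        by (rule H_add)
      then show ?thesis
        unfolding Log bp_var.case var_weight.simps t_part_log_right[OF assms(2,1)] .
    next
      case (T l)
      show ?thesis
      proof (cases "l = m")
        case True
        show ?thesis
          unfolding T bp_var.case var_weight.simps t_part_X True
          by (auto simp: coeff_pCons grade.hom_1 split: nat.splits if_splits)
      qed (simp add: T t_part_X)
    qed (simp add: t_part_X)
  qed simp
  then show ?thesis using assms(4) by blast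
qed

section \<open>The coefficients of the right unit\<close>

text \<open>In a local ring a unit plus an element of the maximal ideal is a unit.\<close>

lemma localised_int_unit_add:
  assumes "prime p" "a \<in> localised_int p" "b \<in> localised_int p" "a * b = 1" "d \<in> localised_int p"
  shows "\<exists>c\<in>localised_int p. (a + of_nat p * d) * c = 1"
proof -
  have "a + of_nat p * d \<noteq> of_nat p * d'" if "d' \<in> localised_int p" for d'
  proof
    assume "a + of_nat p * d = of_nat p * d'"
    then have "a = of_nat p * (d' - d)" by (simp add: algebra_simps)
    then have "of_nat p * ((d' - d) * b) = 1" using assms(4) by (simp add: mult_ac)
    moreover have "(d' - d) * b \<in> localised_int p"
      using that assms localised_int_add[OF assms(1) that localised_int_uminus[OF assms(1,5)]]
      by (intro localised_int_mult) auto
    ultimately show False using prime_not_unit[OF assms(1)] by blast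
  qed
  moreover have "a + of_nat p * d \<in> localised_int p"
    using assms by (intro localised_int_add localised_int_mult) auto
  ultimately have "inverse (a + of_nat p * d) \<in> localised_int p" "a + of_nat p * d \<noteq> 0"
    using localised_int_unit[OF assms(1)] by blast+
  then show ?thesis by (intro bexI[of _ "inverse (a + of_nat p * d)"]) auto
qed

lemma coeff_lin_part_hazewinkel:
  assumes "prime p" "n \<ge> 1"
  shows "\<exists>d\<in>localised_int p. coeff (lin_part n (hazewinkel p n)) 1 = of_nat p * (1 + of_nat p * d)"
proof -
  obtain z where z: "z \<in> int_poly p" "hazewinkel p n = of_nat p * log_c n + of_nat p ^ 2 * z"
    using hazewinkel_mod_p_squared[OF assms] by blast
  have p: "of_nat p = bp_const (of_nat p)" "of_nat p ^ 2 = bp_const (of_nat p ^ 2)"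
    by (simp_all add: bp_const_of_nat bp_const_power)
  have "coeff (lin_part n (hazewinkel p n)) 1 =
      of_nat p * (1 + of_nat p * coeff (lin_part n z) 1)"
    unfolding z(2) p using assms(2)
    by (simp add: lin_part.hom_add lin_part.hom_mult lin_part_const lin_part_X log_c_def
        power2_eq_square algebra_simps)
  then show ?thesis using coeff_lin_part_in[OF assms(1) z(1)] by blast
qed

text \<open>The weight gives the form; that \<open>a\<close> is a unit comes from generation. If
  \<open>p\<close> divided \<open>a\<close>, the coefficient of \<ell>_n would be a multiple of
  \<open>p^2\<close> in every polynomial in the \<open>w i\<close>. But v_n is such a polynomial,
  and its coefficient is \<open>p\<close> times a unit.\<close>

lemma generator_mod_p_squared:
  assumes "prime p" "bp_generators p w" "n \<ge> 1"
  shows "\<exists>a\<in>localised_int p. \<exists>b\<in>localised_int p. \<exists>z\<in>int_poly p.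
    a * b = 1 \<and> w n = bp_const (of_nat p * a) * log_c n + of_nat p ^ 2 * z"
proof -
  have w: "w i \<in> BP p" "bp_homogeneous p (p ^ i - 1) (w i)" if "i \<ge> 1" for i
    using assms(2) that unfolding bp_generators_def by auto
  have p2: "of_nat p ^ 2 = bp_const (of_nat p ^ 2)"
    by (simp add: bp_const_of_nat bp_const_power)
  have "coeff (grade p (w n)) (p ^ n - 1) = w n"
    using w(2)[OF assms(3)] by (simp add: bp_homogeneous_iff)
  with coeff_grade_mod_p_squared[OF assms(1) w(1)[OF assms(3)] assms(3)]
  obtain a z where az: "a \<in> localised_int p" "z \<in> int_poly p"
    "w n = bp_const (of_nat p * a) * log_c n + of_nat p ^ 2 * z" by auto
  have lin_wn: "coeff (lin_part n (w n)) 1 = of_nat p * a + of_nat p ^ 2 * coeff (lin_part n z) 1"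
    unfolding az(3) p2 using assms(3)
    by (simp add: lin_part.hom_add lin_part.hom_mult lin_part_const lin_part_X log_c_def)
  have "a \<noteq> of_nat p * c" if c: "c \<in> localised_int p" for c
  proof
    assume a: "a = of_nat p * c"
    let ?Q = "{of_nat p ^ 2 * d | d. d \<in> localised_int p}"
    have Q0: "0 \<in> ?Q" using assms(1) by (auto intro: exI[of _ 0])
    have Q_I: "of_nat p ^ 2 * d \<in> ?Q" if "d \<in> localised_int p" for d using that by blast
    have "b \<in> int_poly p \<and> coeff (lin_part n b) 1 \<in> ?Q"
      if "b \<in> poly_alg p {w i | i. i \<ge> 1}" for b
      using that
    proof (induction rule: poly_alg.induct)
      case (const c)
      then show ?case
        using Q0 local_alg.const_in[OF local_alg_int_poly[OF assms(1)]]
        by (simp add: lin_part_const)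
    next
      case (gen P)
      then obtain i where i: "P = w i" "i \<ge> 1" by blast
      have "coeff (lin_part n (w i)) 1 \<in> ?Q"
      proof (cases "i = n")
        case True
        have "coeff (lin_part n (w n)) 1 = of_nat p ^ 2 * (c + coeff (lin_part n z) 1)"
          by (simp only: lin_wn a power2_eq_square distrib_left mult.assoc)
        then show ?thesis
          using Q_I[OF localised_int_add[OF assms(1) c coeff_lin_part_in[OF assms(1) az(2)]]] True
          by (simp only:)
      next
        case False
        \<comment> \<open>A linear term in \<ell>_n would force the weight \<open>p ^ n - 1\<close>,
          which \<open>w i\<close> does not have.\<close>
        then have "coeff (lin_part n (w i)) 1 = 0"
          using lin_part_homogeneous[OF w(2)[OF i(2)], of n 1]
            prime_power_minus_1_eq_iff[OF assms(1), of n i] by (metis mult_1)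
        then show ?thesis using Q0 by metis
      qed
      then show ?case using i w(1) BP_subset_int_poly[OF assms(1)] by simp
    next
      case (add P Q)
      then obtain d d' where "d \<in> localised_int p" "d' \<in> localised_int p"
        "coeff (lin_part n P) 1 = of_nat p ^ 2 * d" "coeff (lin_part n Q) 1 = of_nat p ^ 2 * d'" by blast
      then have "coeff (lin_part n (P + Q)) 1 \<in> ?Q"
        using Q_I[of "d + d'"] localised_int_add[OF assms(1)]
        by (simp add: lin_part.hom_add distrib_left)
      then show ?case using add.IH local_alg.add_in[OF local_alg_int_poly[OF assms(1)]] by blast
    next
      case (mult P Q)
      then obtain d d' where d: "d \<in> localised_int p" "d' \<in> localised_int p"
        "coeff (lin_part n P) 1 = of_nat p ^ 2 * d" "coeff (lin_part n Q) 1 = of_nat p ^ 2 * d'" by blast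
      let ?x = "coeff (lin_part n P) 0" and ?y = "coeff (lin_part n Q) 0"
      have xy: "?x \<in> localised_int p" "?y \<in> localised_int p"
        using coeff_lin_part_in[OF assms(1)] mult.IH by blast+
      have "coeff (lin_part n (P * Q)) 1 = of_nat p ^ 2 * (?x * d' + d * ?y)"
        using d by (simp add: lin_part.hom_mult coeff_mult algebra_simps)
      moreover have "?x * d' + d * ?y \<in> localised_int p"
        using d xy by (intro localised_int_add localised_int_mult assms)
      ultimately have "coeff (lin_part n (P * Q)) 1 \<in> ?Q" by blast
      then show ?case using mult.IH local_alg.mult_in[OF local_alg_int_poly[OF assms(1)]] by blast
    qed
    moreover have "hazewinkel p n \<in> poly_alg p {w i | i. i \<ge> 1}"
      using hazewinkel_in_BP[OF assms(1)] assms(2) unfolding bp_generators_def by auto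
    ultimately obtain d where d: "d \<in> localised_int p"
      "coeff (lin_part n (hazewinkel p n)) 1 = of_nat p ^ 2 * d" by blast
    obtain d' where d': "d' \<in> localised_int p"
      "coeff (lin_part n (hazewinkel p n)) 1 = of_nat p * (1 + of_nat p * d')"
      using coeff_lin_part_hazewinkel[OF assms(1,3)] by blast
    have "(of_nat p :: rat) * 1 = of_nat p * (of_nat p * (d - d'))"
      using d d' by (simp add: power2_eq_square algebra_simps)
    then have "of_nat p * (d - d') = 1"
      using prime_gt_0_nat[OF assms(1)] by (simp only: mult_cancel_left) simp
    moreover have "d - d' \<in> localised_int p"
      using localised_int_add[OF assms(1) d(1) localised_int_uminus[OF assms(1) d'(1)]] by simp
    ultimately show False using prime_not_unit[OF assms(1)] by blast
  qed
  then have "inverse a \<in> localised_int p" "a * inverse a = 1"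
    using localised_int_unit[OF assms(1) az(1)] by auto
  then show ?thesis using az by blast
qed

text \<open>The coefficient of \<open>\<ell>\<^sub>i\<close> detects the multiple of \<open>v\<^sub>i\<close>: in the coefficient of \<open>t\<^bsub>n-i\<^esub>\<close> to the
  power \<open>p\<^sup>i\<close> of \<open>\<eta>\<^sub>R(w\<^sub>n)\<close> it is \<open>p\<close> times a unit.\<close>

lemma hazewinkel_in_coefficient_ideal:
  assumes p: "prime p" and w: "bp_generators p w" and n: "n \<ge> 1"
    and K: "0 \<in> K" "\<And>x y. x \<in> K \<Longrightarrow> y \<in> K \<Longrightarrow> x + y \<in> K"
      "\<And>x y. x \<in> BP p \<Longrightarrow> y \<in> K \<Longrightarrow> x * y \<in> K" "K \<subseteq> BP p"
    and coeffs: "\<And>m k. m \<ge> 1 \<Longrightarrow> coeff (t_part m (bp_runit p (w n))) k \<in> K"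
  shows "i < n \<Longrightarrow> hazewinkel p i \<in> K"
proof (induction i rule: less_induct)
  case (less i)
  interpret BP: local_alg p "BP p" using p by (rule local_alg_BP)
  obtain a b z where az: "a \<in> localised_int p" "b \<in> localised_int p" "z \<in> int_poly p" "a * b = 1"
    "w n = bp_const (of_nat p * a) * log_c n + of_nat p ^ 2 * z"
    using generator_mod_p_squared[OF p w n] by blast
  have wn: "w n \<in> BP p" "bp_homogeneous p (p ^ n - 1) (w n)"
    using w n unfolding bp_generators_def by auto
  \<comment> \<open>With this \<open>m\<close>, the part of the right unit of \<ell>_n involving t_m
    is \<ell>_i times the power \<open>p ^ i\<close> of t_m, so \<open>c\<close> below is a unit
    times \<open>p * log_c i\<close> modulo \<open>p^2\<close>.\<close>
  define m where "m = n - i"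
  have m: "m \<ge> 1" "n - m = i" "m \<le> n" using less.prems by (auto simp: m_def)
  have pos: "p ^ j > 0" for j using prime_gt_0_nat[OF p] by simp
  define c where "c = coeff (t_part m (bp_runit p (w n))) (p ^ i)"
  have c_K: "c \<in> K" unfolding c_def by (rule coeffs[OF m(1)])
  then have c_BP: "c \<in> BP p" using K by blast
  have c_hom: "grade p c = monom c (p ^ i - 1)"
  proof -
    have ne: "coeff (grade p c) j = 0" if "j \<noteq> p ^ i - 1" for j
    proof (rule ccontr)
      assume "coeff (grade p c) j \<noteq> 0"
      then have "j + p ^ i * (p ^ m - 1) = p ^ n - 1"
        unfolding c_def by (rule grade_coeff_t_part_runit[OF p m(1) wn(2)])
      moreover have "p ^ i - 1 + p ^ i * (p ^ m - 1) = p ^ n - 1"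
        using prime_power_weight[OF p, of i n] less.prems by (simp add: m_def)
      ultimately show False using that by simp
    qed
    have "bp_homogeneous p (p ^ i - 1) c"
      unfolding bp_homogeneous_def
    proof
      fix mm assume "mm \<in> Poly_Mapping.keys c"
      then have "Poly_Mapping.lookup (coeff (grade p c) (mon_weight p mm)) mm \<noteq> 0"
        by (simp add: lookup_coeff_grade in_keys_iff)
      then have "mon_weight p mm = p ^ i - 1" using ne by force
      then show "(\<Sum>v\<in>Poly_Mapping.keys mm. Poly_Mapping.lookup mm v * var_weight p v) = p ^ i - 1"
        by (simp add: mon_weight_def)
    qed
    then show ?thesis by (simp add: bp_homogeneous_iff)
  qed
  have "\<exists>y\<in>int_poly p. c = bp_const (of_nat p * a) * log_c i + bp_const (of_nat p ^ 2) * y"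
  proof -
    interpret D: coeff_hom "\<lambda>b. t_part m (bp_runit p b)" by (rule coeff_hom_t_part_runit)
    have p2: "of_nat p ^ 2 = bp_const (of_nat p ^ 2)"
      by (simp add: bp_const_of_nat bp_const_power)
    have "c = bp_const (of_nat p * a) * log_c i +
        bp_const (of_nat p ^ 2) * coeff (t_part m (bp_runit p z)) (p ^ i)"
      unfolding c_def az(5) p2 D.hom_add D.hom_mult
      using pos[of i] m by (simp add: t_part_const bp_runit_log t_part_log_right[OF m(1) p] coeff_poly_const)
    then show ?thesis using coeff_t_part_runit_in_int_poly[OF p m(1) az(3)] by blast
  qed
  then obtain y where y: "y \<in> int_poly p"
    "c = bp_const (of_nat p * a) * log_c i + bp_const (of_nat p ^ 2) * y" by blast
  show ?case
  proof (cases "i = 0")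
    case True
    obtain c' where c': "c' \<in> localised_int p" "c = bp_const c'"
      using coeff_grade_0[OF p c_BP] c_hom True by auto
    \<comment> \<open>The coefficient in degree 0 is the constant term whichever \<ell> is kept; the
      index 1 is an arbitrary choice.\<close>
    let ?d = "coeff (lin_part 1 y) 0"
    have d: "?d \<in> localised_int p" by (rule coeff_lin_part_in[OF p y(1)])
    have "lin_part 1 (bp_const c') = lin_part 1 (bp_const (of_nat p * a) + bp_const (of_nat p ^ 2) * y)"
      using c'(2) y(2) True by (simp add: log_c_def)
    then have "coeff (lin_part 1 (bp_const c')) 0 = of_nat p * a + of_nat p ^ 2 * ?d"
      by (simp add: lin_part.hom_add lin_part.hom_mult lin_part_const)
    then have c'_eq: "c' = of_nat p * (a + of_nat p * ?d)"
      by (simp add: lin_part_const power2_eq_square algebra_simps)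
    obtain e where e: "e \<in> localised_int p" "(a + of_nat p * ?d) * e = 1"
      using localised_int_unit_add[OF p az(1,2,4) d] by blast
    have "e * c' = of_nat p" unfolding c'_eq using e(2) by (simp add: mult_ac)
    then have "bp_const e * c = hazewinkel p i"
      unfolding c'(2) bp_const.hom_mult[symmetric] by (simp add: True bp_const_of_nat)
    then show ?thesis using K(3)[OF BP.const_in[OF e(1)] c_K] by simp
  next
    case False
    then have i: "i \<ge> 1" by simp
    \<comment> \<open>Modulo all of \<open>K\<close> nothing could be concluded about the multiple
      \<open>f\<close> of v_i, since a remainder in \<open>K\<close> might itself contain v_i. In
      the subideal \<open>I\<close> the coefficient of \<ell>_i is a multiple of \<open>p^2\<close>.
      The condition on the constant term makes \<open>I\<close> stable under BP_*: the coefficient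
      of \<ell>_i in an element of BP_* is divisible by \<open>p\<close>, so the mixed product is
      divisible by \<open>p^2\<close>.\<close>
    define I where "I = {x \<in> K. \<exists>d0\<in>localised_int p. \<exists>d1\<in>localised_int p.
      coeff (lin_part i x) 0 = of_nat p * d0 \<and> coeff (lin_part i x) 1 = of_nat p ^ 2 * d1}"
    have lin_BP: "\<exists>d\<in>localised_int p. coeff (lin_part i x) 1 = of_nat p * d" if "x \<in> BP p" for x
    proof -
      have "x \<in> BP p \<and> (\<exists>d\<in>localised_int p. coeff (lin_part i x) 1 = of_nat p * d)"
        using that[unfolded BP_def]
      proof (induction rule: poly_alg.induct)
        case (const c)
        then show ?case using BP.const_in p by (auto simp: lin_part_const intro!: bexI[of _ 0])
      next
        case (gen P)
        then obtain k where k: "P = hazewinkel p k" by blast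
        obtain z where z: "z \<in> int_poly p" "hazewinkel p k = of_nat p * z"
          using hazewinkel_dvd_p[OF p] by blast
        have "coeff (lin_part i P) 1 = of_nat p * coeff (lin_part i z) 1"
          unfolding k z(2) bp_const_of_nat[symmetric] by (simp add: lin_part.hom_mult lin_part_const)
        then show ?case using coeff_lin_part_in[OF p z(1)] hazewinkel_in_BP[OF p] k by blast
      next
        case (add P Q)
        then obtain d d' where "d \<in> localised_int p" "d' \<in> localised_int p"
          "coeff (lin_part i P) 1 = of_nat p * d" "coeff (lin_part i Q) 1 = of_nat p * d'" by blast
        then have "coeff (lin_part i (P + Q)) 1 = of_nat p * (d + d')" "d + d' \<in> localised_int p"
          using localised_int_add[OF p] by (simp_all add: lin_part.hom_add distrib_left)
        then show ?case using add.IH BP.add_in by blast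
      next
        case (mult P Q)
        then obtain d d' where d: "d \<in> localised_int p" "d' \<in> localised_int p"
          "coeff (lin_part i P) 1 = of_nat p * d" "coeff (lin_part i Q) 1 = of_nat p * d'" by blast
        let ?x = "coeff (lin_part i P) 0" and ?y = "coeff (lin_part i Q) 0"
        have xy: "?x \<in> localised_int p" "?y \<in> localised_int p"
          using coeff_lin_part_in[OF p] BP_subset_int_poly[OF p] mult.IH by blast+
        have "coeff (lin_part i (P * Q)) 1 = of_nat p * (?x * d' + d * ?y)"
          using d by (simp add: lin_part.hom_mult coeff_mult algebra_simps)
        moreover have "?x * d' + d * ?y \<in> localised_int p"
          using d xy by (intro localised_int_add localised_int_mult p)
        ultimately show ?case using mult.IH BP.mult_in by blast
      qed
      then show ?thesis by blast
    qed
    have I_0: "0 \<in> I" unfolding I_def using K(1) p by (auto intro!: bexI[of _ 0])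
    have I_add: "x + y \<in> I" if "x \<in> I" "y \<in> I" for x y
    proof -
      from that obtain d0 d1 e0 e1 where *: "d0 \<in> localised_int p" "d1 \<in> localised_int p"
        "e0 \<in> localised_int p" "e1 \<in> localised_int p" "x \<in> K" "y \<in> K"
        "coeff (lin_part i x) 0 = of_nat p * d0" "coeff (lin_part i x) 1 = of_nat p ^ 2 * d1"
        "coeff (lin_part i y) 0 = of_nat p * e0" "coeff (lin_part i y) 1 = of_nat p ^ 2 * e1"
        unfolding I_def by blast
      have "coeff (lin_part i (x + y)) 0 = of_nat p * (d0 + e0)"
        "coeff (lin_part i (x + y)) 1 = of_nat p ^ 2 * (d1 + e1)"
        using * by (simp_all add: lin_part.hom_add distrib_left)
      then show ?thesis unfolding I_def using K(2) * localised_int_add[OF p] by blast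
    qed
    have I_mult: "x * y \<in> I" if x_BP: "x \<in> BP p" and "y \<in> I" for x y
    proof -
      from that obtain e0 e1 where *: "e0 \<in> localised_int p" "e1 \<in> localised_int p" "y \<in> K"
        "coeff (lin_part i y) 0 = of_nat p * e0" "coeff (lin_part i y) 1 = of_nat p ^ 2 * e1"
        unfolding I_def by blast
      obtain d where d: "d \<in> localised_int p" "coeff (lin_part i x) 1 = of_nat p * d"
        using lin_BP[OF x_BP] by blast
      let ?x = "coeff (lin_part i x) 0"
      have x: "?x \<in> localised_int p"
        using coeff_lin_part_in[OF p] BP_subset_int_poly[OF p x_BP] by blast
      have "coeff (lin_part i (x * y)) 0 = of_nat p * (?x * e0)"
        "coeff (lin_part i (x * y)) 1 = of_nat p ^ 2 * (?x * e1 + d * e0)"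
        using * d by (simp_all add: lin_part.hom_mult coeff_mult power2_eq_square algebra_simps)
      moreover have "?x * e0 \<in> localised_int p" "?x * e1 + d * e0 \<in> localised_int p"
        using * d x by (auto intro!: localised_int_add localised_int_mult p)
      ultimately show ?thesis unfolding I_def using K(3)[OF x_BP *(3)] by blast
    qed
    have I_v: "hazewinkel p j \<in> I" if j: "1 \<le> j" "j < i" for j
    proof -
      have hom: "bp_homogeneous p (p ^ j - 1) (hazewinkel p j)"
        by (simp add: bp_homogeneous_iff grade_hazewinkel[OF p])
      have "coeff (lin_part i (hazewinkel p j)) 0 = 0"
        using lin_part_homogeneous[OF hom, of i 0] prime_power_minus_1_pos[OF p j(1)]
        by (metis less_not_refl mult_0)
      moreover have "coeff (lin_part i (hazewinkel p j)) 1 = 0"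
        using lin_part_homogeneous[OF hom, of i 1] prime_power_minus_1_eq_iff[OF p, of i j] j
        by (metis less_not_refl mult_1)
      moreover have "hazewinkel p j \<in> K" using less.IH j less.prems by simp
      ultimately show ?thesis unfolding I_def using p by (auto intro!: bexI[of _ 0])
    qed
    have "I \<subseteq> BP p" using K(4) unfolding I_def by blast
    from coeff_grade_mod_ideal[OF p c_BP i I_0 I_add I_mult this I_v] obtain f x where
      fx: "f \<in> localised_int p" "x \<in> I" "c = bp_const f * hazewinkel p i + x"
      using c_hom by auto
    obtain d1 where d1: "x \<in> K" "d1 \<in> localised_int p" "coeff (lin_part i x) 1 = of_nat p ^ 2 * d1"
      using fx(2) unfolding I_def by blast
    obtain g where g: "g \<in> localised_int p"
      "coeff (lin_part i (hazewinkel p i)) 1 = of_nat p * (1 + of_nat p * g)"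
      using coeff_lin_part_hazewinkel[OF p i] by blast
    let ?d = "coeff (lin_part i y) 1"
    have d: "?d \<in> localised_int p" by (rule coeff_lin_part_in[OF p y(1)])
    \<comment> \<open>Two expressions for the coefficient of \<ell>_i in \<open>c\<close>. Modulo
      \<open>p^2\<close> they are \<open>p * a\<close> and \<open>p * f\<close>, so \<open>f\<close>
      is congruent to the unit \<open>a\<close> modulo \<open>p\<close>.\<close>
    have "of_nat p * a + of_nat p ^ 2 * ?d = coeff (lin_part i c) 1"
      unfolding y(2) using i
      by (simp add: lin_part.hom_add lin_part.hom_mult lin_part_const lin_part_X log_c_def)
    also have "\<dots> = f * (of_nat p * (1 + of_nat p * g)) + of_nat p ^ 2 * d1"
      unfolding fx(3) using g d1
      by (simp add: lin_part.hom_add lin_part.hom_mult lin_part_const)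
    finally have "of_nat p * f = of_nat p * (a + of_nat p * (?d - f * g - d1))"
      by (simp add: power2_eq_square algebra_simps)
    then have f_eq: "f = a + of_nat p * (?d - f * g - d1)"
      using prime_gt_0_nat[OF p] by (simp only: mult_cancel_left) simp
    have "?d - f * g - d1 = ?d + - (f * g) + - d1" by simp
    also have "\<dots> \<in> localised_int p"
      by (intro localised_int_add localised_int_uminus localised_int_mult p d fx g d1)
    finally obtain e where e: "e \<in> localised_int p" "f * e = 1"
      using localised_int_unit_add[OF p az(1,2,4)] f_eq by metis
    have "bp_const e * (c + (-1) * x) = bp_const (f * e) * hazewinkel p i"
      unfolding fx(3) by (simp add: bp_const.hom_mult algebra_simps)
    then have "hazewinkel p i = bp_const e * (c + (-1) * x)" by (simp add: e(2))
    also have "\<dots> \<in> K"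
      using BP.uminus_in[OF BP.one_in] by (intro K(2,3) BP.const_in e c_K d1) auto
    finally show ?thesis .
  qed
qed

text \<open>By weight, \<open>w (n - 1)\<close> is a multiple of v_{n-1} modulo an ideal containing
  the earlier v_j, and \<open>K\<close> contains all of these. For \<open>n = 1\<close> both
  \<open>w 0\<close> and v_0 are \<open>p\<close>.\<close>

lemma generator_in_coefficient_ideal:
  assumes p: "prime p" and w: "bp_generators p w" and n: "n \<ge> 1"
    and K: "0 \<in> K" "\<And>x y. x \<in> K \<Longrightarrow> y \<in> K \<Longrightarrow> x + y \<in> K"
      "\<And>x y. x \<in> BP p \<Longrightarrow> y \<in> K \<Longrightarrow> x * y \<in> K" "K \<subseteq> BP p"
    and coeffs: "\<And>m k. m \<ge> 1 \<Longrightarrow> coeff (t_part m (bp_runit p (w n))) k \<in> K"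
  shows "w (n - 1) \<in> K"
proof -
  have v: "hazewinkel p i \<in> K" if "i < n" for i
    by (rule hazewinkel_in_coefficient_ideal[OF p w n K coeffs that])
  show ?thesis
  proof (cases "n - 1 = 0")
    case True
    then show ?thesis using v[of 0] n w by (simp add: bp_generators_def)
  next
    case False
    let ?i = "n - 1"
    interpret BP: local_alg p "BP p" using p by (rule local_alg_BP)
    have i: "?i \<ge> 1" using False by simp
    have wi: "w ?i \<in> BP p" "bp_homogeneous p (p ^ ?i - 1) (w ?i)"
      using w i unfolding bp_generators_def by auto
    have "\<exists>a\<in>localised_int p. \<exists>y\<in>K. coeff (grade p (w ?i)) (p ^ ?i - 1) = bp_const a * hazewinkel p ?i + y"
      by (rule coeff_grade_mod_ideal[OF p wi(1) i K]) (use v in auto)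
    then obtain a y where "a \<in> localised_int p" "y \<in> K" "w ?i = bp_const a * hazewinkel p ?i + y"
      using wi(2) by (auto simp: bp_homogeneous_iff)
    then show ?thesis using K v[of ?i] BP.const_in n by simp
  qed
qed

section \<open>Nilpotent coefficients\<close>

text \<open>Every binomial term contains \<open>x ^ i\<close> or \<open>y ^ j\<close>. Here
  \<open>J\<close> plays the role of an ideal in \<open>P\<close>; the lemma serves both for scalars
  that annihilate a module element and for polynomials that annihilate a polynomial.\<close>

lemma binomial_closed:
  fixes x y :: "'a::comm_ring_1"
  assumes J: "0 \<in> J" "\<And>a b. a \<in> J \<Longrightarrow> b \<in> J \<Longrightarrow> a + b \<in> J"
    "\<And>a b. a \<in> P \<Longrightarrow> b \<in> J \<Longrightarrow> a * b \<in> J"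
    and P: "\<And>a b. a \<in> P \<Longrightarrow> b \<in> P \<Longrightarrow> a * b \<in> P" "\<And>k. of_nat k \<in> P"
    and "x \<in> P" "y \<in> P" "x ^ i \<in> J" "y ^ j \<in> J"
  shows "(x + y) ^ (i + j) \<in> J"
proof -
  have pow: "z ^ k \<in> P" if "z \<in> P" for z k
    using that P(1) P(2)[of 1] by (induction k) auto
  have sum: "(\<And>k. k \<in> I \<Longrightarrow> f k \<in> J) \<Longrightarrow> (\<Sum>k\<in>I. f k) \<in> J" for I :: "nat set" and f
    by (induction I rule: infinite_finite_induct) (simp_all add: J)
  have "of_nat ((i + j) choose k) * x ^ k * y ^ (i + j - k) \<in> J" if "k \<in> {..i + j}" for k
  proof (cases "i \<le> k")
    case True
    then have "x ^ k = x ^ (k - i) * x ^ i" by (simp add: power_add[symmetric])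
    then have "of_nat ((i + j) choose k) * x ^ k * y ^ (i + j - k) =
        (of_nat ((i + j) choose k) * x ^ (k - i) * y ^ (i + j - k)) * x ^ i"
      by (simp add: mult_ac)
    then show ?thesis using J(3) P pow assms by simp
  next
    case False
    then have "y ^ (i + j - k) = y ^ (i - k) * y ^ j" by (simp add: power_add[symmetric])
    then have "of_nat ((i + j) choose k) * x ^ k * y ^ (i + j - k) =
        (of_nat ((i + j) choose k) * x ^ k * y ^ (i - k)) * y ^ j"
      by (simp add: mult_ac)
    then show ?thesis using J(3) P pow assms by simp
  qed
  then show ?thesis unfolding binomial_ring by (rule sum)
qed

text \<open>Formulated with bounds on the degrees because the coefficient at the bound may
  vanish.\<close>

lemma coeff_mult_bound:
  assumes "degree F \<le> d" "degree (G :: 'a::comm_semiring_0 poly) \<le> e"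
  shows "coeff (F * G) (d + e) = coeff F d * coeff G e"
proof (cases "degree F = d \<and> degree G = e")
  case True
  then show ?thesis using coeff_mult_degree_sum[of F G] by auto
next
  case False
  then have "degree F < d \<or> degree G < e" using assms by auto
  moreover from this have "degree (F * G) < d + e"
    using degree_mult_le[of F G] assms by auto
  ultimately show ?thesis by (auto simp: coeff_eq_0)
qed

lemma coeff_power_bound:
  assumes "degree (F :: 'a::comm_semiring_1 poly) \<le> d"
  shows "degree (F ^ N) \<le> N * d \<and> coeff (F ^ N) (N * d) = coeff F d ^ N"
proof (induction N)
  case (Suc N)
  have "degree (F ^ Suc N) \<le> d + N * d"
    using degree_mult_le[of F "F ^ N"] Suc assms by simp
  then show ?case using coeff_mult_bound[OF assms Suc[THEN conjunct1]] Suc by simp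
qed simp

text \<open>The base of the comodule is not commutative, but two elements of \<open>S\<close> act in
  commuting fashion, because both orders give the action of their product. The leading coefficient
  argument relies on this interchange.\<close>

locale ring_action = abelian_group M for M (structure) +
  fixes S :: "'r::comm_ring_1 set" and act :: "'r \<Rightarrow> 'a \<Rightarrow> 'a"
  assumes S_0: "0 \<in> S" and S_1: "1 \<in> S"
    and S_add: "a \<in> S \<Longrightarrow> b \<in> S \<Longrightarrow> a + b \<in> S"
    and S_mult: "a \<in> S \<Longrightarrow> b \<in> S \<Longrightarrow> a * b \<in> S"
    and S_uminus: "a \<in> S \<Longrightarrow> - a \<in> S"
    and act_closed: "a \<in> S \<Longrightarrow> x \<in> carrier M \<Longrightarrow> act a x \<in> carrier M"
    and act_add_left: "a \<in> S \<Longrightarrow> b \<in> S \<Longrightarrow> x \<in> carrier M \<Longrightarrow> act (a + b) x = act a x \<oplus> act b x"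
    and act_add_right: "a \<in> S \<Longrightarrow> x \<in> carrier M \<Longrightarrow> y \<in> carrier M \<Longrightarrow>
      act a (x \<oplus> y) = act a x \<oplus> act a y"
    and act_mult: "a \<in> S \<Longrightarrow> b \<in> S \<Longrightarrow> x \<in> carrier M \<Longrightarrow> act (a * b) x = act a (act b x)"
begin

lemma S_power: "a \<in> S \<Longrightarrow> a ^ k \<in> S"
  by (induction k) (simp_all add: S_1 S_mult)

lemma S_of_nat: "of_nat k \<in> S"
  by (induction k) (simp_all add: S_0 S_1 S_add)

lemma act_0_left: "x \<in> carrier M \<Longrightarrow> act 0 x = \<zero>"
  using act_add_left[of 0 0 x] act_closed[of 0 x] S_0 by (simp add: add.l_cancel_one')

lemma act_0_right: "a \<in> S \<Longrightarrow> act a \<zero> = \<zero>"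
  using act_add_right[of a \<zero> \<zero>] act_closed[of a \<zero>] by (simp add: add.l_cancel_one')

lemma act_finsum:
  assumes "a \<in> S" "finite I" "f \<in> I \<rightarrow> carrier M"
  shows "act a (\<Oplus>i\<in>I. f i) = (\<Oplus>i\<in>I. act a (f i))"
  using assms(2,3)
proof (induction I rule: finite_induct)
  case empty
  then show ?case by (simp add: act_0_right assms(1))
next
  case (insert i I)
  then have "f i \<in> carrier M" "f \<in> I \<rightarrow> carrier M" by auto
  moreover from this have "(\<lambda>i. act a (f i)) \<in> I \<rightarrow> carrier M" "act a (f i) \<in> carrier M"
    using act_closed[OF assms(1)] by auto
  ultimately show ?case using insert by (simp add: act_add_right assms(1))
qed

text \<open>The radical of the annihilator of \<open>x\<close> in \<open>S\<close>; the bound on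
  \<open>j\<close> matches that of torsion elements.\<close>

definition nil_ideal :: "'a \<Rightarrow> 'r set"
  where "nil_ideal x = {b \<in> S. \<exists>j\<ge>1. act (b ^ j) x = \<zero>}"

lemma nil_ideal_0: "x \<in> carrier M \<Longrightarrow> 0 \<in> nil_ideal x"
  unfolding nil_ideal_def by (auto simp: S_0 act_0_left intro!: exI[of _ 1])

lemma nil_ideal_mult:
  assumes "x \<in> carrier M" "a \<in> S" "b \<in> nil_ideal x" shows "a * b \<in> nil_ideal x"
proof -
  obtain j where j: "j \<ge> 1" "b \<in> S" "act (b ^ j) x = \<zero>"
    using assms unfolding nil_ideal_def by blast
  have "act ((a * b) ^ j) x = \<zero>"
    using j assms by (simp add: power_mult_distrib act_mult S_power act_0_right)
  then show ?thesis using j assms(2) S_mult unfolding nil_ideal_def by blast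
qed

lemma nil_ideal_add:
  assumes "x \<in> carrier M" "a \<in> nil_ideal x" "b \<in> nil_ideal x" shows "a + b \<in> nil_ideal x"
proof -
  obtain i where i: "i \<ge> 1" "a \<in> S" "act (a ^ i) x = \<zero>"
    using assms unfolding nil_ideal_def by blast
  obtain j where j: "j \<ge> 1" "b \<in> S" "act (b ^ j) x = \<zero>"
    using assms unfolding nil_ideal_def by blast
  have "(a + b) ^ (i + j) \<in> {c \<in> S. act c x = \<zero>}"
    by (rule binomial_closed[where P = S])
      (use i j assms(1) in \<open>auto simp: S_0 S_add S_mult S_of_nat S_power act_0_left act_add_left
        act_mult act_0_right\<close>)
  then show ?thesis using i j S_add unfolding nil_ideal_def
    by (auto intro!: exI[of _ "i + j"])
qed

section \<open>Polynomials annihilating a polynomial with coefficients in the module\<close>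

definition S_poly :: "'r poly set"
  where "S_poly = {F. \<forall>k. coeff F k \<in> S}"

text \<open>\<open>h\<close> is read as a power series in one variable with coefficients in the
  module, and the sums are the coefficients of \<open>F\<close> times \<open>h\<close>.\<close>

definition ann_poly :: "(nat \<Rightarrow> 'a) \<Rightarrow> 'r poly set"
  where "ann_poly h = {F \<in> S_poly. \<forall>k. (\<Oplus>l\<in>{..k}. act (coeff F l) (h (k - l))) = \<zero>}"

lemma S_poly_mult: "F \<in> S_poly \<Longrightarrow> G \<in> S_poly \<Longrightarrow> F * G \<in> S_poly"
  unfolding S_poly_def using coeff_mult_semiring_closed[of S] S_0 S_add S_mult by blast

lemma S_poly_of_nat: "of_nat k \<in> S_poly"
  unfolding S_poly_def by (simp add: of_nat_poly coeff_pCons S_0 S_of_nat split: nat.split)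

lemma S_poly_power: "F \<in> S_poly \<Longrightarrow> F ^ k \<in> S_poly"
  using S_poly_of_nat[of 1] by (induction k) (simp_all add: S_poly_mult)

context
  fixes h :: "nat \<Rightarrow> 'a"
  assumes h: "\<And>k. h k \<in> carrier M"
begin

lemma act_h_closed: "F \<in> S_poly \<Longrightarrow> act (coeff F l) (h r) \<in> carrier M"
  by (auto simp: S_poly_def intro: act_closed h)

lemma ann_poly_0: "0 \<in> ann_poly h"
  unfolding ann_poly_def S_poly_def by (simp add: S_0 act_0_left h)

lemma ann_poly_add: "F \<in> ann_poly h \<Longrightarrow> G \<in> ann_poly h \<Longrightarrow> F + G \<in> ann_poly h"
proof -
  assume FG: "F \<in> ann_poly h" "G \<in> ann_poly h"
  then have S: "F \<in> S_poly" "G \<in> S_poly" by (auto simp: ann_poly_def)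
  have "(\<Oplus>l\<in>{..k}. act (coeff (F + G) l) (h (k - l))) = \<zero>" for k
  proof -
    have "(\<Oplus>l\<in>{..k}. act (coeff (F + G) l) (h (k - l))) =
      (\<Oplus>l\<in>{..k}. act (coeff F l) (h (k - l)) \<oplus> act (coeff G l) (h (k - l)))"
      using S by (simp add: S_poly_def act_add_left h)
    also have "\<dots> = (\<Oplus>l\<in>{..k}. act (coeff F l) (h (k - l))) \<oplus> (\<Oplus>l\<in>{..k}. act (coeff G l) (h (k - l)))"
      by (rule finsum_addf) (auto intro: act_h_closed S)
    finally show ?thesis using FG by (simp add: ann_poly_def)
  qed
  then show ?thesis using S by (auto simp: ann_poly_def S_poly_def S_add)
qed

lemma ann_poly_smult: "a \<in> S \<Longrightarrow> F \<in> ann_poly h \<Longrightarrow> smult a F \<in> ann_poly h"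
proof -
  assume a: "a \<in> S" and F: "F \<in> ann_poly h"
  then have S: "F \<in> S_poly" by (auto simp: ann_poly_def)
  have "(\<Oplus>l\<in>{..k}. act (coeff (smult a F) l) (h (k - l))) = \<zero>" for k
  proof -
    have "(\<Oplus>l\<in>{..k}. act (coeff (smult a F) l) (h (k - l))) =
      (\<Oplus>l\<in>{..k}. act a (act (coeff F l) (h (k - l))))"
      using S a by (simp add: S_poly_def act_mult h)
    also have "\<dots> = act a (\<Oplus>l\<in>{..k}. act (coeff F l) (h (k - l)))"
      by (rule act_finsum[symmetric]) (auto intro: act_h_closed S a)
    finally show ?thesis using F a by (simp add: ann_poly_def act_0_right)
  qed
  then show ?thesis using S a by (auto simp: ann_poly_def S_poly_def S_mult)
qed

lemma ann_poly_shift: "F \<in> ann_poly h \<Longrightarrow> pCons 0 F \<in> ann_poly h"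
proof -
  assume F: "F \<in> ann_poly h"
  then have S: "F \<in> S_poly" by (auto simp: ann_poly_def)
  then have S': "pCons 0 F \<in> S_poly" by (auto simp: S_poly_def coeff_pCons S_0 split: nat.split)
  have "(\<Oplus>l\<in>{..k}. act (coeff (pCons 0 F) l) (h (k - l))) = \<zero>" for k
  proof (cases k)
    case 0
    then show ?thesis by (simp add: act_0_left h)
  next
    case (Suc k')
    have "(\<Oplus>l\<in>{..Suc k'}. act (coeff (pCons 0 F) l) (h (Suc k' - l))) =
      (\<Oplus>l\<in>{..k'}. act (coeff (pCons 0 F) (Suc l)) (h (Suc k' - Suc l))) \<oplus>
      act (coeff (pCons 0 F) 0) (h (Suc k' - 0))"
      by (rule finsum_Suc2) (auto intro: act_h_closed S')
    then show ?thesis using F h by (simp add: Suc ann_poly_def act_0_left)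
  qed
  then show ?thesis using S' by (auto simp: ann_poly_def)
qed

lemma ann_poly_mult:
  assumes "G \<in> S_poly" "F \<in> ann_poly h" shows "G * F \<in> ann_poly h"
  using assms(1)
proof (induction G)
  case 0
  then show ?case by (simp add: ann_poly_0)
next
  case (pCons a G)
  then have "a \<in> S" "G \<in> S_poly"
    unfolding S_poly_def by (auto simp: coeff_pCons split: nat.splits dest: spec[of _ 0] spec[of _ "Suc _"])
  then show ?case
    using pCons.IH ann_poly_add ann_poly_smult ann_poly_shift assms(2) by simp
qed

text \<open>Descending induction on \<open>r\<close>, arranged as induction on \<open>j\<close>. In
  degree \<open>D + r\<close> of \<open>G\<close> times \<open>h\<close>, terms with
  \<open>l > D\<close> vanish by the degree bound, and terms with \<open>l < D\<close> involve
  \<open>h\<close> at an index above \<open>r\<close>, which \<open>coeff G D ^ j\<close> already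
  kills. Only the leading coefficient acting on \<open>h r\<close> is left.\<close>

lemma leading_coeff_nilpotent:
  assumes G: "G \<in> ann_poly h" "degree G \<le> D" and E: "\<And>k. k > E \<Longrightarrow> h k = \<zero>"
  shows "r + j > E \<Longrightarrow> act (coeff G D ^ j) (h r) = \<zero>"
proof (induction j arbitrary: r)
  case 0
  then show ?case using E by (simp add: act_0_right S_1)
next
  case (Suc j)
  have S: "G \<in> S_poly" using G by (auto simp: ann_poly_def)
  define b where "b = coeff G D"
  have b: "b \<in> S" using S by (simp add: b_def S_poly_def)
  have bj: "b ^ j \<in> S" using b by (rule S_power)
  let ?k = "D + r"
  have "act (b ^ j) (\<Oplus>l\<in>{..?k}. act (coeff G l) (h (?k - l))) = \<zero>"
    using G(1) bj by (simp add: ann_poly_def act_0_right)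
  moreover have "act (b ^ j) (\<Oplus>l\<in>{..?k}. act (coeff G l) (h (?k - l))) =
      (\<Oplus>l\<in>{..?k}. act (b ^ j) (act (coeff G l) (h (?k - l))))"
    by (rule act_finsum) (auto intro: act_h_closed S bj)
  moreover have "(\<Oplus>l\<in>{..?k}. act (b ^ j) (act (coeff G l) (h (?k - l)))) =
      (\<Oplus>l\<in>{..?k}. if D = l then act (b ^ j) (act (coeff G l) (h (?k - l))) else \<zero>)"
  proof (rule finsum_cong')
    show "(\<lambda>l. if D = l then act (b ^ j) (act (coeff G l) (h (?k - l))) else \<zero>) \<in> {..?k} \<rightarrow> carrier M"
      by (auto intro!: act_h_closed S act_closed bj)
    fix l assume l: "l \<in> {..?k}"
    have cl: "coeff G l \<in> S" using S by (simp add: S_poly_def)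
    consider "l = D" | "l > D" | "l < D" by linarith
    then show "act (b ^ j) (act (coeff G l) (h (?k - l))) =
        (if D = l then act (b ^ j) (act (coeff G l) (h (?k - l))) else \<zero>)"
    proof cases
      case 2
      then have "coeff G l = 0" using G(2) by (simp add: coeff_eq_0)
      then show ?thesis using 2 h bj by (simp add: act_0_left act_0_right)
    next
      case 3
      then have "?k - l + j > E" using Suc.prems by simp
      then have "act (b ^ j) (h (?k - l)) = \<zero>" unfolding b_def by (rule Suc.IH)
      then have "act (coeff G l) (act (b ^ j) (h (?k - l))) = \<zero>" using cl by (simp add: act_0_right)
      then have "act (b ^ j) (act (coeff G l) (h (?k - l))) = \<zero>"
        using act_mult[OF cl bj h] act_mult[OF bj cl h] by (simp add: mult.commute)
      then show ?thesis using 3 by simp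
    qed simp
  qed simp
  moreover have "\<dots> = act (b ^ j) (act (coeff G D) (h (?k - D)))"
    by (rule finsum_singleton[of D "{..?k}" "\<lambda>l. act (b ^ j) (act (coeff G l) (h (?k - l)))"])
      (auto intro!: act_h_closed S act_closed bj)
  ultimately have "act (b ^ j) (act b (h r)) = \<zero>" by (simp add: b_def)
  then show ?case using act_mult[OF bj b h] by (simp add: b_def mult.commute)
qed

text \<open>Splitting off the leading term keeps \<open>F\<close> nilpotent modulo the annihilator of \<open>h\<close>.\<close>

lemma coeff_nilpotent:
  assumes E: "\<And>k. k > E \<Longrightarrow> h k = \<zero>"
  shows "F \<in> S_poly \<Longrightarrow> (\<And>l. l \<ge> d \<Longrightarrow> coeff F l = 0) \<Longrightarrow> F ^ N \<in> ann_poly h \<Longrightarrow>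
    \<exists>j\<ge>1. act (coeff F k ^ j) (h r) = \<zero>"
proof (induction d arbitrary: F N)
  case 0
  then show ?case by (intro exI[of _ 1]) (simp add: act_0_left h)
next
  case (Suc d)
  define a where "a = coeff F d"
  have a: "a \<in> S" using Suc.prems by (simp add: a_def S_poly_def)
  have deg: "degree F \<le> d" using Suc.prems(2) by (intro degree_le) auto
  \<comment> \<open>The coefficient of \<open>F ^ N\<close> at the degree bound is
    \<open>a ^ N\<close>, and its power \<open>Suc E\<close> kills all of \<open>h\<close>. The
    outer \<open>Suc\<close> keeps \<open>J\<close> positive even for \<open>N = 0\<close>.\<close>
  define J where "J = Suc (N * Suc E)"
  have aJ: "act (a ^ J) (h r) = \<zero>" for r
  proof -
    have "act ((a ^ N) ^ Suc E) (h r) = \<zero>"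
    proof -
      have "act (coeff (F ^ N) (N * d) ^ Suc E) (h r) = \<zero>"
        by (rule leading_coeff_nilpotent[OF Suc.prems(3) _ E])
          (use coeff_power_bound[OF deg, of N] in auto)
      then show ?thesis using coeff_power_bound[OF deg, of N] by (simp only: a_def)
    qed
    then have "act a (act (a ^ (N * Suc E)) (h r)) = \<zero>"
      by (simp only: power_mult act_0_right[OF a])
    then show ?thesis
      using act_mult[OF a S_power[OF a] h] by (simp add: J_def)
  qed
  let ?m = "monom a d"
  have m: "- ?m \<in> S_poly" using a by (simp add: S_poly_def S_0 S_uminus)
  have mJ: "(- ?m) ^ J = monom ((- a) ^ J) (J * d)"
    by (simp add: minus_monom monom_power mult.commute)
  have aJ': "act ((- a) ^ J) (h r) = \<zero>" for r
  proof -
    have "(- a) ^ J = (- 1) ^ J * a ^ J" by (simp add: power_mult_distrib[symmetric])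
    then show ?thesis using a aJ h S_uminus[OF S_1]
      by (simp only: act_mult S_power act_0_right)
  qed
  have "(- ?m) ^ J \<in> ann_poly h"
  proof -
    have "act (coeff ((- ?m) ^ J) l) (h s) = \<zero>" for l s
      unfolding mJ by (simp add: aJ' act_0_left h)
    then show ?thesis using S_poly_power[OF m] by (simp add: ann_poly_def)
  qed
  with Suc.prems have "(F + - ?m) ^ (N + J) \<in> ann_poly h"
    by (intro binomial_closed[where P = S_poly])
      (auto intro: ann_poly_0 ann_poly_add ann_poly_mult S_poly_mult S_poly_of_nat m)
  moreover have "F + - ?m \<in> S_poly"
  proof -
    have "coeff (F + - ?m) l \<in> S" for l
      using S_add[of "coeff F l" "coeff (- ?m) l"] Suc.prems(1) m unfolding S_poly_def by simp
    then show ?thesis unfolding S_poly_def by blast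
  qed
  moreover have "coeff (F + - ?m) l = 0" if "l \<ge> d" for l
    using that Suc.prems(2)[of l] by (cases "l = d") (auto simp: a_def)
  ultimately have IH: "\<exists>j\<ge>1. act (coeff (F + - ?m) k ^ j) (h r) = \<zero>"
    using Suc.IH by blast
  show ?case
  proof (cases "k = d")
    case True
    then show ?thesis using aJ by (intro exI[of _ J]) (simp add: a_def J_def)
  next
    case False
    then show ?thesis using IH by simp
  qed
qed

end

end

section \<open>Additive maps on tensor products\<close>

context abelian_monoid
begin

lemma list_sum_Nil [simp]: "list_sum G [] = \<zero>"
  by (simp add: list_sum_def)

lemma list_sum_Cons [simp]: "list_sum G (x # xs) = x \<oplus> list_sum G xs"
  by (simp add: list_sum_def)

lemma list_sum_closed [simp]: "set xs \<subseteq> carrier G \<Longrightarrow> list_sum G xs \<in> carrier G"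
  by (induction xs) simp_all

lemma list_sum_append:
  "set xs \<subseteq> carrier G \<Longrightarrow> set ys \<subseteq> carrier G \<Longrightarrow>
    list_sum G (xs @ ys) = list_sum G xs \<oplus> list_sum G ys"
  by (induction xs) (simp_all add: a_assoc)

lemma list_sum_hom:
  assumes "abelian_monoid N" "h \<zero> = \<zero>\<^bsub>N\<^esub>"
    and "\<And>x y. x \<in> carrier G \<Longrightarrow> y \<in> carrier G \<Longrightarrow> h (x \<oplus> y) = h x \<oplus>\<^bsub>N\<^esub> h y"
    and "set xs \<subseteq> carrier G"
  shows "h (list_sum G xs) = list_sum N (map h xs)"
  using assms(4)
  by (induction xs)
    (simp_all add: assms abelian_monoid.list_sum_Nil[OF assms(1)] abelian_monoid.list_sum_Cons[OF assms(1)])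

lemma sum_cong_list_sum:
  assumes "sum_cong E step s t"
    and f: "\<And>e. e \<in> E \<Longrightarrow> f e \<in> carrier G"
    and step: "\<And>s t. step s t \<Longrightarrow> s \<in> lists E \<and> t \<in> lists E \<and>
      list_sum G (map f s) = list_sum G (map f t)"
  shows "s \<in> lists E \<and> t \<in> lists E \<and> list_sum G (map f s) = list_sum G (map f t)"
  using assms(1)
proof (induction rule: sum_cong.induct)
  case (base s t)
  then show ?case by (rule step)
next
  case (app s t s' t')
  moreover have "set (map f u) \<subseteq> carrier G" if "u \<in> lists E" for u
    using that f by auto
  ultimately show ?case by (simp add: list_sum_append)
next
  case (comm s t)
  moreover have "set (map f u) \<subseteq> carrier G" if "u \<in> lists E" for u
    using that f by auto
  ultimately show ?case by (simp add: list_sum_append a_comm)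
qed auto

text \<open>The universal property of the tensor product for representing lists; all information
  drawn from an equality of tensors comes through it.\<close>

lemma tensor_eq_list_sum:
  assumes "tensor_eq R U ra Y la s t"
    and f: "\<And>x y. x \<in> carrier U \<Longrightarrow> y \<in> carrier Y \<Longrightarrow> f (x, y) \<in> carrier G"
    and U: "\<zero>\<^bsub>U\<^esub> \<in> carrier U"
      "\<And>x x'. x \<in> carrier U \<Longrightarrow> x' \<in> carrier U \<Longrightarrow> x \<oplus>\<^bsub>U\<^esub> x' \<in> carrier U"
      "\<And>x r. x \<in> carrier U \<Longrightarrow> r \<in> carrier R \<Longrightarrow> ra x r \<in> carrier U"
    and Y: "\<And>y y'. y \<in> carrier Y \<Longrightarrow> y' \<in> carrier Y \<Longrightarrow> y \<oplus>\<^bsub>Y\<^esub> y' \<in> carrier Y"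
      "\<And>r y. r \<in> carrier R \<Longrightarrow> y \<in> carrier Y \<Longrightarrow> la r y \<in> carrier Y"
    and zero: "\<And>y. y \<in> carrier Y \<Longrightarrow> f (\<zero>\<^bsub>U\<^esub>, y) = \<zero>"
    and left: "\<And>x x' y. x \<in> carrier U \<Longrightarrow> x' \<in> carrier U \<Longrightarrow> y \<in> carrier Y \<Longrightarrow>
      f (x \<oplus>\<^bsub>U\<^esub> x', y) = f (x, y) \<oplus> f (x', y)"
    and right: "\<And>x y y'. x \<in> carrier U \<Longrightarrow> y \<in> carrier Y \<Longrightarrow> y' \<in> carrier Y \<Longrightarrow>
      f (x, y \<oplus>\<^bsub>Y\<^esub> y') = f (x, y) \<oplus> f (x, y')"
    and balance: "\<And>x r y. x \<in> carrier U \<Longrightarrow> r \<in> carrier R \<Longrightarrow> y \<in> carrier Y \<Longrightarrow>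
      f (ra x r, y) = f (x, la r y)"
  shows "s \<in> lists (carrier U \<times> carrier Y) \<and> t \<in> lists (carrier U \<times> carrier Y) \<and>
    list_sum G (map f s) = list_sum G (map f t)"
  using assms(1) unfolding tensor_eq_def
proof (rule sum_cong_list_sum)
  fix s t assume "tensor_step R U ra Y la s t"
  then show "s \<in> lists (carrier U \<times> carrier Y) \<and> t \<in> lists (carrier U \<times> carrier Y) \<and>
      list_sum G (map f s) = list_sum G (map f t)"
    by cases (auto simp: zero left right balance f U Y)
qed (auto simp: f)

end

lemma tensor_class:
  assumes "c \<in> tensor R U ra Y la"
  obtains s where "s \<in> c" "s \<in> lists (carrier U \<times> carrier Y)" "\<And>t. t \<in> c \<Longrightarrow> tensor_eq R U ra Y la s t"
proof -
  obtain s where s: "s \<in> lists (carrier U \<times> carrier Y)" "c = {(s, t). tensor_eq R U ra Y la s t} `` {s}"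
    using assms unfolding tensor_def by (rule quotientE)
  moreover from this have "tensor_eq R U ra Y la s s"
    unfolding tensor_eq_def by (intro sum_cong.refl)
  ultimately show ?thesis using that by auto
qed

section \<open>Coefficients in the Hopf algebroid\<close>

text \<open>In even topological degree every Koszul sign is trivial; a general \<open>y\<close> is
  treated through its homogeneous components.\<close>

lemma (in bigraded_ring) even_degree_central:
  assumes "x \<in> G s w" "even s" "y \<in> carrier R"
  shows "x \<otimes> y = y \<otimes> x"
proof -
  have sub: "G s w \<subseteq> carrier R" for s w
    using subgroup[of s w] by (rule additive_subgroup.a_subset)
  obtain F f where F: "finite F" "\<forall>(s, w)\<in>F. f (s, w) \<in> G s w" "y = (\<Oplus>d\<in>F. f d)"
    using spans[OF assms(3)] by blast
  have f: "f \<in> F \<rightarrow> carrier R" using F(2) sub by fastforce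
  have x: "x \<in> carrier R" using assms(1) sub by blast
  have "x \<otimes> y = (\<Oplus>d\<in>F. x \<otimes> f d)"
    unfolding F(3) by (rule finsum_rdistr[OF F(1) x f])
  also have "\<dots> = (\<Oplus>d\<in>F. f d \<otimes> x)"
  proof (rule finsum_cong')
    show "(\<lambda>d. f d \<otimes> x) \<in> F \<rightarrow> carrier R" using f x by auto
    fix d assume d: "d \<in> F"
    then obtain s' w' where "d = (s', w')" "f d \<in> G s' w'" using F(2) by (cases d) auto
    then show "x \<otimes> f d = f d \<otimes> x"
      using graded_commute[OF assms(1)] assms(2) by (simp add: koszul_def)
  qed simp
  also have "\<dots> = y \<otimes> x"
    unfolding F(3) by (rule finsum_ldistr[OF F(1) x f, symmetric])
  finally show ?thesis .
qed

lemma poly_ring_simps [simp]: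
  "carrier (poly_ring S) = S" "x \<otimes>\<^bsub>poly_ring S\<^esub> y = x * y" "x \<oplus>\<^bsub>poly_ring S\<^esub> y = x + y"
  "\<one>\<^bsub>poly_ring S\<^esub> = 1" "\<zero>\<^bsub>poly_ring S\<^esub> = 0"
  by (simp_all add: poly_ring_def)

lemma bp_homogeneous_const: "bp_homogeneous p 0 (bp_const c)"
  by (simp add: bp_homogeneous_iff grade_const monom_0)

lemma bp_homogeneous_hazewinkel: "prime p \<Longrightarrow> bp_homogeneous p (p ^ n - 1) (hazewinkel p n)"
  by (simp add: bp_homogeneous_iff grade_hazewinkel)

lemma bp_homogeneous_tt: "bp_homogeneous p (p ^ n - 1) (tt n)"
  by (simp add: bp_homogeneous_iff grade_tt)

context motivic_bp_hopf_algebroid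
begin

interpretation A: bigraded_ring "base H" "base_gr H" by (rule base_ring)
interpretation B: bigraded_ring "total H" "total_gr H" by (rule total_ring)
interpretation BP: local_alg p "BP p" by (rule local_alg_BP[OF p_prime])
interpretation BPBP: local_alg p "BPBP p" by (rule local_alg_BPBP[OF p_prime])

lemma Phi_closed: "b \<in> BPBP p \<Longrightarrow> \<Phi> b \<in> carrier (total H)"
  and Phi_mult: "b \<in> BPBP p \<Longrightarrow> c \<in> BPBP p \<Longrightarrow> \<Phi> (b * c) = \<Phi> b \<otimes>\<^bsub>total H\<^esub> \<Phi> c"
  and Phi_add: "b \<in> BPBP p \<Longrightarrow> c \<in> BPBP p \<Longrightarrow> \<Phi> (b + c) = \<Phi> b \<oplus>\<^bsub>total H\<^esub> \<Phi> c"
  using ring_hom_closed[OF total_hom] ring_hom_mult[OF total_hom] ring_hom_add[OF total_hom]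
  by simp_all

lemma phi_closed: "b \<in> BP p \<Longrightarrow> \<phi> b \<in> carrier (base H)"
  and phi_mult: "b \<in> BP p \<Longrightarrow> c \<in> BP p \<Longrightarrow> \<phi> (b * c) = \<phi> b \<otimes>\<^bsub>base H\<^esub> \<phi> c"
  and phi_add: "b \<in> BP p \<Longrightarrow> c \<in> BP p \<Longrightarrow> \<phi> (b + c) = \<phi> b \<oplus>\<^bsub>base H\<^esub> \<phi> c"
  and phi_1: "\<phi> 1 = \<one>\<^bsub>base H\<^esub>"
  using ring_hom_closed[OF base_hom] ring_hom_mult[OF base_hom] ring_hom_add[OF base_hom]
    ring_hom_one[OF base_hom]
  by simp_all

lemma phi_0: "\<phi> 0 = \<zero>\<^bsub>base H\<^esub>"
  using phi_add[of 0 0] phi_closed[of 0] by (simp add: A.add.l_cancel_one')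

lemma phi_power: "b \<in> BP p \<Longrightarrow> \<phi> (b ^ k) = \<phi> b [^]\<^bsub>base H\<^esub> k"
proof (induction k)
  case (Suc k)
  then show ?case using phi_mult[of "b ^ k" b] BP.power_in by (simp add: mult.commute)
qed (simp add: phi_1)

lemma phi_sum:
  "finite I \<Longrightarrow> (\<And>i. i \<in> I \<Longrightarrow> f i \<in> BP p) \<Longrightarrow> \<phi> (\<Sum>i\<in>I. f i) = (\<Oplus>\<^bsub>base H\<^esub>i\<in>I. \<phi> (f i))"
proof (induction I rule: finite_induct)
  case (insert i I)
  then have "(\<lambda>i. \<phi> (f i)) \<in> I \<rightarrow> carrier (base H)" "\<phi> (f i) \<in> carrier (base H)"
    using phi_closed by auto
  with insert show ?case by (simp add: phi_add BP.sum_in)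
qed (simp add: phi_0)

text \<open>\<open>\<Phi>\<close> places constants and generators in even topological degree, where
  elements are central; centrality passes to sums and products.\<close>

lemma Phi_central:
  assumes "b \<in> BPBP p" "g \<in> carrier (total H)"
  shows "\<Phi> b \<otimes>\<^bsub>total H\<^esub> g = g \<otimes>\<^bsub>total H\<^esub> \<Phi> b"
proof -
  have hom: "\<Phi> b \<otimes>\<^bsub>total H\<^esub> g = g \<otimes>\<^bsub>total H\<^esub> \<Phi> b"
    if "b \<in> BPBP p" "bp_homogeneous p e b" for b e
    by (rule B.even_degree_central[OF total_hom_degree[OF that] _ assms(2)]) simp
  have "b \<in> BPBP p \<and> \<Phi> b \<otimes>\<^bsub>total H\<^esub> g = g \<otimes>\<^bsub>total H\<^esub> \<Phi> b"
    using assms(1)[unfolded BPBP_def]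
  proof (induction rule: poly_alg.induct)
    case (const c)
    then show ?case using hom[OF _ bp_homogeneous_const] BPBP.const_in by blast
  next
    case (gen P)
    then have "P \<in> BPBP p"
      using tt_in_BPBP[OF p_prime] BP_subset_BPBP[OF hazewinkel_in_BP[OF p_prime]] by blast
    moreover from gen obtain n where "P = hazewinkel p n \<or> P = tt n" by blast
    ultimately show ?case
      using hom bp_homogeneous_hazewinkel[OF p_prime] bp_homogeneous_tt by blast
  next
    case (add P Q)
    then show ?case using assms(2)
      by (simp add: Phi_add Phi_closed BPBP.add_in B.l_distr B.r_distr)
  next
    case (mult P Q)
    then have "\<Phi> (P * Q) \<otimes>\<^bsub>total H\<^esub> g = \<Phi> P \<otimes>\<^bsub>total H\<^esub> (g \<otimes>\<^bsub>total H\<^esub> \<Phi> Q)"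
      using assms(2) by (simp add: Phi_mult Phi_closed B.m_assoc)
    also have "\<dots> = g \<otimes>\<^bsub>total H\<^esub> \<Phi> (P * Q)"
      using mult assms(2) by (simp add: Phi_mult Phi_closed B.m_assoc[symmetric])
    finally show ?case using mult BPBP.mult_in by blast
  qed
  then show ?thesis by blast
qed

text \<open>Transported from the total ring, of which the base is a retract through the left unit
  and the counit.\<close>

lemma phi_central:
  assumes "b \<in> BP p" "a \<in> carrier (base H)"
  shows "\<phi> b \<otimes>\<^bsub>base H\<^esub> a = a \<otimes>\<^bsub>base H\<^esub> \<phi> b"
proof -
  have la: "lunit H a \<in> carrier (total H)" using ring_hom_closed[OF lunit_hom assms(2)] .
  have "counit H (\<Phi> b \<otimes>\<^bsub>total H\<^esub> lunit H a) = counit H (lunit H a \<otimes>\<^bsub>total H\<^esub> \<Phi> b)"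
    using Phi_central[OF BP_subset_BPBP[OF assms(1)] la] by simp
  then show ?thesis
    using la Phi_closed[OF BP_subset_BPBP[OF assms(1)]] phi_closed[OF assms(1)] assms
    by (simp add: ring_hom_mult[OF counit_hom] hom_lunit counit_lunit)
qed

lemma lunit_closed: "a \<in> carrier (base H) \<Longrightarrow> lunit H a \<in> carrier (total H)"
  and runit_closed: "a \<in> carrier (base H) \<Longrightarrow> runit H a \<in> carrier (total H)"
  and counit_closed: "g \<in> carrier (total H) \<Longrightarrow> counit H g \<in> carrier (base H)"
  and conj_closed: "g \<in> carrier (total H) \<Longrightarrow> conj H g \<in> carrier (total H)"
  by (simp_all add: ring_hom_closed[OF lunit_hom] ring_hom_closed[OF runit_hom]
      ring_hom_closed[OF counit_hom] ring_hom_closed[OF conj_hom])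

text \<open>Apply the counit to the identity \<open>conj_left\<close>. The counit of
  \<open>y\<close> equals the counit of the conjugate of \<open>runit H (counit H y)\<close>, so the
  sum becomes the counit of the conjugate of the sum in \<open>counit_right\<close>, which is
  \<open>g\<close>.\<close>

lemma counit_conj:
  assumes "g \<in> carrier (total H)" shows "counit H (conj H g) = counit H g"
proof -
  obtain s where s: "s \<in> comult H g" "s \<in> lists (carrier (total H) \<times> carrier (total H))"
    using tensor_class[OF comult_closed[OF assms, unfolded total_tensor_def]] by blast
  then have s': "\<And>x y. (x, y) \<in> set s \<Longrightarrow> x \<in> carrier (total H) \<and> y \<in> carrier (total H)" by auto
  have ab: "abelian_monoid (base H)" by unfold_locales
  have hom: "(\<lambda>x. counit H (conj H x)) \<in> ring_hom (total H) (base H)"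
    using ring_hom_trans[OF conj_hom counit_hom] by (simp add: comp_def)
  have "counit H g = counit H (runit H (counit H g))"
    using assms by (simp add: counit_runit counit_closed)
  also have "\<dots> = counit H (list_sum (total H) [conj H x \<otimes>\<^bsub>total H\<^esub> y. (x, y) \<leftarrow> s])"
    by (simp add: conj_left[OF assms s(1)])
  also have "\<dots> = list_sum (base H) (map (counit H) [conj H x \<otimes>\<^bsub>total H\<^esub> y. (x, y) \<leftarrow> s])"
    by (rule B.list_sum_hom[where h = "counit H", OF ab
          ring_hom_zero[OF counit_hom B.ring_axioms A.ring_axioms]])
      (use s' in \<open>auto simp: ring_hom_add[OF counit_hom] conj_closed\<close>)
  also have "map (counit H) [conj H x \<otimes>\<^bsub>total H\<^esub> y. (x, y) \<leftarrow> s] =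
      map (\<lambda>x. counit H (conj H x)) [ract H x (counit H y). (x, y) \<leftarrow> s]"
    using s' by (auto simp: ract_def ring_hom_mult[OF counit_hom] ring_hom_mult[OF conj_hom]
        conj_closed runit_closed counit_closed conj_runit counit_lunit lunit_closed)
  also have "list_sum (base H) \<dots> =
      counit H (conj H (list_sum (total H) [ract H x (counit H y). (x, y) \<leftarrow> s]))"
    by (rule B.list_sum_hom[where h = "\<lambda>x. counit H (conj H x)", OF ab
          ring_hom_zero[OF hom B.ring_axioms A.ring_axioms], symmetric])
      (use s' in \<open>auto simp: ring_hom_add[OF hom] ract_def runit_closed counit_closed\<close>)
  also have "\<dots> = counit H (conj H g)"
    by (simp add: counit_right[OF assms s(1)])
  finally show ?thesis by simp
qed

text \<open>A list \<open>r\<close> of pairs \<open>(a, b)\<close> represents \<open>\<Sum> \<eta>\<^sub>L(a) \<Phi>(b)\<close>; \<open>t_coeff m k r\<close> is the coefficient of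
  \<open>t\<^sub>m\<^sup>k\<close> of this element when the other \<open>t\<^sub>j\<close> are set to \<open>0\<close>.\<close>

definition base_sum :: "('a \<times> bp_poly) list \<Rightarrow> 'g"
  where "base_sum r = list_sum (total H) [lact H a (\<Phi> b). (a, b) \<leftarrow> r]"

definition t_coeff :: "nat \<Rightarrow> nat \<Rightarrow> ('a \<times> bp_poly) list \<Rightarrow> 'a"
  where "t_coeff m k r = list_sum (base H) [a \<otimes>\<^bsub>base H\<^esub> \<phi> (coeff (t_part m b) k). (a, b) \<leftarrow> r]"

abbreviation base_lists :: "('a \<times> bp_poly) list set"
  where "base_lists \<equiv> lists (carrier (base H) \<times> BPBP p)"

lemma lact_closed: "a \<in> carrier (base H) \<Longrightarrow> g \<in> carrier (total H) \<Longrightarrow> lact H a g \<in> carrier (total H)"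
  by (simp add: lact_def lunit_closed)

lemma ract_closed: "a \<in> carrier (base H) \<Longrightarrow> g \<in> carrier (total H) \<Longrightarrow> ract H g a \<in> carrier (total H)"
  by (simp add: ract_def runit_closed)

lemma phi_coeff_closed: "b \<in> BPBP p \<Longrightarrow> \<phi> (coeff (t_part m b) k) \<in> carrier (base H)"
  by (simp add: phi_closed coeff_t_part_in_BP[OF p_prime])

lemma base_sum_Nil [simp]: "base_sum [] = \<zero>\<^bsub>total H\<^esub>"
  and base_sum_Cons [simp]: "base_sum ((a, b) # r) = lact H a (\<Phi> b) \<oplus>\<^bsub>total H\<^esub> base_sum r"
  and t_coeff_Nil [simp]: "t_coeff m k [] = \<zero>\<^bsub>base H\<^esub>"
  and t_coeff_Cons [simp]: "t_coeff m k ((a, b) # r) =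
    a \<otimes>\<^bsub>base H\<^esub> \<phi> (coeff (t_part m b) k) \<oplus>\<^bsub>base H\<^esub> t_coeff m k r"
  by (simp_all add: base_sum_def t_coeff_def)

lemma base_sum_closed [simp]: "r \<in> base_lists \<Longrightarrow> base_sum r \<in> carrier (total H)"
  by (induction r) (auto simp: lact_closed Phi_closed)

lemma t_coeff_closed [simp]: "r \<in> base_lists \<Longrightarrow> t_coeff m k r \<in> carrier (base H)"
  by (induction r) (auto simp: phi_coeff_closed)

lemma base_sum_append:
  "r \<in> base_lists \<Longrightarrow> r' \<in> base_lists \<Longrightarrow> base_sum (r @ r') = base_sum r \<oplus>\<^bsub>total H\<^esub> base_sum r'"
  unfolding base_sum_def map_append
  by (rule B.list_sum_append) (auto simp: lact_closed Phi_closed)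

lemma t_coeff_append:
  "r \<in> base_lists \<Longrightarrow> r' \<in> base_lists \<Longrightarrow> t_coeff m k (r @ r') = t_coeff m k r \<oplus>\<^bsub>base H\<^esub> t_coeff m k r'"
  unfolding t_coeff_def map_append
  by (rule A.list_sum_append) (auto simp: phi_coeff_closed)

text \<open>Injectivity of base change turns a vanishing element into a vanishing tensor over BP_*.
  The coefficient respects the balancing relation because \<open>t_part\<close> sends BP_* to
  constant polynomials.\<close>

lemma t_coeff_eq_0:
  assumes "r \<in> base_lists" "base_sum r = \<zero>\<^bsub>total H\<^esub>"
  shows "t_coeff m k r = \<zero>\<^bsub>base H\<^esub>"
proof -
  let ?f = "\<lambda>(a, b). a \<otimes>\<^bsub>base H\<^esub> \<phi> (coeff (t_part m b) k)"
  have "tensor_eq (poly_ring (BP p)) (base H) (\<lambda>a b. a \<otimes>\<^bsub>base H\<^esub> \<phi> b)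
        (poly_ring (BPBP p)) (\<lambda>b x. b * x) r []"
    using base_change_inj[OF assms(1)] assms(2) by (simp add: base_sum_def)
  then have "list_sum (base H) (map ?f r) = list_sum (base H) (map ?f [])"
  proof (rule A.tensor_eq_list_sum[THEN conjunct2, THEN conjunct2])
    fix x r y
    assume xy: "x \<in> carrier (base H)" "r \<in> carrier (poly_ring (BP p))" "y \<in> carrier (poly_ring (BPBP p))"
    then have "coeff (t_part m (r * y)) k = r * coeff (t_part m y) k"
      by (simp add: t_part.hom_mult t_part_BP)
    then show "?f (x \<otimes>\<^bsub>base H\<^esub> \<phi> r, y) = ?f (x, r * y)"
      using xy by (simp add: phi_mult coeff_t_part_in_BP[OF p_prime] phi_closed phi_coeff_closed A.m_assoc)
  qed (auto simp: phi_coeff_closed phi_closed BPBP.add_in BPBP.mult_in BP_subset_BPBP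
      A.l_distr A.r_distr t_part.hom_add phi_add coeff_t_part_in_BP[OF p_prime])
  then show ?thesis by (simp add: t_coeff_def)
qed

text \<open>Appending \<open>r'\<close> with its first entries negated to \<open>r\<close> gives a
  list that represents zero.\<close>

lemma t_coeff_unique:
  assumes r: "r \<in> base_lists" "r' \<in> base_lists" "base_sum r = base_sum r'"
  shows "t_coeff m k r = t_coeff m k r'"
proof -
  define n where "n = map (\<lambda>(a, b). (\<ominus>\<^bsub>base H\<^esub> a, b)) r'"
  have n: "n \<in> base_lists \<and> base_sum n = \<ominus>\<^bsub>total H\<^esub> base_sum r' \<and>
      t_coeff m k n = \<ominus>\<^bsub>base H\<^esub> t_coeff m k r'"
    unfolding n_def using r(2)
  proof (induction r')
    case (Cons x r')
    obtain a b where x: "x = (a, b)" by (cases x)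
    have ab: "a \<in> carrier (base H)" "b \<in> BPBP p" "r' \<in> base_lists" using Cons x by auto
    have "lunit H (\<ominus>\<^bsub>base H\<^esub> a) = \<ominus>\<^bsub>total H\<^esub> lunit H a"
    proof -
      have "lunit H (\<ominus>\<^bsub>base H\<^esub> a \<oplus>\<^bsub>base H\<^esub> a) = \<zero>\<^bsub>total H\<^esub>"
        using ab ring_hom_zero[OF lunit_hom A.ring_axioms B.ring_axioms] by (simp add: A.l_neg)
      then have "lunit H (\<ominus>\<^bsub>base H\<^esub> a) \<oplus>\<^bsub>total H\<^esub> lunit H a = \<zero>\<^bsub>total H\<^esub>"
        using ab by (simp add: ring_hom_add[OF lunit_hom])
      then show ?thesis using ab by (intro B.minus_equality[symmetric]) (simp_all add: lunit_closed)
    qed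
    then have "lact H (\<ominus>\<^bsub>base H\<^esub> a) (\<Phi> b) = \<ominus>\<^bsub>total H\<^esub> lact H a (\<Phi> b)"
      using ab by (simp add: lact_def B.l_minus lunit_closed Phi_closed)
    then show ?case using Cons ab x
      by (auto simp: A.l_minus phi_coeff_closed lact_closed Phi_closed A.minus_add B.minus_add)
  qed simp
  have "t_coeff m k (r @ n) = \<zero>\<^bsub>base H\<^esub>"
    using r n by (intro t_coeff_eq_0) (auto simp: base_sum_append B.r_neg)
  then have "t_coeff m k r \<oplus>\<^bsub>base H\<^esub> \<ominus>\<^bsub>base H\<^esub> t_coeff m k r' = \<zero>\<^bsub>base H\<^esub>"
    using r n by (simp add: t_coeff_append)
  then have "\<ominus>\<^bsub>base H\<^esub> (\<ominus>\<^bsub>base H\<^esub> t_coeff m k r') = t_coeff m k r"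
    using r by (intro A.minus_equality) auto
  then show ?thesis using r by simp
qed

text \<open>Conjugation turns right linearity into left linearity, so these are right linear
  coefficient functions.\<close>

definition right_coeff :: "nat \<Rightarrow> nat \<Rightarrow> 'g \<Rightarrow> 'a"
  where "right_coeff m k g = t_coeff m k (SOME r. r \<in> base_lists \<and> conj H g = base_sum r)"

lemma right_coeff_eq:
  assumes "r \<in> base_lists" "conj H g = base_sum r"
  shows "right_coeff m k g = t_coeff m k r"
proof -
  let ?r = "SOME r. r \<in> base_lists \<and> conj H g = base_sum r"
  have "?r \<in> base_lists \<and> conj H g = base_sum ?r"
    using someI_ex[of "\<lambda>r. r \<in> base_lists \<and> conj H g = base_sum r"] assms by blast
  then show ?thesis
    unfolding right_coeff_def using assms by (intro t_coeff_unique) auto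
qed

lemma conj_representation:
  assumes "g \<in> carrier (total H)"
  obtains r where "r \<in> base_lists" "conj H g = base_sum r"
  using base_change_surj[OF conj_closed[OF assms]] unfolding base_sum_def by blast

lemma right_coeff_closed: "g \<in> carrier (total H) \<Longrightarrow> right_coeff m k g \<in> carrier (base H)"
  by (erule conj_representation) (simp add: right_coeff_eq)

lemma right_coeff_0: "right_coeff m k \<zero>\<^bsub>total H\<^esub> = \<zero>\<^bsub>base H\<^esub>"
  using right_coeff_eq[of "[]" "\<zero>\<^bsub>total H\<^esub>"] ring_hom_zero[OF conj_hom B.ring_axioms B.ring_axioms]
  by simp

lemma right_coeff_add:
  assumes "g \<in> carrier (total H)" "g' \<in> carrier (total H)"
  shows "right_coeff m k (g \<oplus>\<^bsub>total H\<^esub> g') = right_coeff m k g \<oplus>\<^bsub>base H\<^esub> right_coeff m k g'"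
proof -
  obtain r r' where r: "r \<in> base_lists" "conj H g = base_sum r" "r' \<in> base_lists" "conj H g' = base_sum r'"
    using conj_representation assms by metis
  then have "conj H (g \<oplus>\<^bsub>total H\<^esub> g') = base_sum (r @ r')"
    using assms by (simp add: ring_hom_add[OF conj_hom] base_sum_append)
  then have "right_coeff m k (g \<oplus>\<^bsub>total H\<^esub> g') = t_coeff m k (r @ r')"
    using r by (intro right_coeff_eq) auto
  then show ?thesis using r by (simp add: right_coeff_eq t_coeff_append)
qed

text \<open>Conjugation sends the right unit of \<open>a\<close> to its left unit, multiplied on
  from the right; centrality of the images of \<open>\<Phi>\<close> and \<open>\<phi>\<close> moves
  it past the factors from BP_*BP and BP_*.\<close>

lemma right_coeff_ract:
  assumes "g \<in> carrier (total H)" "a \<in> carrier (base H)"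
  shows "right_coeff m k (ract H g a) = right_coeff m k g \<otimes>\<^bsub>base H\<^esub> a"
proof -
  obtain r where r: "r \<in> base_lists" "conj H g = base_sum r"
    using conj_representation assms by metis
  define r' where "r' = map (\<lambda>(c, b). (c \<otimes>\<^bsub>base H\<^esub> a, b)) r"
  have r': "r' \<in> base_lists \<and> base_sum r' = base_sum r \<otimes>\<^bsub>total H\<^esub> lunit H a \<and>
      t_coeff m k r' = t_coeff m k r \<otimes>\<^bsub>base H\<^esub> a"
    unfolding r'_def using r(1)
  proof (induction r)
    case Nil
    then show ?case using assms(2) by (simp add: lunit_closed)
  next
    case (Cons x r)
    obtain c b where x: "x = (c, b)" by (cases x)
    have cb: "c \<in> carrier (base H)" "b \<in> BPBP p" "r \<in> base_lists" using Cons x by auto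
    have "lact H (c \<otimes>\<^bsub>base H\<^esub> a) (\<Phi> b) = lact H c (\<Phi> b) \<otimes>\<^bsub>total H\<^esub> lunit H a"
      using cb assms(2) Phi_central[OF cb(2) lunit_closed[OF assms(2)]]
      by (simp add: lact_def ring_hom_mult[OF lunit_hom] lunit_closed Phi_closed B.m_assoc)
    moreover have "c \<otimes>\<^bsub>base H\<^esub> a \<otimes>\<^bsub>base H\<^esub> \<phi> (coeff (t_part m b) k) =
        c \<otimes>\<^bsub>base H\<^esub> \<phi> (coeff (t_part m b) k) \<otimes>\<^bsub>base H\<^esub> a"
      using cb assms(2) phi_central[OF coeff_t_part_in_BP[OF p_prime cb(2)] assms(2)]
      by (simp add: phi_coeff_closed A.m_assoc)
    ultimately show ?case using Cons cb x assms(2)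
      by (auto simp: B.l_distr A.l_distr lact_closed Phi_closed lunit_closed phi_coeff_closed)
  qed
  have "conj H (ract H g a) = base_sum r'"
    using assms r r' by (simp add: ract_def ring_hom_mult[OF conj_hom] runit_closed conj_runit)
  then have "right_coeff m k (ract H g a) = t_coeff m k r'" using r' by (intro right_coeff_eq) auto
  then show ?thesis using r r' by (simp add: right_coeff_eq)
qed

text \<open>Conjugation turns the left unit of \<open>\<phi> b\<close> into its right unit, which is
  \<open>\<Phi>\<close> of \<open>bp_runit p b\<close>. Multiplying by this central element is a
  Cauchy product on t_m-coefficients.\<close>

lemma right_coeff_lact:
  assumes "g \<in> carrier (total H)" "b \<in> BP p"
  shows "right_coeff m k (lact H (\<phi> b) g) = (\<Oplus>\<^bsub>base H\<^esub>l\<in>{..k}.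
    \<phi> (coeff (t_part m (bp_runit p b)) l) \<otimes>\<^bsub>base H\<^esub> right_coeff m (k - l) g)"
proof -
  obtain r where r: "r \<in> base_lists" "conj H g = base_sum r"
    using conj_representation assms by metis
  let ?e = "bp_runit p b"
  have e: "?e \<in> BPBP p" by (rule bp_runit_in_BPBP[OF p_prime assms(2)])
  let ?c = "\<lambda>l. coeff (t_part m ?e) l"
  have c: "?c l \<in> BP p" for l by (rule coeff_t_part_in_BP[OF p_prime e])
  define r' where "r' = map (\<lambda>(a, b'). (a, ?e * b')) r"
  have r': "r' \<in> base_lists \<and> base_sum r' = \<Phi> ?e \<otimes>\<^bsub>total H\<^esub> base_sum r \<and>
      t_coeff m k r' = (\<Oplus>\<^bsub>base H\<^esub>l\<in>{..k}. \<phi> (?c l) \<otimes>\<^bsub>base H\<^esub> t_coeff m (k - l) r)"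
    unfolding r'_def using r(1)
  proof (induction r)
    case Nil
    then show ?case using e by (simp add: Phi_closed phi_closed c)
  next
    case (Cons x r)
    obtain a b' where x: "x = (a, b')" by (cases x)
    have ab: "a \<in> carrier (base H)" "b' \<in> BPBP p" "r \<in> base_lists" using Cons x by auto
    let ?c' = "\<lambda>l. coeff (t_part m b') l"
    have c': "?c' l \<in> BP p" for l by (rule coeff_t_part_in_BP[OF p_prime ab(2)])
    have "lact H a (\<Phi> (?e * b')) = lunit H a \<otimes>\<^bsub>total H\<^esub> \<Phi> ?e \<otimes>\<^bsub>total H\<^esub> \<Phi> b'"
      using ab e by (simp add: lact_def Phi_mult Phi_closed lunit_closed B.m_assoc)
    also have "\<dots> = \<Phi> ?e \<otimes>\<^bsub>total H\<^esub> lact H a (\<Phi> b')"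
      using ab e Phi_central[OF e lunit_closed[OF ab(1)]]
      by (simp add: lact_def Phi_closed lunit_closed B.m_assoc[symmetric])
    finally have 1: "lact H a (\<Phi> (?e * b')) = \<Phi> ?e \<otimes>\<^bsub>total H\<^esub> lact H a (\<Phi> b')" .
    have "a \<otimes>\<^bsub>base H\<^esub> \<phi> (coeff (t_part m (?e * b')) k) =
        a \<otimes>\<^bsub>base H\<^esub> (\<Oplus>\<^bsub>base H\<^esub>l\<in>{..k}. \<phi> (?c l) \<otimes>\<^bsub>base H\<^esub> \<phi> (?c' (k - l)))"
      using c c' by (simp add: t_part.hom_mult coeff_mult phi_sum BP.mult_in phi_mult)
    also have "\<dots> = (\<Oplus>\<^bsub>base H\<^esub>l\<in>{..k}. a \<otimes>\<^bsub>base H\<^esub> (\<phi> (?c l) \<otimes>\<^bsub>base H\<^esub> \<phi> (?c' (k - l))))"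
      by (rule A.finsum_rdistr) (auto intro!: A.m_closed phi_closed c c' ab)
    also have "\<dots> = (\<Oplus>\<^bsub>base H\<^esub>l\<in>{..k}. \<phi> (?c l) \<otimes>\<^bsub>base H\<^esub> (a \<otimes>\<^bsub>base H\<^esub> \<phi> (?c' (k - l))))"
      using ab(1) c c' phi_central[OF c ab(1)]
      by (intro A.finsum_cong') (auto simp: phi_closed A.m_assoc[symmetric])
    finally have 2: "a \<otimes>\<^bsub>base H\<^esub> \<phi> (coeff (t_part m (?e * b')) k) =
      (\<Oplus>\<^bsub>base H\<^esub>l\<in>{..k}. \<phi> (?c l) \<otimes>\<^bsub>base H\<^esub> (a \<otimes>\<^bsub>base H\<^esub> \<phi> (?c' (k - l))))" .
    have 3: "(\<Oplus>\<^bsub>base H\<^esub>l\<in>{..k}. \<phi> (?c l) \<otimes>\<^bsub>base H\<^esub> t_coeff m (k - l) (x # r)) =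
        (\<Oplus>\<^bsub>base H\<^esub>l\<in>{..k}. \<phi> (?c l) \<otimes>\<^bsub>base H\<^esub> (a \<otimes>\<^bsub>base H\<^esub> \<phi> (?c' (k - l)))) \<oplus>\<^bsub>base H\<^esub>
        (\<Oplus>\<^bsub>base H\<^esub>l\<in>{..k}. \<phi> (?c l) \<otimes>\<^bsub>base H\<^esub> t_coeff m (k - l) r)"
      using ab c c' unfolding x
      by (subst A.finsum_addf[symmetric]) (auto simp: A.r_distr phi_closed)
    show ?case
      using Cons.IH ab e 1 2 3 x
      by (auto simp: BPBP.mult_in B.r_distr Phi_closed lact_closed)
  qed
  have "conj H (lact H (\<phi> b) g) = base_sum r'"
    using assms r r'
    by (simp add: lact_def ring_hom_mult[OF conj_hom] phi_closed lunit_closed conj_lunit hom_runit)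
  then have "right_coeff m k (lact H (\<phi> b) g) = t_coeff m k r'"
    using r' by (intro right_coeff_eq) auto
  then show ?thesis using r r' by (simp add: right_coeff_eq)
qed

text \<open>The constant coefficient of \<open>t_part\<close> is the counit of BP_*BP, which
  \<open>\<Phi>\<close> respects, and the counit is invariant under conjugation.\<close>

lemma right_coeff_counit:
  assumes "g \<in> carrier (total H)"
  shows "right_coeff m 0 g = counit H g"
proof -
  obtain r where r: "r \<in> base_lists" "conj H g = base_sum r"
    using conj_representation assms by metis
  have "t_coeff m 0 r = counit H (base_sum r)"
    using r(1)
  proof (induction r)
    case Nil
    then show ?case using ring_hom_zero[OF counit_hom B.ring_axioms A.ring_axioms] by simp
  next
    case (Cons x r)
    obtain a b where x: "x = (a, b)" by (cases x)
    have ab: "a \<in> carrier (base H)" "b \<in> BPBP p" "r \<in> base_lists" using Cons x by auto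
    then show ?case using Cons x
      by (simp add: ring_hom_add[OF counit_hom] ring_hom_mult[OF counit_hom] lact_def lunit_closed
          Phi_closed counit_lunit coeff_t_part_0 hom_counit)
  qed
  then show ?thesis using r counit_conj[OF assms] by (simp add: right_coeff_eq)
qed

lemma right_coeff_eventually_0:
  assumes "g \<in> carrier (total H)"
  shows "\<exists>N. \<forall>k>N. right_coeff m k g = \<zero>\<^bsub>base H\<^esub>"
proof -
  obtain r where r: "r \<in> base_lists" "conj H g = base_sum r"
    using conj_representation assms by metis
  have "\<exists>N. \<forall>k>N. t_coeff m k r = \<zero>\<^bsub>base H\<^esub>"
    using r(1)
  proof (induction r)
    case (Cons x r)
    obtain a b where x: "x = (a, b)" by (cases x)
    obtain N where N: "\<forall>k>N. t_coeff m k r = \<zero>\<^bsub>base H\<^esub>" using Cons by auto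
    have "\<forall>k>max N (degree (t_part m b)). t_coeff m k (x # r) = \<zero>\<^bsub>base H\<^esub>"
      using N Cons.hyps x by (auto simp: coeff_eq_0 phi_0)
    then show ?case by blast
  qed simp
  then show ?thesis using r by (simp add: right_coeff_eq)
qed

end

section \<open>Torsion in comodules\<close>

locale bp_comodule = motivic_bp_hopf_algebroid H p \<phi> \<Phi> + comodule H M \<psi>
  for H :: "('a, 'g) hopf_data" and p :: nat and \<phi> :: "bp_poly \<Rightarrow> 'a" and \<Phi> :: "bp_poly \<Rightarrow> 'g"
    and M :: "('a, 'm) module" and \<psi> :: "'m \<Rightarrow> ('g \<times> 'm) list set"
begin

interpretation B: bigraded_ring "total H" "total_gr H" by (rule total_ring)
interpretation BP: local_alg p "BP p" by (rule local_alg_BP[OF p_prime])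

text \<open>The k-th coefficient of the image in M[t_m] of the tensor that \<open>s\<close>
  represents.\<close>

definition co_coeff :: "nat \<Rightarrow> nat \<Rightarrow> ('g \<times> 'm) list \<Rightarrow> 'm"
  where "co_coeff m k s = list_sum M (map (\<lambda>(g, z). right_coeff m k g \<odot>\<^bsub>M\<^esub> z) s)"

abbreviation co_lists :: "('g \<times> 'm) list set"
  where "co_lists \<equiv> lists (carrier (total H) \<times> carrier M)"

lemma zero_smult: "x \<in> carrier M \<Longrightarrow> \<zero>\<^bsub>base H\<^esub> \<odot>\<^bsub>M\<^esub> x = \<zero>\<^bsub>M\<^esub>"
  using smult_l_distr[of "\<zero>\<^bsub>base H\<^esub>" "\<zero>\<^bsub>base H\<^esub>" x] smult_closed[of "\<zero>\<^bsub>base H\<^esub>" x]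
  by (simp add: M.add.l_cancel_one')

interpretation act: ring_action M "BP p" "\<lambda>b x. \<phi> b \<odot>\<^bsub>M\<^esub> x"
  by unfold_locales
    (auto simp: BP.closed phi_closed phi_add phi_mult smult_closed smult_l_distr smult_r_distr
      smult_assoc)

lemma co_coeff_Nil [simp]: "co_coeff m k [] = \<zero>\<^bsub>M\<^esub>"
  and co_coeff_Cons [simp]:
    "co_coeff m k ((g, z) # s) = right_coeff m k g \<odot>\<^bsub>M\<^esub> z \<oplus>\<^bsub>M\<^esub> co_coeff m k s"
  by (simp_all add: co_coeff_def)

lemma co_coeff_closed [simp]: "s \<in> co_lists \<Longrightarrow> co_coeff m k s \<in> carrier M"
  by (induction s) (auto simp: smult_closed right_coeff_closed)

lemma co_coeff_append:
  "s \<in> co_lists \<Longrightarrow> t \<in> co_lists \<Longrightarrow> co_coeff m k (s @ t) = co_coeff m k s \<oplus>\<^bsub>M\<^esub> co_coeff m k t"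
  unfolding co_coeff_def map_append
  by (rule M.list_sum_append) (auto simp: smult_closed right_coeff_closed)

text \<open>Right linearity of \<open>right_coeff\<close> is exactly the balancing condition over
  the base, so the coefficients depend only on the class.\<close>

lemma coaction_class:
  assumes "x \<in> carrier M"
  obtains s where "s \<in> \<psi> x" "s \<in> co_lists"
    "\<And>t m k. t \<in> \<psi> x \<Longrightarrow> t \<in> co_lists \<and> co_coeff m k t = co_coeff m k s"
proof -
  obtain s where s: "s \<in> \<psi> x" "s \<in> co_lists"
    "\<And>t. t \<in> \<psi> x \<Longrightarrow> tensor_eq (base H) (total H) (ract H) M (\<lambda>a z. a \<odot>\<^bsub>M\<^esub> z) s t"
    using tensor_class[OF coact_closed[OF assms, unfolded total_tensor_def]] by blast
  have "t \<in> co_lists \<and> co_coeff m k t = co_coeff m k s" if "t \<in> \<psi> x" for t m k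
  proof -
    let ?f = "\<lambda>(g, z). right_coeff m k g \<odot>\<^bsub>M\<^esub> z"
    have "s \<in> co_lists \<and> t \<in> co_lists \<and> list_sum M (map ?f s) = list_sum M (map ?f t)"
      using s(3)[OF that]
      by (rule M.tensor_eq_list_sum)
        (auto simp: smult_closed right_coeff_closed right_coeff_0 right_coeff_add right_coeff_ract
          zero_smult smult_l_distr smult_r_distr smult_assoc ract_closed)
    then show ?thesis by (simp add: co_coeff_def)
  qed
  with s show ?thesis using that by blast
qed

lemma co_coeff_lact:
  assumes "s \<in> co_lists" "b \<in> BP p"
  shows "co_coeff m k (map (\<lambda>(g, z). (lact H (\<phi> b) g, z)) s) =
    (\<Oplus>\<^bsub>M\<^esub>l\<in>{..k}. \<phi> (coeff (t_part m (bp_runit p b)) l) \<odot>\<^bsub>M\<^esub> co_coeff m (k - l) s)"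
proof -
  let ?c = "\<lambda>l. coeff (t_part m (bp_runit p b)) l"
  have c: "\<phi> (?c l) \<in> carrier (base H)" for l
    by (rule phi_coeff_closed[OF bp_runit_in_BPBP[OF p_prime assms(2)]])
  have c_BP: "?c l \<in> BP p" for l
    by (rule coeff_t_part_in_BP[OF p_prime bp_runit_in_BPBP[OF p_prime assms(2)]])
  show ?thesis
    using assms(1)
  proof (induction s)
    case Nil
    then show ?case using act.act_0_right[OF c_BP] by simp
  next
    case (Cons x s)
    obtain g z where x: "x = (g, z)" by (cases x)
    have gz: "g \<in> carrier (total H)" "z \<in> carrier M" "s \<in> co_lists" using Cons x by auto
    have smult_sum: "(\<Oplus>\<^bsub>base H\<^esub>i\<in>I. f i) \<odot>\<^bsub>M\<^esub> z = (\<Oplus>\<^bsub>M\<^esub>i\<in>I. f i \<odot>\<^bsub>M\<^esub> z)"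
      if "finite I" "f \<in> I \<rightarrow> carrier (base H)" for I :: "nat set" and f
      using that
    proof (induction I rule: finite_induct)
      case empty
      then show ?case using gz by (simp add: zero_smult)
    next
      case (insert i I)
      then have "f i \<in> carrier (base H)" "f \<in> I \<rightarrow> carrier (base H)" by auto
      moreover from this have "(\<lambda>i. f i \<odot>\<^bsub>M\<^esub> z) \<in> I \<rightarrow> carrier M" "f i \<odot>\<^bsub>M\<^esub> z \<in> carrier M"
        using gz by (auto intro: smult_closed)
      ultimately show ?case using insert gz by (simp add: smult_l_distr)
    qed
    have "right_coeff m k (lact H (\<phi> b) g) \<odot>\<^bsub>M\<^esub> z =
        (\<Oplus>\<^bsub>M\<^esub>l\<in>{..k}. (\<phi> (?c l) \<otimes>\<^bsub>base H\<^esub> right_coeff m (k - l) g) \<odot>\<^bsub>M\<^esub> z)"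
      unfolding right_coeff_lact[OF gz(1) assms(2)]
      by (rule smult_sum) (auto intro!: c right_coeff_closed gz)
    also have "\<dots> = (\<Oplus>\<^bsub>M\<^esub>l\<in>{..k}. \<phi> (?c l) \<odot>\<^bsub>M\<^esub> (right_coeff m (k - l) g \<odot>\<^bsub>M\<^esub> z))"
      using gz c by (intro M.finsum_cong') (auto simp: smult_assoc right_coeff_closed smult_closed)
    finally have 1: "right_coeff m k (lact H (\<phi> b) g) \<odot>\<^bsub>M\<^esub> z = \<dots>" .
    have "(\<Oplus>\<^bsub>M\<^esub>l\<in>{..k}. \<phi> (?c l) \<odot>\<^bsub>M\<^esub> co_coeff m (k - l) (x # s)) =
        (\<Oplus>\<^bsub>M\<^esub>l\<in>{..k}. \<phi> (?c l) \<odot>\<^bsub>M\<^esub> (right_coeff m (k - l) g \<odot>\<^bsub>M\<^esub> z)) \<oplus>\<^bsub>M\<^esub>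
        (\<Oplus>\<^bsub>M\<^esub>l\<in>{..k}. \<phi> (?c l) \<odot>\<^bsub>M\<^esub> co_coeff m (k - l) s)"
      using gz c unfolding x
      by (subst M.finsum_addf[symmetric])
        (auto simp: smult_r_distr smult_closed right_coeff_closed)
    then show ?case using Cons.IH 1 x by simp
  qed
qed

lemma coeff_runit_nilpotent:
  assumes x: "x \<in> carrier M" and b: "b \<in> BP p" and j: "\<phi> (b ^ j) \<odot>\<^bsub>M\<^esub> x = \<zero>\<^bsub>M\<^esub>"
  shows "coeff (t_part m (bp_runit p b)) k \<in> act.nil_ideal x"
proof -
  obtain s where s: "s \<in> \<psi> x" "s \<in> co_lists" using coaction_class[OF x] by metis
  define h where "h k = co_coeff m k s" for k
  have h: "h k \<in> carrier M" for k using s by (simp add: h_def)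
  have h_0: "h 0 = x"
  proof -
    have "map (\<lambda>(g, z). right_coeff m 0 g \<odot>\<^bsub>M\<^esub> z) s = map (\<lambda>(g, z). counit H g \<odot>\<^bsub>M\<^esub> z) s"
      using s(2) by (auto simp: right_coeff_counit)
    then show ?thesis using coact_counit[OF x s(1)] unfolding h_def co_coeff_def by (simp only:)
  qed
  have "\<exists>E. \<forall>k>E. co_coeff m k s = \<zero>\<^bsub>M\<^esub>"
    using s(2)
  proof (induction s)
    case (Cons y s)
    obtain g z where y: "y = (g, z)" by (cases y)
    have gz: "g \<in> carrier (total H)" "z \<in> carrier M" using Cons y by auto
    obtain N E where N: "\<forall>k>N. right_coeff m k g = \<zero>\<^bsub>base H\<^esub>" "\<forall>k>E. co_coeff m k s = \<zero>\<^bsub>M\<^esub>"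
      using right_coeff_eventually_0[OF gz(1), of m] Cons.IH by blast
    have "\<forall>k>max N E. co_coeff m k (y # s) = \<zero>\<^bsub>M\<^esub>"
      using N gz y by (simp add: zero_smult)
    then show ?case by blast
  qed simp
  then obtain E where E: "\<And>k. k > E \<Longrightarrow> h k = \<zero>\<^bsub>M\<^esub>" unfolding h_def by blast
  let ?F = "t_part m (bp_runit p b)"
  have bj: "b ^ j \<in> BP p" using b by (rule BP.power_in)
  have coeffs: "coeff (t_part m (bp_runit p c)) l \<in> BP p" if "c \<in> BP p" for c l
    by (rule coeff_t_part_in_BP[OF p_prime bp_runit_in_BPBP[OF p_prime that]])
  have "map (\<lambda>(g, z). (lact H (\<phi> (b ^ j)) g, z)) s \<in> \<psi> \<zero>\<^bsub>M\<^esub>"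
    using coact_smult[OF phi_closed[OF bj] x s(1)] j by simp
  moreover have "co_coeff m k t = \<zero>\<^bsub>M\<^esub>" if t: "t \<in> \<psi> \<zero>\<^bsub>M\<^esub>" for t k
  proof -
    obtain s0 where s0: "s0 \<in> co_lists"
      "\<And>t m k. t \<in> \<psi> \<zero>\<^bsub>M\<^esub> \<Longrightarrow> t \<in> co_lists \<and> co_coeff m k t = co_coeff m k s0"
      using coaction_class[OF M.zero_closed] by metis
    \<comment> \<open>By additivity \<open>t @ t\<close> represents the same tensor as
      \<open>t\<close>, so each coefficient equals its own double and is zero.\<close>
    have "t @ t \<in> \<psi> \<zero>\<^bsub>M\<^esub>" using coact_add[OF M.zero_closed M.zero_closed t t] by simp
    then have "co_coeff m k t \<oplus>\<^bsub>M\<^esub> co_coeff m k t = co_coeff m k t"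
      using s0(2) t co_coeff_append by metis
    moreover have "co_coeff m k t \<in> carrier M" using s0(2)[OF t] co_coeff_closed by metis
    ultimately show ?thesis by (simp add: M.add.l_cancel_one')
  qed
  ultimately have "(\<Oplus>\<^bsub>M\<^esub>l\<in>{..k}. \<phi> (coeff (?F ^ j) l) \<odot>\<^bsub>M\<^esub> h (k - l)) = \<zero>\<^bsub>M\<^esub>" for k
    using co_coeff_lact[OF s(2) bj, of m k]
    by (simp add: h_def bp_runit.hom_power t_part.hom_power)
  moreover have "?F \<in> act.S_poly" "?F ^ j \<in> act.S_poly"
    using coeffs[OF b] coeffs[OF bj]
    by (simp_all add: act.S_poly_def bp_runit.hom_power t_part.hom_power)
  ultimately have "?F ^ j \<in> act.ann_poly h" by (simp add: act.ann_poly_def)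
  \<comment> \<open>Nilpotence holds on every coefficient of \<open>h\<close>; the index 0 is chosen
    because \<open>h 0\<close> is \<open>x\<close>.\<close>
  then have "\<exists>i\<ge>1. \<phi> (coeff ?F k ^ i) \<odot>\<^bsub>M\<^esub> h 0 = \<zero>\<^bsub>M\<^esub>"
    by (intro act.coeff_nilpotent[where h = h and E = E and d = "Suc (degree ?F)" and N = j])
      (use h E \<open>?F \<in> act.S_poly\<close> in \<open>auto simp: coeff_eq_0\<close>)
  then show ?thesis using coeffs[OF b] by (simp add: act.nil_ideal_def h_0)
qed

lemma generator_torsion:
  assumes w: "bp_generators p w" and n: "n \<ge> 1" and x: "x \<in> carrier M"
    and tors: "torsion_element (base H) M (\<phi> (w n)) x"
  shows "torsion_element (base H) M (\<phi> (w (n - 1))) x"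
proof -
  have wn: "w n \<in> BP p" using w n unfolding bp_generators_def by auto
  obtain j where j: "\<phi> (w n ^ j) \<odot>\<^bsub>M\<^esub> x = \<zero>\<^bsub>M\<^esub>"
    using tors phi_power[OF wn] unfolding torsion_element_def by metis
  have "w (n - 1) \<in> act.nil_ideal x"
  proof (rule generator_in_coefficient_ideal[OF p_prime w n])
    show "act.nil_ideal x \<subseteq> BP p" by (auto simp: act.nil_ideal_def)
    show "coeff (t_part m (bp_runit p (w n))) k \<in> act.nil_ideal x" for m k
      by (rule coeff_runit_nilpotent[OF x wn j])
  qed (auto intro: act.nil_ideal_0 act.nil_ideal_add act.nil_ideal_mult x)
  then show ?thesis
    unfolding act.nil_ideal_def torsion_element_def using phi_power by auto
qed

end

theorem theorem9p1p1:
  fixes H :: "('a, 'g) hopf_data" and p n :: nat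
    and \<phi> :: "bp_poly \<Rightarrow> 'a" and \<Phi> :: "bp_poly \<Rightarrow> 'g"
    and w :: "nat \<Rightarrow> bp_poly"
    and M :: "('a, 'm) module" and \<psi> :: "'m \<Rightarrow> ('g \<times> 'm) list set" and x :: 'm
  assumes "motivic_bp_hopf_algebroid H p \<phi> \<Phi>"
    and "bp_generators p w"
    and "comodule H M \<psi>"
    and "n \<ge> 1"
    and "x \<in> carrier M"
    and "torsion_element (base H) M (\<phi> (w n)) x"
  shows "torsion_element (base H) M (\<phi> (w (n - 1))) x"
proof -
  interpret bp_comodule H p \<phi> \<Phi> M \<psi>
    using assms(1,3) by (rule bp_comodule.intro)
  show ?thesis by (rule generator_torsion[OF assms(2,4,5,6)])
qed

end
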